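(* For every MLO formula $\psi(X,Y,P)$ and every $\mathbf{P}\subseteq\mathbb{N}$, writing $M=\langle\mathbb{N},<,\mathbf{P}\rangle$: either there is a C-operator $F$ that is MLO-definable in $M$ such that $M\models\forall X\,\psi(X,F(X),P)$, or there is an SC-operator $G$ that is MLO-definable in $M$ such that $M\models\forall Y\,\neg\psi(G(Y),Y,P)$. Moreover, formulas defining these operators are computable from $\psi$.
   Context: MLO is monadic second-order logic over $<$ and unary predicate symbols, interpreted in $\langle\mathbb{N},<,\mathbf{P}\rangle$ with set variables ranging over subsets of $\mathbb{N}$ (identified with $\omega$-strings over $\{0,1\}$). An operator $F:\{0,1\}^\omega\to\{0,1\}^\omega$ is causal (C-operator) if whenever $X,X'$ coincide on $[0,t]$ then $F(X),F(X')$ coincide on $[0,t]$; strongly causal (SC-operator) if whenever $X,X'$ coincide on $[0,t)$ then $F(X),F(X')$ coincide on $[0,t]$. $F$ is MLO-definable in $M$ if there is an MLO formula $\theta(X,Y,P)$ such that for all $\mathbf{X},\mathbf{Y}\subseteq\mathbb{N}$: $\mathbf{Y}=F(\mathbf{X})$ iff $M\models\theta(\mathbf{X},\mathbf{Y},\mathbf{P})$. *)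

theory Defs
  imports Main "HOL-Library.Nat_Bijection"
begin

section \<open>Monadic logic of order over a single unary predicate symbol\<close>

text \<open>
  First-order variables and set variables are two separate sorts, each named by natural
  numbers. The remaining connectives and the universal quantifiers are the usual derived ones.
\<close>

datatype mlo =
    Less nat nat
  | Equal nat nat
  | Elem nat nat   \<comment> \<open>\<open>Elem t X\<close>: the first-order variable \<open>t\<close> belongs to the set variable \<open>X\<close>\<close>
  | Param nat      \<comment> \<open>\<open>Param t\<close>: the predicate symbol \<open>P\<close> of the structure holds at \<open>t\<close>\<close>
  | Neg mlo
  | Conj mlo mlo
  | ExElem nat mlo
  | ExSet nat mlo

primrec sat :: "nat set \<Rightarrow> (nat \<Rightarrow> nat) \<Rightarrow> (nat \<Rightarrow> nat set) \<Rightarrow> mlo \<Rightarrow> bool" where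
  "sat P e s (Less t u) \<longleftrightarrow> e t < e u"
| "sat P e s (Equal t u) \<longleftrightarrow> e t = e u"
| "sat P e s (Elem t X) \<longleftrightarrow> e t \<in> s X"
| "sat P e s (Param t) \<longleftrightarrow> e t \<in> P"
| "sat P e s (Neg \<phi>) \<longleftrightarrow> \<not> sat P e s \<phi>"
| "sat P e s (Conj \<phi> \<chi>) \<longleftrightarrow> sat P e s \<phi> \<and> sat P e s \<chi>"
| "sat P e s (ExElem t \<phi>) \<longleftrightarrow> (\<exists>n. sat P (e(t := n)) s \<phi>)"
| "sat P e s (ExSet X \<phi>) \<longleftrightarrow> (\<exists>A. sat P e (s(X := A)) \<phi>)"

primrec free_elem :: "mlo \<Rightarrow> nat set" where
  "free_elem (Less t u) = {t, u}"
| "free_elem (Equal t u) = {t, u}"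
| "free_elem (Elem t X) = {t}"
| "free_elem (Param t) = {t}"
| "free_elem (Neg \<phi>) = free_elem \<phi>"
| "free_elem (Conj \<phi> \<chi>) = free_elem \<phi> \<union> free_elem \<chi>"
| "free_elem (ExElem t \<phi>) = free_elem \<phi> - {t}"
| "free_elem (ExSet X \<phi>) = free_elem \<phi>"

primrec free_set :: "mlo \<Rightarrow> nat set" where
  "free_set (Less t u) = {}"
| "free_set (Equal t u) = {}"
| "free_set (Elem t X) = {X}"
| "free_set (Param t) = {}"
| "free_set (Neg \<phi>) = free_set \<phi>"
| "free_set (Conj \<phi> \<chi>) = free_set \<phi> \<union> free_set \<chi>"
| "free_set (ExElem t \<phi>) = free_set \<phi>"
| "free_set (ExSet X \<phi>) = free_set \<phi> - {X}"

text \<open>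
  A formula \<open>\<phi>(X,Y,P)\<close>: the set variables \<open>X\<close> and \<open>Y\<close> are those numbered 0 and 1,
  and no other variable is free.
\<close>

definition formula_XY :: "mlo \<Rightarrow> bool" where
  "formula_XY \<phi> \<longleftrightarrow> free_elem \<phi> = {} \<and> free_set \<phi> \<subseteq> {0, 1}"

text \<open>
  \<open>holds P A B \<phi>\<close> is \<open>M \<Turnstile> \<phi>(A,B,P)\<close> for \<open>M = (\<nat>, <, P)\<close>. The values given to the
  other variables are irrelevant for formulas satisfying \<open>formula_XY\<close>.
\<close>

definition holds :: "nat set \<Rightarrow> nat set \<Rightarrow> nat set \<Rightarrow> mlo \<Rightarrow> bool" where
  "holds P A B \<phi> \<longleftrightarrow> sat P (\<lambda>_. 0) ((\<lambda>_. {})(0 := A, 1 := B)) \<phi>"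


section \<open>Operators\<close>

definition causal :: "(nat set \<Rightarrow> nat set) \<Rightarrow> bool" where
  "causal F \<longleftrightarrow> (\<forall>t X X'. X \<inter> {..t} = X' \<inter> {..t} \<longrightarrow> F X \<inter> {..t} = F X' \<inter> {..t})"

definition strongly_causal :: "(nat set \<Rightarrow> nat set) \<Rightarrow> bool" where
  "strongly_causal F \<longleftrightarrow>
     (\<forall>t X X'. X \<inter> {..<t} = X' \<inter> {..<t} \<longrightarrow> F X \<inter> {..t} = F X' \<inter> {..t})"

text \<open>
  In a defining formula the variable \<open>X\<close> is the argument and \<open>Y\<close> the value, whichever
  role the operator plays in the game.
\<close>

definition mlo_defines :: "nat set \<Rightarrow> mlo \<Rightarrow> (nat set \<Rightarrow> nat set) \<Rightarrow> bool" where
  "mlo_defines P \<theta> F \<longleftrightarrow> formula_XY \<theta> \<and> (\<forall>A B. B = F A \<longleftrightarrow> holds P A B \<theta>)"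

definition mlo_definable :: "nat set \<Rightarrow> (nat set \<Rightarrow> nat set) \<Rightarrow> bool" where
  "mlo_definable P F \<longleftrightarrow> (\<exists>\<theta>. mlo_defines P \<theta> F)"


section \<open>Computable transformations of formulas\<close>

text \<open>
  The total recursive functions: the least class containing zero, successor and projections and
  closed under composition, primitive recursion and minimization of regular functions.
  An \<open>n\<close>-ary function is represented on lists; only its values on lists of length \<open>n\<close> matter.
\<close>

inductive recursive :: "nat \<Rightarrow> (nat list \<Rightarrow> nat) \<Rightarrow> bool" where
  zero: "recursive n (\<lambda>_. 0)"
| suc: "recursive 1 (\<lambda>xs. Suc (xs ! 0))"
| proj: "i < n \<Longrightarrow> recursive n (\<lambda>xs. xs ! i)"
| comp: "\<lbrakk>recursive (length hs) g; \<forall>h\<in>set hs. recursive n h\<rbrakk>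
    \<Longrightarrow> recursive n (\<lambda>xs. g (map (\<lambda>h. h xs) hs))"
| prim_rec: "\<lbrakk>recursive n g; recursive (Suc (Suc n)) h\<rbrakk>
    \<Longrightarrow> recursive (Suc n) (\<lambda>xs. rec_nat (g (tl xs)) (\<lambda>k r. h (k # r # tl xs)) (hd xs))"
| minimization: "\<lbrakk>recursive (Suc n) g; \<forall>xs. length xs = n \<longrightarrow> (\<exists>k. g (k # xs) = 0)\<rbrakk>
    \<Longrightarrow> recursive n (\<lambda>xs. LEAST k. g (k # xs) = 0)"

primrec mlo_code :: "mlo \<Rightarrow> nat" where
  "mlo_code (Less t u) = prod_encode (0, prod_encode (t, u))"
| "mlo_code (Equal t u) = prod_encode (1, prod_encode (t, u))"
| "mlo_code (Elem t X) = prod_encode (2, prod_encode (t, X))"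
| "mlo_code (Param t) = prod_encode (3, t)"
| "mlo_code (Neg \<phi>) = prod_encode (4, mlo_code \<phi>)"
| "mlo_code (Conj \<phi> \<chi>) = prod_encode (5, prod_encode (mlo_code \<phi>, mlo_code \<chi>))"
| "mlo_code (ExElem t \<phi>) = prod_encode (6, prod_encode (t, mlo_code \<phi>))"
| "mlo_code (ExSet X \<phi>) = prod_encode (7, prod_encode (X, mlo_code \<phi>))"

lemma mlo_code_inject: "mlo_code \<phi> = mlo_code \<chi> \<longleftrightarrow> \<phi> = \<chi>"
  by (induction \<phi> arbitrary: \<chi>; case_tac \<chi>; simp)

definition computable :: "(mlo \<Rightarrow> mlo) \<Rightarrow> bool" where
  "computable f \<longleftrightarrow> (\<exists>r. recursive 1 r \<and> (\<forall>\<phi>. r [mlo_code \<phi>] = mlo_code (f \<phi>)))"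

end

theory Submission
  imports Defs "HOL-Library.Infinite_Set" "HOL-Library.Ramsey"
begin

text \<open>
  The \<open>k\<close>-types of finite segments of a structure form a finite algebra under concatenation, and
  the types of the blocks of a factorization of \<open>\<nat>\<close> decide all formulas of quantifier rank \<open>k\<close>.
  Remembering one starting position for each class of starting positions with the same type up to
  the present gives a deterministic parity automaton for \<open>\<psi>\<close>, with \<open>P\<close> built into its
  time-dependent transitions. Positional determinacy of the parity game on (time, state) then
  provides a winning strategy with finite memory, whose size is bounded recursively in \<open>\<psi>\<close>.

  Such a strategy is a tuple of subsets of \<open>\<nat>\<close> and being a winning one is expressible in MLO, so
  the formula may quantify over strategies; no automaton has to be computed. To define a single
  operator the formula picks a canonical winning tuple \<open>A\<close>. It ranges over the pairs of such a
  tuple and an unbounded set \<open>D\<close> whose consecutive elements cut \<open>A\<close> into blocks of one type, and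
  takes the greedy least pair. The limit of the greedy choices is again winning because its blocks
  have the type of the blocks of its approximations. Equality of types is itself
  definable, by the back-and-forth recursion on \<open>k\<close>.
\<close>

section \<open>Types of segments\<close>

text \<open>The winner depends on \<open>P\<close>, which is not part of the input, so the two
  formulas computed from \<psi> must serve every \<open>P\<close>: they see it only through
  \<open>Param\<close>, and all bounds depend on the code of \<psi> alone. That both players cannot
  win (\<open>not_both_win\<close>) shows which of the two formulas is right. The winning strategy
  varies with time, so it is not a finite object but a tuple of subsets of the structure. The
  winning tuples form a definable set with no evident definable member. Taking a lexicographic
  minimum does not work directly: winning is a parity condition and not a closed one, so a limit of
  winning tuples need not win. The set \<open>D\<close> of cuts repairs this. Ramsey's theorem
  provides some \<open>D\<close> for every winning tuple; homogeneity is a matter of finite prefixes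
  and hence passes to limits; and agreement with a single approximation up to the second cut already
  fixes the types of all blocks of the limit.\<close>

lemma sat_cong:
  "(\<And>t. t \<in> free_elem \<phi> \<Longrightarrow> e t = e' t) \<Longrightarrow> (\<And>X. X \<in> free_set \<phi> \<Longrightarrow> s X = s' X)
    \<Longrightarrow> sat P e s \<phi> \<longleftrightarrow> sat P e' s' \<phi>"
proof (induction \<phi> arbitrary: e e' s s')
  case (Conj \<phi> \<chi>)
  have "sat P e s \<phi> = sat P e' s' \<phi>" "sat P e s \<chi> = sat P e' s' \<chi>"
    using Conj.prems by (auto intro!: Conj.IH)
  then show ?case by simp
next
  case (ExElem t \<phi>)
  have "sat P (e(t := n)) s \<phi> = sat P (e'(t := n)) s' \<phi>" for n
    using ExElem.prems by (intro ExElem.IH) auto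
  then show ?case by simp
next
  case (ExSet X \<phi>)
  have "sat P e (s(X := B)) \<phi> = sat P e' (s'(X := B)) \<phi>" for B
    using ExSet.prems by (intro ExSet.IH) auto
  then show ?case by simp
next
  case (Neg \<phi>)
  have "sat P e s \<phi> = sat P e' s' \<phi>" using Neg.prems by (intro Neg.IH) auto
  then show ?case by simp
qed simp_all

lemma sat_eq_holds: "formula_XY \<phi> \<Longrightarrow> sat P e s \<phi> \<longleftrightarrow> holds P (s 0) (s 1) \<phi>"
  unfolding holds_def formula_XY_def by (rule sat_cong) auto

lemma prod_encode_mono: "a \<le> a' \<Longrightarrow> b \<le> b' \<Longrightarrow> prod_encode (a, b) \<le> prod_encode (a', b')"
proof -
  assume *: "a \<le> a'" "b \<le> b'"
  have "mono triangle" by (rule mono_iff_le_Suc[THEN iffD2]) simp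
  then show ?thesis using * by (auto simp: prod_encode_def intro!: add_mono elim!: monoD)
qed

lemma prod_encode_less:
  assumes "a \<le> a'" "b \<le> b'" "a < a' \<or> b < b'"
  shows "prod_encode (a, b) < prod_encode (a', b')"
proof -
  have "prod_encode (a, b) \<noteq> prod_encode (a', b')" using assms by auto
  with prod_encode_mono[OF assms(1,2)] show ?thesis by (rule le_neq_trans)
qed

lemma set_encode_less: "A \<subseteq> {..<b} \<Longrightarrow> set_encode A < 2 ^ b"
proof -
  assume "A \<subseteq> {..<b}"
  then have "set_encode A \<le> (\<Sum>i<b. 2 ^ i)"
    unfolding set_encode_def by (intro sum_mono2) auto
  also have "\<dots> < 2 ^ b" by (induction b) auto
  finally show ?thesis .
qed

text \<open>Element variables are represented by singleton components. \<open>meet\<close> then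
  covers equality, membership and the predicate \<open>P\<close>, and \<open>before\<close> covers
  the order, so these two are all the atomic information.\<close>

definition meet :: "nat \<Rightarrow> nat \<Rightarrow> (nat \<Rightarrow> nat set) \<Rightarrow> nat \<Rightarrow> nat \<Rightarrow> bool" where
  "meet s t A i j \<longleftrightarrow> (\<exists>a. s \<le> a \<and> a < t \<and> a \<in> A i \<and> a \<in> A j)"

definition before :: "nat \<Rightarrow> nat \<Rightarrow> (nat \<Rightarrow> nat set) \<Rightarrow> nat \<Rightarrow> nat \<Rightarrow> bool" where
  "before s t A i j \<longleftrightarrow> (\<exists>a b. s \<le> a \<and> a < b \<and> b < t \<and> a \<in> A i \<and> b \<in> A j)"

definition atoms :: "nat \<Rightarrow> nat \<Rightarrow> nat \<Rightarrow> (nat \<Rightarrow> nat set) \<Rightarrow> nat set" where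
  "atoms n s t A = {x. \<exists>i<n. \<exists>j<n. x = prod_encode (0, prod_encode (i, j)) \<and> meet s t A i j
     \<or> x = prod_encode (1, prod_encode (i, j)) \<and> before s t A i j}"

text \<open>The component quantified at level \<open>k + 1\<close> has number \<open>m + k\<close>, above the \<open>m\<close> given ones.\<close>

primrec tp :: "nat \<Rightarrow> nat \<Rightarrow> nat \<Rightarrow> nat \<Rightarrow> nat \<Rightarrow> (nat \<Rightarrow> nat set) \<Rightarrow> nat" where
  "tp m n 0 s t A = set_encode (atoms n s t A)"
| "tp m n (Suc k) s t A = set_encode (range (\<lambda>B. tp m n k s t (A(m + k := B))))"

text \<open>The bound involves neither the segment nor the sets. This makes the later number of
  automaton states a recursive function of the formula, uniformly in \<open>P\<close>.\<close>

primrec tp_bound :: "nat \<Rightarrow> nat \<Rightarrow> nat" where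
  "tp_bound n 0 = 2 ^ prod_encode (2, prod_encode (n, n))"
| "tp_bound n (Suc k) = 2 ^ tp_bound n k"

lemma atoms_subset: "atoms n s t A \<subseteq> {..<prod_encode (2, prod_encode (n, n))}"
  by (auto simp: atoms_def intro!: prod_encode_less prod_encode_mono)

lemma tp_less: "tp m n k s t A < tp_bound n k"
  by (induction k arbitrary: A) (auto intro!: set_encode_less atoms_subset[THEN subsetD])

lemma finite_tp_range: "finite (range (\<lambda>B. tp m n k s t (f B)))"
  by (rule finite_subset[of _ "{..<tp_bound n k}"]) (auto simp: tp_less)

lemma tp_0_iff: "tp m n 0 s t A = tp m n 0 s' t' A' \<longleftrightarrow>
    (\<forall>i<n. \<forall>j<n. (meet s t A i j \<longleftrightarrow> meet s' t' A' i j) \<and> (before s t A i j \<longleftrightarrow> before s' t' A' i j))"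
proof -
  have fin: "finite (atoms n s t A)" for s t A by (rule finite_subset[OF atoms_subset]) simp
  have "tp m n 0 s t A = tp m n 0 s' t' A' \<longleftrightarrow> atoms n s t A = atoms n s' t' A'"
    using fin by (simp add: set_encode_eq)
  also have "\<dots> \<longleftrightarrow> (\<forall>i<n. \<forall>j<n. (meet s t A i j \<longleftrightarrow> meet s' t' A' i j) \<and> (before s t A i j \<longleftrightarrow> before s' t' A' i j))"
    (is "_ \<longleftrightarrow> ?r")
  proof
    assume "atoms n s t A = atoms n s' t' A'"
    then have "x \<in> atoms n s t A \<longleftrightarrow> x \<in> atoms n s' t' A'" for x by simp
    from this[of "prod_encode (0, prod_encode (i, j))" for i j]
      this[of "prod_encode (1, prod_encode (i, j))" for i j]
    show ?r unfolding atoms_def by simp blast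
  next
    assume ?r then show "atoms n s t A = atoms n s' t' A'" unfolding atoms_def by (simp cong: conj_cong)
  qed
  finally show ?thesis .
qed

text \<open>This replaces the numerical encoding by the back-and-forth condition, which is what all
  later arguments use and what \<open>typeF\<close> writes down as a formula.\<close>

lemma tp_Suc_iff: "tp m n (Suc k) s t A = tp m n (Suc k) s' t' A' \<longleftrightarrow>
    (\<forall>B. \<exists>B'. tp m n k s t (A(m + k := B)) = tp m n k s' t' (A'(m + k := B'))) \<and>
    (\<forall>B'. \<exists>B. tp m n k s t (A(m + k := B)) = tp m n k s' t' (A'(m + k := B')))"
  (is "_ \<longleftrightarrow> ?r")
proof -
  have "tp m n (Suc k) s t A = tp m n (Suc k) s' t' A' \<longleftrightarrow>
    range (\<lambda>B. tp m n k s t (A(m + k := B))) = range (\<lambda>B. tp m n k s' t' (A'(m + k := B)))"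
    by (simp add: set_encode_eq[OF finite_tp_range finite_tp_range])
  also have "\<dots> \<longleftrightarrow> ?r" (is "range ?f = range ?g \<longleftrightarrow> _")
  proof
    assume "range ?f = range ?g"
    then have "\<forall>B. ?f B \<in> range ?g" "\<forall>B. ?g B \<in> range ?f" by auto
    then show ?r by (metis (no_types, lifting) image_iff)
  next
    assume ?r
    then show "range ?f = range ?g" by (metis (no_types, lifting) rangeI image_subsetI subset_antisym)
  qed
  finally show ?thesis .
qed

declare tp.simps [simp del]

text \<open>The level-\<open>k\<close> type never looks at the components numbered \<open>m, \<dots>, m + k - 1\<close>:
  they are overwritten before the atomic level is reached.\<close>

lemma tp_cong:
  "(\<And>i. i < n \<Longrightarrow> i < m \<or> m + k \<le> i \<Longrightarrow> A i \<inter> {s..<t} = A' i \<inter> {s..<t}) \<Longrightarrow> tp m n k s t A = tp m n k s t A'"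
proof (induction k arbitrary: A A')
  case 0
  have *: "\<And>i a. i < n \<Longrightarrow> s \<le> a \<Longrightarrow> a < t \<Longrightarrow> a \<in> A i \<longleftrightarrow> a \<in> A' i"
    using 0 by (simp add: set_eq_iff) (metis not_le_imp_less)
  have "meet s t A i j = meet s t A' i j" if "i < n" "j < n" for i j
    unfolding meet_def using *[OF that(1)] *[OF that(2)] by auto
  moreover have "before s t A i j = before s t A' i j" if "i < n" "j < n" for i j
    unfolding before_def using *[OF that(1)] *[OF that(2)] by (meson less_imp_le less_trans le_less_trans)
  ultimately show ?case by (simp add: tp_0_iff)
next
  case (Suc k)
  have "tp m n k s t (A(m + k := B)) = tp m n k s t (A'(m + k := B))" for B
  proof (rule Suc.IH)
    fix i assume "i < n" "i < m \<or> m + k \<le> i"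
    then have "i < n" "i = m + k \<or> i < m \<or> m + Suc k \<le> i" by auto
    then show "(A(m + k := B)) i \<inter> {s..<t} = (A'(m + k := B)) i \<inter> {s..<t}"
      using Suc.prems[of i] by auto
  qed
  then show ?case unfolding tp_Suc_iff by blast
qed

lemma tp_empty: "tp m n k s s A = tp m n k s' s' A'"
proof (induction k arbitrary: A A')
  case (Suc k)
  show ?case unfolding tp_Suc_iff using Suc.IH by blast
qed (auto simp: tp_0_iff meet_def before_def)

lemma meet_append: "s \<le> t \<Longrightarrow> t \<le> u \<Longrightarrow> meet s u A i j \<longleftrightarrow> meet s t A i j \<or> meet t u A i j"
proof
  assume *: "s \<le> t" "t \<le> u" and "meet s u A i j"
  then obtain a where a: "s \<le> a" "a < u" "a \<in> A i" "a \<in> A j" unfolding meet_def by auto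
  consider "a < t" | "t \<le> a" by linarith
  then show "meet s t A i j \<or> meet t u A i j" using a unfolding meet_def by cases blast+
next
  assume *: "s \<le> t" "t \<le> u" and "meet s t A i j \<or> meet t u A i j"
  then show "meet s u A i j" unfolding meet_def by (meson le_trans less_le_trans)
qed

lemma before_append: "s \<le> t \<Longrightarrow> t \<le> u \<Longrightarrow> before s u A i j \<longleftrightarrow>
    before s t A i j \<or> before t u A i j \<or> meet s t A i i \<and> meet t u A j j"
proof
  assume *: "s \<le> t" "t \<le> u" and "before s u A i j"
  then obtain a b where ab: "s \<le> a" "a < b" "b < u" "a \<in> A i" "b \<in> A j" unfolding before_def by auto
  consider "b < t" | "t \<le> a" | "a < t" "t \<le> b" by linarith
  then show "before s t A i j \<or> before t u A i j \<or> meet s t A i i \<and> meet t u A j j"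
    using ab unfolding before_def meet_def by cases blast+
next
  assume *: "s \<le> t" "t \<le> u" and "before s t A i j \<or> before t u A i j \<or> meet s t A i i \<and> meet t u A j j"
  then show "before s u A i j" unfolding before_def meet_def
    by (meson le_trans less_le_trans)
qed

text \<open>The composition theorem: a set played on the whole segment is answered separately on the
  two halves, and the two answers are glued at the cut point, since a type sees only its own
  segment.\<close>

lemma tp_append:
  assumes "tp m n k s t A = tp m n k s' t' A'" "tp m n k t u A = tp m n k t' u' A'"
    and le: "s \<le> t" "t \<le> u" "s' \<le> t'" "t' \<le> u'"
  shows "tp m n k s u A = tp m n k s' u' A'"
  using assms(1,2)
proof (induction k arbitrary: A A')
  case 0
  then show ?case unfolding tp_0_iff by (simp add: meet_append[OF le(1,2)] meet_append[OF le(3,4)]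
        before_append[OF le(1,2)] before_append[OF le(3,4)])
next
  case (Suc k)
  have glue: "tp m n k s t (A(m + k := C \<inter> {..<t} \<union> D \<inter> {t..})) = tp m n k s t (A(m + k := C))"
    "tp m n k t u (A(m + k := C \<inter> {..<t} \<union> D \<inter> {t..})) = tp m n k t u (A(m + k := D))" for A s t u C D
    by (rule tp_cong; auto)+
  show ?case unfolding tp_Suc_iff
  proof (intro conjI allI)
    fix B
    obtain C where C: "tp m n k s t (A(m + k := B)) = tp m n k s' t' (A'(m + k := C))"
      using Suc.prems(1) unfolding tp_Suc_iff by blast
    obtain D where D: "tp m n k t u (A(m + k := B)) = tp m n k t' u' (A'(m + k := D))"
      using Suc.prems(2) unfolding tp_Suc_iff by blast
    show "\<exists>B'. tp m n k s u (A(m + k := B)) = tp m n k s' u' (A'(m + k := B'))"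
      by (rule exI[of _ "C \<inter> {..<t'} \<union> D \<inter> {t'..}"], rule Suc.IH) (simp_all only: glue C D)
  next
    fix B
    obtain C where C: "tp m n k s t (A(m + k := C)) = tp m n k s' t' (A'(m + k := B))"
      using Suc.prems(1) unfolding tp_Suc_iff by blast
    obtain D where D: "tp m n k t u (A(m + k := D)) = tp m n k t' u' (A'(m + k := B))"
      using Suc.prems(2) unfolding tp_Suc_iff by blast
    show "\<exists>C. tp m n k s u (A(m + k := C)) = tp m n k s' u' (A'(m + k := B))"
      by (rule exI[of _ "C \<inter> {..<t} \<union> D \<inter> {t..}"], rule Suc.IH) (simp_all only: glue C D)
  qed
qed

text \<open>Higher types refine atomic ones: playing the empty set in every remaining round leaves
  the components \<open>i\<close> and \<open>j\<close> untouched.\<close>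

lemma tp_atoms:
  "tp m n k s t A = tp m n k s' t' A' \<Longrightarrow> i < n \<Longrightarrow> i < m \<or> m + k \<le> i \<Longrightarrow> j < n \<Longrightarrow> j < m \<or> m + k \<le> j
    \<Longrightarrow> (meet s t A i j \<longleftrightarrow> meet s' t' A' i j) \<and> (before s t A i j \<longleftrightarrow> before s' t' A' i j)"
proof (induction k arbitrary: A A')
  case 0
  then show ?case by (simp add: tp_0_iff)
next
  case (Suc k)
  obtain C where C: "tp m n k s t (A(m + k := {})) = tp m n k s' t' (A'(m + k := C))"
    using Suc.prems(1) unfolding tp_Suc_iff by blast
  have ne: "i \<noteq> m + k" "j \<noteq> m + k" using Suc.prems by auto
  have "i < m \<or> m + k \<le> i" "j < m \<or> m + k \<le> j" using Suc.prems by auto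
  with Suc.IH[OF C] Suc.prems(2,4) ne show ?case by (simp add: meet_def before_def)
qed

section \<open>Factorizations of the natural numbers into blocks\<close>

definition cuts :: "(nat \<Rightarrow> nat) \<Rightarrow> bool" where
  "cuts d \<longleftrightarrow> d 0 = 0 \<and> mono d \<and> (\<forall>a. \<exists>i. a < d i)"

lemma cuts_ex:
  assumes "cuts d" shows "\<exists>i. d i \<le> a \<and> a < d (Suc i)"
proof -
  define j where "j = (LEAST j. a < d j)"
  have j: "a < d j" unfolding j_def by (rule LeastI_ex) (use assms in \<open>simp add: cuts_def\<close>)
  then obtain i where i: "j = Suc i" using assms j by (cases j) (auto simp: cuts_def)
  have "\<not> a < d i" using i not_less_Least[of i "\<lambda>j. a < d j"] unfolding j_def by simp
  with j i show ?thesis by (intro exI[of _ i]) simp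
qed

lemma cuts_less:
  assumes "cuts d" "d i \<le> a" "a < d (Suc i)" "d j \<le> b" "b < d (Suc j)" "i < j"
  shows "a < b"
proof -
  have "d (Suc i) \<le> d j" using assms by (auto simp: cuts_def dest!: monoD[of d "Suc i" j])
  then show ?thesis using assms by linarith
qed

lemma cuts_unique:
  assumes "cuts d" "d i \<le> a" "a < d (Suc i)" "d j \<le> a" "a < d (Suc j)"
  shows "i = j"
  using cuts_less[OF assms] cuts_less[OF assms(1,4,5,2,3)] by (cases i j rule: linorder_cases) simp_all

text \<open>One back-and-forth round on the whole of the natural numbers: the answers are chosen
  block by block, and since the blocks are disjoint their union restricts to the chosen answer on
  each.\<close>

lemma tp_cuts_extend:
  assumes d': "cuts d'"
    and eq: "\<forall>i. tp m n (Suc k) (d i) (d (Suc i)) A = tp m n (Suc k) (d' i) (d' (Suc i)) A'"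
  shows "\<exists>B'. \<forall>i. tp m n k (d i) (d (Suc i)) (A(m + k := B)) = tp m n k (d' i) (d' (Suc i)) (A'(m + k := B'))"
proof -
  have "\<forall>i. \<exists>C. tp m n k (d i) (d (Suc i)) (A(m + k := B)) = tp m n k (d' i) (d' (Suc i)) (A'(m + k := C))"
    using eq unfolding tp_Suc_iff by blast
  from choice[OF this]
  obtain C where C: "\<And>i. tp m n k (d i) (d (Suc i)) (A(m + k := B)) = tp m n k (d' i) (d' (Suc i)) (A'(m + k := C i))"
    by blast
  define B' where "B' = (\<Union>i. C i \<inter> {d' i..<d' (Suc i)})"
  have "B' \<inter> {d' i..<d' (Suc i)} = C i \<inter> {d' i..<d' (Suc i)}" for i
  proof (intro set_eqI iffI)
    fix x assume x: "x \<in> B' \<inter> {d' i..<d' (Suc i)}"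
    then obtain j where j: "x \<in> C j" "d' j \<le> x" "x < d' (Suc j)" unfolding B'_def by auto
    then have "j = i" using x cuts_unique[OF d', of j x i] by simp
    with j x show "x \<in> C i \<inter> {d' i..<d' (Suc i)}" by simp
  qed (auto simp: B'_def)
  then have "tp m n k (d' i) (d' (Suc i)) (A'(m + k := C i)) = tp m n k (d' i) (d' (Suc i)) (A'(m + k := B'))" for i
    by (intro tp_cong) auto
  with C show ?thesis by (intro exI[of _ B']) simp
qed

lemma cuts_mem_iff:
  assumes "cuts d"
  shows "(\<exists>i. meet (d i) (d (Suc i)) A x y) \<longleftrightarrow> (\<exists>a. a \<in> A x \<and> a \<in> A y)"
  unfolding meet_def using cuts_ex[OF assms] by blast

lemma cuts_before_iff:
  assumes "cuts d"
  shows "(\<exists>i. before (d i) (d (Suc i)) A x y) \<or> (\<exists>i j. i < j \<and> meet (d i) (d (Suc i)) A x x \<and> meet (d j) (d (Suc j)) A y y)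
    \<longleftrightarrow> (\<exists>a b. a \<in> A x \<and> b \<in> A y \<and> a < b)" (is "?l \<longleftrightarrow> ?r")
proof
  assume ?l then show ?r unfolding before_def meet_def using cuts_less[OF assms] by blast
next
  assume ?r
  then obtain a b where ab: "a \<in> A x" "b \<in> A y" "a < b" by auto
  obtain i j where ij: "d i \<le> a" "a < d (Suc i)" "d j \<le> b" "b < d (Suc j)" using cuts_ex[OF assms] by metis
  have "\<not> j < i" using cuts_less[OF assms ij(3,4,1,2)] ab by auto
  then consider "i = j" | "i < j" by linarith
  then show ?l unfolding before_def meet_def using ab ij by cases blast+
qed

lemma tp_cuts_atoms:
  assumes d: "cuts d" "cuts d'"
    and eq: "\<forall>i. tp m n k (d i) (d (Suc i)) A = tp m n k (d' i) (d' (Suc i)) A'"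
    and xy: "x < n" "x < m \<or> m + k \<le> x" "y < n" "y < m \<or> m + k \<le> y"
  shows "(\<exists>a. a \<in> A x \<and> a \<in> A y) \<longleftrightarrow> (\<exists>a. a \<in> A' x \<and> a \<in> A' y)"
    and "(\<exists>a b. a \<in> A x \<and> b \<in> A y \<and> a < b) \<longleftrightarrow> (\<exists>a b. a \<in> A' x \<and> b \<in> A' y \<and> a < b)"
proof -
  have *: "meet (d i) (d (Suc i)) A x y = meet (d' i) (d' (Suc i)) A' x y"
     "before (d i) (d (Suc i)) A x y = before (d' i) (d' (Suc i)) A' x y"
     "meet (d i) (d (Suc i)) A x x = meet (d' i) (d' (Suc i)) A' x x"
     "meet (d i) (d (Suc i)) A y y = meet (d' i) (d' (Suc i)) A' y y" for i
    using tp_atoms[OF eq[rule_format, of i]] xy by blast+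
  show "(\<exists>a. a \<in> A x \<and> a \<in> A y) \<longleftrightarrow> (\<exists>a. a \<in> A' x \<and> a \<in> A' y)"
    unfolding cuts_mem_iff[OF d(1), of A, symmetric] cuts_mem_iff[OF d(2), of A', symmetric] * ..
  show "(\<exists>a b. a \<in> A x \<and> b \<in> A y \<and> a < b) \<longleftrightarrow> (\<exists>a b. a \<in> A' x \<and> b \<in> A' y \<and> a < b)"
    unfolding cuts_before_iff[OF d(1), of A, symmetric] cuts_before_iff[OF d(2), of A', symmetric] * ..
qed

text \<open>Being a singleton is atomic information: the component meets itself and is not before
  itself. Hence a singleton is answered by a singleton, and element quantifiers can be played as set
  quantifiers.\<close>

lemma tp_cuts_singleton:
  assumes d: "cuts d" "cuts d'"
    and eq: "\<forall>i. tp m n k (d i) (d (Suc i)) A = tp m n k (d' i) (d' (Suc i)) A'"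
    and x: "x < n" "x < m \<or> m + k \<le> x" and A: "A x = {a}"
  shows "\<exists>a'. A' x = {a'}"
proof -
  have "\<exists>a. a \<in> A' x" "\<not> (\<exists>a b. a \<in> A' x \<and> b \<in> A' x \<and> a < b)"
    using tp_cuts_atoms[OF d eq x x] A by auto
  then show ?thesis by (metis linorder_neqE_nat singleton_iff set_eqI)
qed

section \<open>Block types decide formulas\<close>

primrec qrank :: "mlo \<Rightarrow> nat" where
  "qrank (Less t u) = 0"
| "qrank (Equal t u) = 0"
| "qrank (Elem t X) = 0"
| "qrank (Param t) = 0"
| "qrank (Neg \<phi>) = qrank \<phi>"
| "qrank (Conj \<phi> \<chi>) = max (qrank \<phi>) (qrank \<chi>)"
| "qrank (ExElem t \<phi>) = Suc (qrank \<phi>)"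
| "qrank (ExSet X \<phi>) = Suc (qrank \<phi>)"

text \<open>Any bound on the rank will do as number of rounds. Taking the code itself spares a proof
  that the rank is recursive.\<close>

lemma qrank_le_code: "qrank \<phi> \<le> mlo_code \<phi>"
proof -
  have "a > 0 \<Longrightarrow> b < prod_encode (a, b)" for a b
    using prod_encode_less[of 0 a b b] le_prod_encode_2[of b 0] by (meson le_less_trans le0 order_refl)
  then have *: "a > 0 \<Longrightarrow> r \<le> b \<Longrightarrow> Suc r \<le> prod_encode (a, prod_encode (c, b))" for a b c r
    using le_prod_encode_2[of b c] by (metis Suc_leI le_less_trans less_le_trans)
  show ?thesis
  proof (induction \<phi>)
    case (Conj \<phi> \<chi>)
    have "qrank \<phi> \<le> prod_encode (mlo_code \<phi>, mlo_code \<chi>)" "qrank \<chi> \<le> prod_encode (mlo_code \<phi>, mlo_code \<chi>)"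
      using Conj le_prod_encode_1 le_prod_encode_2 le_trans by blast+
    then show ?case using le_prod_encode_2[of "prod_encode (mlo_code \<phi>, mlo_code \<chi>)" 5]
      by simp
    next
    case (Neg \<phi>)
    then show ?case using le_prod_encode_2[of "mlo_code \<phi>" 4] by simp
  qed (simp_all add: *)
qed

text \<open>\<alpha> and \<beta> tell which component stands for which free variable, and
  \<open>p\<close> is the component holding the predicate. The slots from \<open>m\<close> to
  \<open>m + k - 1\<close> must stay unassigned, because the remaining \<open>k\<close> rounds
  overwrite them.\<close>

definition tracks :: "nat \<Rightarrow> nat \<Rightarrow> nat \<Rightarrow> nat set \<Rightarrow> (nat \<Rightarrow> nat) \<Rightarrow> (nat \<Rightarrow> nat set) \<Rightarrow> (nat \<Rightarrow> nat set) \<Rightarrow>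
    mlo \<Rightarrow> nat \<Rightarrow> (nat \<Rightarrow> nat) \<Rightarrow> (nat \<Rightarrow> nat) \<Rightarrow> bool" where
  "tracks m n k P e s A \<phi> p \<alpha> \<beta> \<longleftrightarrow> A p = P \<and> p < m \<and> p < n \<and>
    (\<forall>t\<in>free_elem \<phi>. A (\<alpha> t) = {e t} \<and> \<alpha> t < n \<and> (\<alpha> t < m \<or> m + k \<le> \<alpha> t)) \<and>
    (\<forall>X\<in>free_set \<phi>. A (\<beta> X) = s X \<and> \<beta> X < n \<and> (\<beta> X < m \<or> m + k \<le> \<beta> X))"

lemma tracks_elem: "tracks m n k P e s A \<phi> p \<alpha> \<beta> \<Longrightarrow> t \<in> free_elem \<phi> \<Longrightarrow>
    A (\<alpha> t) = {e t} \<and> \<alpha> t < n \<and> (\<alpha> t < m \<or> m + k \<le> \<alpha> t)"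
  unfolding tracks_def by blast

lemma tracks_set: "tracks m n k P e s A \<phi> p \<alpha> \<beta> \<Longrightarrow> X \<in> free_set \<phi> \<Longrightarrow>
    A (\<beta> X) = s X \<and> \<beta> X < n \<and> (\<beta> X < m \<or> m + k \<le> \<beta> X)"
  unfolding tracks_def by blast

text \<open>A quantifier is matched by one round of \<open>tp_cuts_extend\<close>, and the bound
  variable moves to the slot \<open>m + k'\<close> just played. The level, the tuples and the
  assignments of slots all change there, so all of them are generalized in the induction.\<close>

lemma sat_cuts:
  assumes "cuts d" "cuts d'" and "qrank \<phi> \<le> k" "m + k \<le> n"
    and "\<forall>i. tp m n k (d i) (d (Suc i)) A = tp m n k (d' i) (d' (Suc i)) A'"
    and "tracks m n k P e s A \<phi> p \<alpha> \<beta>" "tracks m n k P' e' s' A' \<phi> p \<alpha> \<beta>"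
    and "sat P e s \<phi>"
  shows "sat P' e' s' \<phi>"
proof -
  \<comment> \<open>The induction needs an equivalence, because negation exchanges the two
    structures.\<close>
  have "sat P e s \<phi> \<longleftrightarrow> sat P' e' s' \<phi>" using assms(1-7)
  proof (induction \<phi> arbitrary: k A A' e e' s s' \<alpha> \<beta>)
    case (Less t u)
    from tp_cuts_atoms(2)[OF Less.prems(1,2,5), of "\<alpha> t" "\<alpha> u"] Less.prems(6,7)
    show ?case unfolding tracks_def by auto
  next
    case (Equal t u)
    from tp_cuts_atoms(1)[OF Equal.prems(1,2,5), of "\<alpha> t" "\<alpha> u"] Equal.prems(6,7)
    show ?case unfolding tracks_def by auto
  next
    case (Elem t X)
    from tp_cuts_atoms(1)[OF Elem.prems(1,2,5), of "\<alpha> t" "\<beta> X"] Elem.prems(6,7)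
    show ?case unfolding tracks_def by auto
  next
    case (Param t)
    from tp_cuts_atoms(1)[OF Param.prems(1,2,5), of "\<alpha> t" p] Param.prems(6,7)
    show ?case unfolding tracks_def by auto
  next
    case (Neg \<phi>)
    have "sat P e s \<phi> \<longleftrightarrow> sat P' e' s' \<phi>"
      by (rule Neg.IH[OF Neg.prems(1,2) _ Neg.prems(4,5)]) (use Neg.prems in \<open>auto simp: tracks_def\<close>)
    then show ?case by simp
  next
    case (Conj \<phi> \<chi>)
    have "sat P e s \<phi> \<longleftrightarrow> sat P' e' s' \<phi>"
      by (rule Conj.IH(1)[OF Conj.prems(1,2) _ Conj.prems(4,5)]) (use Conj.prems in \<open>auto simp: tracks_def\<close>)
    moreover have "sat P e s \<chi> \<longleftrightarrow> sat P' e' s' \<chi>"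
      by (rule Conj.IH(2)[OF Conj.prems(1,2) _ Conj.prems(4,5)]) (use Conj.prems in \<open>auto simp: tracks_def\<close>)
    ultimately show ?case by simp
  next
    case (ExElem t \<phi>)
    then obtain k' where k: "k = Suc k'" "qrank \<phi> \<le> k'" "m + k' \<le> n" "m + k' < n" by (cases k) auto
    note eq = ExElem.prems(5)[unfolded k(1)]
    have tr: "tracks m n k' P (e(t := a)) s (A(m + k' := {a})) \<phi> p (\<alpha>(t := m + k')) \<beta>"
      if "tracks m n k P e s A (ExElem t \<phi>) p \<alpha> \<beta>" for P e s A a
    proof -
      have "\<alpha> u \<noteq> m + k'" if "u \<in> free_elem \<phi>" "u \<noteq> t" for u
        using tracks_elem[OF \<open>tracks m n k P e s A (ExElem t \<phi>) p \<alpha> \<beta>\<close>, of u] that k by auto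
      moreover have "\<beta> Y \<noteq> m + k'" if "Y \<in> free_set \<phi>" for Y
        using tracks_set[OF \<open>tracks m n k P e s A (ExElem t \<phi>) p \<alpha> \<beta>\<close>, of Y] that k by auto
      ultimately show ?thesis using that k unfolding tracks_def by auto
    qed
    note ih = ExElem.IH[OF ExElem.prems(1,2) k(2,3) _ tr[OF ExElem.prems(6)] tr[OF ExElem.prems(7)]]
    show ?case
    proof
      assume "sat P e s (ExElem t \<phi>)"
      then obtain a where a: "sat P (e(t := a)) s \<phi>" by auto
      obtain B where B: "\<forall>i. tp m n k' (d i) (d (Suc i)) (A(m + k' := {a})) = tp m n k' (d' i) (d' (Suc i)) (A'(m + k' := B))"
        using tp_cuts_extend[OF ExElem.prems(2) eq] by blast
      obtain b where "B = {b}" using tp_cuts_singleton[OF ExElem.prems(1,2) B, of "m + k'" a] k by auto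
      with ih[of a b] a B have "sat P' (e'(t := b)) s' \<phi>" by blast
      then show "sat P' e' s' (ExElem t \<phi>)" by auto
    next
      assume "sat P' e' s' (ExElem t \<phi>)"
      then obtain a where a: "sat P' (e'(t := a)) s' \<phi>" by auto
      obtain B where B: "\<forall>i. tp m n k' (d' i) (d' (Suc i)) (A'(m + k' := {a})) = tp m n k' (d i) (d (Suc i)) (A(m + k' := B))"
        using tp_cuts_extend[OF ExElem.prems(1), of m n k' d' A' A] eq by metis
      obtain b where "B = {b}" using tp_cuts_singleton[OF ExElem.prems(2,1) B, of "m + k'" a] k by auto
      with ih[of b a] a B have "sat P (e(t := b)) s \<phi>" by metis
      then show "sat P e s (ExElem t \<phi>)" by auto
    qed
  next
    case (ExSet X \<phi>)
    then obtain k' where k: "k = Suc k'" "qrank \<phi> \<le> k'" "m + k' \<le> n" "m + k' < n" by (cases k) auto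
    note eq = ExSet.prems(5)[unfolded k(1)]
    have tr: "tracks m n k' P e (s(X := B)) (A(m + k' := B)) \<phi> p \<alpha> (\<beta>(X := m + k'))"
      if "tracks m n k P e s A (ExSet X \<phi>) p \<alpha> \<beta>" for P e s A B
    proof -
      have "\<alpha> u \<noteq> m + k'" if "u \<in> free_elem \<phi>" for u
        using tracks_elem[OF \<open>tracks m n k P e s A (ExSet X \<phi>) p \<alpha> \<beta>\<close>, of u] that k by auto
      moreover have "\<beta> Y \<noteq> m + k'" if "Y \<in> free_set \<phi>" "Y \<noteq> X" for Y
        using tracks_set[OF \<open>tracks m n k P e s A (ExSet X \<phi>) p \<alpha> \<beta>\<close>, of Y] that k by auto
      ultimately show ?thesis using that k unfolding tracks_def by auto
    qed
    note ih = ExSet.IH[OF ExSet.prems(1,2) k(2,3) _ tr[OF ExSet.prems(6)] tr[OF ExSet.prems(7)]]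
    show ?case
    proof
      assume "sat P e s (ExSet X \<phi>)"
      then obtain C where C: "sat P e (s(X := C)) \<phi>" by auto
      obtain B where B: "\<forall>i. tp m n k' (d i) (d (Suc i)) (A(m + k' := C)) = tp m n k' (d' i) (d' (Suc i)) (A'(m + k' := B))"
        using tp_cuts_extend[OF ExSet.prems(2) eq] by blast
      with ih[of C B] C have "sat P' e' (s'(X := B)) \<phi>" by blast
      then show "sat P' e' s' (ExSet X \<phi>)" by auto
    next
      assume "sat P' e' s' (ExSet X \<phi>)"
      then obtain C where C: "sat P' e' (s'(X := C)) \<phi>" by auto
      obtain B where B: "\<forall>i. tp m n k' (d' i) (d' (Suc i)) (A'(m + k' := C)) = tp m n k' (d i) (d (Suc i)) (A(m + k' := B))"
        using tp_cuts_extend[OF ExSet.prems(1), of m n k' d' A' A] eq by metis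
      with ih[of B C] C have "sat P e (s(X := B)) \<phi>" by metis
      then show "sat P e s (ExSet X \<phi>)" by auto
    qed
  qed
  with assms(8) show ?thesis by simp
qed

section \<open>Positional determinacy of parity games\<close>

text \<open>The least priority seen infinitely often satisfies \<open>ev\<close>. Keeping
  \<open>ev\<close> arbitrary gives the opponent's condition the same shape, with \<open>ev\<close>
  negated.\<close>

definition parity :: "(nat \<Rightarrow> bool) \<Rightarrow> (nat \<Rightarrow> nat) \<Rightarrow> bool" where
  "parity ev p \<longleftrightarrow> (\<exists>i. ev i \<and> (\<forall>N. \<exists>t\<ge>N. p t = i) \<and> (\<exists>N. \<forall>t\<ge>N. i \<le> p t))"

lemma parity_shift: "parity ev (\<lambda>t. p (t + c)) \<Longrightarrow> parity ev p"
  unfolding parity_def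
proof (elim exE conjE)
  fix i N assume i: "ev i" "\<forall>N. \<exists>t\<ge>N. p (t + c) = i" "\<forall>t\<ge>N. i \<le> p (t + c)"
  have "\<exists>t\<ge>M. p t = i" for M
    using i(2) by (meson trans_le_add1)
  moreover have "\<forall>t\<ge>N + c. i \<le> p t"
    using i(3) by (metis add_le_imp_le_right le_add_diff_inverse2 add_leD2)
  ultimately show "\<exists>i. ev i \<and> (\<forall>N. \<exists>t\<ge>N. p t = i) \<and> (\<exists>N. \<forall>t\<ge>N. i \<le> p t)"
    using i(1) by blast
qed

lemma parity_unique:
  assumes "parity ev p" "parity (\<lambda>i. \<not> ev i) p" shows False
proof -
  obtain i N where i: "ev i" "\<forall>N. \<exists>t\<ge>N. p t = i" "\<forall>t\<ge>N. i \<le> p t"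
    using assms(1) unfolding parity_def by blast
  obtain j M where j: "\<not> ev j" "\<forall>N. \<exists>t\<ge>N. p t = j" "\<forall>t\<ge>M. j \<le> p t"
    using assms(2) unfolding parity_def by blast
  have "i \<le> j" using i(3) j(2) by metis
  moreover have "j \<le> i" using j(3) i(2) by metis
  ultimately show False using i j by simp
qed

text \<open>In \<open>E v a\<close>, the set of possible next positions after the protagonist made the
  choice \<open>a\<close> at \<open>v\<close>, the choice may itself be a function of the opponent's simultaneous move.\<close>

definition winning_part ::
  "('v \<Rightarrow> 'a \<Rightarrow> 'v set) \<Rightarrow> ('v \<Rightarrow> nat) \<Rightarrow> (nat \<Rightarrow> bool) \<Rightarrow> nat \<Rightarrow> (nat \<Rightarrow> 'v set) \<Rightarrow> 'v set \<Rightarrow> ('v \<Rightarrow> 'a) \<Rightarrow> bool" where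
  "winning_part E pr ev k X D a \<longleftrightarrow>
    (\<forall>v\<in>D. E v (a v) \<subseteq> (if pr v < k then X (pr v) else D)) \<and>
    (\<forall>f. (\<forall>i. f i \<in> D \<and> k \<le> pr (f i) \<and> f (Suc i) \<in> E (f i) (a (f i))) \<longrightarrow> parity ev (\<lambda>i. pr (f i)))"

lemma winning_part_step:
  "winning_part E pr ev k X D a \<Longrightarrow> v \<in> D \<Longrightarrow> w \<in> E v (a v) \<Longrightarrow> (if pr v < k then w \<in> X (pr v) else w \<in> D)"
  unfolding winning_part_def by (auto split: if_splits)

lemma winning_part_parity:
  "winning_part E pr ev k X D a \<Longrightarrow> (\<And>i. f i \<in> D) \<Longrightarrow> (\<And>i. k \<le> pr (f i)) \<Longrightarrow> (\<And>i. f (Suc i) \<in> E (f i) (a (f i)))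
    \<Longrightarrow> parity ev (\<lambda>i. pr (f i))"
  unfolding winning_part_def by blast

lemma winning_partI:
  assumes "\<And>v w. v \<in> D \<Longrightarrow> w \<in> E v (a v) \<Longrightarrow> (if pr v < k then w \<in> X (pr v) else w \<in> D)"
    and "\<And>f. (\<And>i. f i \<in> D) \<Longrightarrow> (\<And>i. k \<le> pr (f i)) \<Longrightarrow> (\<And>i. f (Suc i) \<in> E (f i) (a (f i)))
    \<Longrightarrow> parity ev (\<lambda>i. pr (f i))"
  shows "winning_part E pr ev k X D a"
  unfolding winning_part_def using assms by (auto split: if_splits)

text \<open>Well-order all pairs of a winning part and its strategy, and always play by the least
  pair whose part contains the position. A move stays inside the current part, so the pair in use
  never increases along a play. It is eventually constant, and the tail of the play is won by that
  one strategy.\<close>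

lemma winning_part_Union:
  fixes E :: "'v \<Rightarrow> 'a \<Rightarrow> 'v set"
  shows "\<exists>a. winning_part E pr ev k X (\<Union>{D. \<exists>a. winning_part E pr ev k X D a}) a"
proof -
  define S where "S = {(D, a). winning_part E pr ev k X D a}"
  define G where "G = \<Union>{D. \<exists>a. winning_part E pr ev k X D a}"
  obtain r :: "('v set \<times> ('v \<Rightarrow> 'a)) rel" where wo: "well_order_on UNIV r"
    using well_order_on by blast
  have wf: "wf (r - Id)" using wo by (simp add: well_order_on_def)
  have lin: "linear_order r" using wo by (simp add: well_order_on_def)
  then have rt: "refl r" "total r" "trans r"
    by (simp_all add: linear_order_on_def partial_order_on_def preorder_on_def)
  have refl: "(x, x) \<in> r" for x using rt(1) by (meson UNIV_I refl_onD)
  have tot: "(x, y) \<in> r \<or> (y, x) \<in> r" for x y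
    using refl[of x] rt(2) unfolding total_on_def by (metis UNIV_I)
  have least: "\<exists>y\<in>Q. \<forall>z\<in>Q. (y, z) \<in> r" if "Q \<noteq> {}" for Q
  proof -
    from that obtain q where "q \<in> Q" by blast
    from wfE_min[OF wf this] obtain y where "y \<in> Q" "\<And>z. (z, y) \<in> r - Id \<Longrightarrow> z \<notin> Q"
      by metis
    then have "(y, z) \<in> r" if "z \<in> Q" for z using that tot[of y z] refl[of y]
      by (metis DiffI pair_in_Id_conv)
    with \<open>y \<in> Q\<close> show ?thesis by blast
  qed
  have antisym: "(x, y) \<in> r \<Longrightarrow> (y, x) \<in> r \<Longrightarrow> x = y" for x y
    using lin antisymD[of r x y] by (simp add: linear_order_on_def partial_order_on_def)
  have "\<forall>v\<in>G. \<exists>y. y \<in> S \<and> v \<in> fst y \<and> (\<forall>z\<in>S. v \<in> fst z \<longrightarrow> (y, z) \<in> r)"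
  proof
    fix v assume "v \<in> G"
    then have "{y \<in> S. v \<in> fst y} \<noteq> {}" unfolding G_def S_def by auto
    from least[OF this] show "\<exists>y. y \<in> S \<and> v \<in> fst y \<and> (\<forall>z\<in>S. v \<in> fst z \<longrightarrow> (y, z) \<in> r)" by blast
  qed
  from bchoice[OF this] obtain sel where sel: "\<And>v. v \<in> G \<Longrightarrow> sel v \<in> S" "\<And>v. v \<in> G \<Longrightarrow> v \<in> fst (sel v)"
    "\<And>v z. v \<in> G \<Longrightarrow> z \<in> S \<Longrightarrow> v \<in> fst z \<Longrightarrow> (sel v, z) \<in> r" by blast
  define a where "a v = snd (sel v) v" for v
  have good: "winning_part E pr ev k X (fst (sel v)) (snd (sel v))" if "v \<in> G" for v
    using sel(1)[OF that] by (simp add: S_def case_prod_unfold)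
  have sub: "fst (sel v) \<subseteq> G" if "v \<in> G" for v using good[OF that] unfolding G_def by blast
  have "winning_part E pr ev k X G a"
  proof (rule winning_partI)
    fix v w assume v: "v \<in> G" and w: "w \<in> E v (a v)"
    from winning_part_step[OF good[OF v] sel(2)[OF v]] w sub[OF v]
    show "if pr v < k then w \<in> X (pr v) else w \<in> G" unfolding a_def by (auto split: if_splits)
  next
    fix f assume f: "\<And>i. f i \<in> G" "\<And>i. k \<le> pr (f i)" "\<And>i. f (Suc i) \<in> E (f i) (a (f i))"
    have dec: "(sel (f (Suc i)), sel (f i)) \<in> r" for i
    proof -
      have "f (Suc i) \<in> fst (sel (f i))"
        using winning_part_step[OF good[OF f(1)] sel(2)[OF f(1)], of "f (Suc i)" i] f(2)[of i] f(3)[of i]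
        by (simp add: a_def)
      then show ?thesis using sel(1,3) f(1) by blast
    qed
    have dec': "(sel (f (i + n)), sel (f i)) \<in> r" for i n
    proof (induction n)
      case (Suc n)
      then show ?case using dec[of "i + n"] transD[OF rt(3)] by simp
    qed (simp add: refl)
    obtain c where c: "\<And>i. (sel (f c), sel (f i)) \<in> r"
      using least[of "range (\<lambda>i. sel (f i))"] by auto
    have const: "sel (f (i + c)) = sel (f c)" for i
      using antisym[OF dec'[of c i]] c[of "i + c"] by (simp add: add.commute)
    have "parity ev (\<lambda>i. pr (f (i + c)))"
    proof (rule winning_part_parity[OF good[OF f(1)[of c]]])
      show "f (i + c) \<in> fst (sel (f c))" for i using sel(2)[OF f(1)[of "i + c"]] by (simp add: const)
      show "f (Suc i + c) \<in> E (f (i + c)) (snd (sel (f c)) (f (i + c)))" for i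
        using f(3)[of "i + c"] by (simp add: a_def const)
    qed (rule f(2))
    then show "parity ev (\<lambda>i. pr (f i))" by (rule parity_shift)
  qed
  then show ?thesis unfolding G_def by blast
qed

section \<open>Winning regions as nested fixpoints\<close>

definition fixp :: "bool \<Rightarrow> ('v set \<Rightarrow> 'v set) \<Rightarrow> 'v set" where
  "fixp b F = (if b then gfp F else lfp F)"

lemma fixp_mono: "(\<And>Z. F Z \<subseteq> G Z) \<Longrightarrow> fixp b F \<subseteq> fixp b G"
  unfolding fixp_def by (simp add: gfp_mono lfp_mono)

lemma fixp_unfold: "mono F \<Longrightarrow> fixp b F = F (fixp b F)"
  unfolding fixp_def using gfp_unfold lfp_unfold by auto

lemma compl_fixp: "- fixp b F = fixp (\<not> b) (\<lambda>Z. - F (- Z))"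
proof -
  have *: "- gfp F = lfp (\<lambda>Z. - F (- Z))" for F :: "'a set \<Rightarrow> 'a set"
  proof (intro set_eqI iffI)
    fix x assume x: "x \<in> - gfp F"
    have "x \<in> w" if "- F (- w) \<subseteq> w" for w
    proof -
      have "- w \<subseteq> F (- w)" using that by blast
      then show ?thesis using x gfp_upperbound[of "- w" F] by blast
    qed
    then show "x \<in> lfp (\<lambda>Z. - F (- Z))" unfolding lfp_def by blast
  next
    fix x assume x: "x \<in> lfp (\<lambda>Z. - F (- Z))"
    have "x \<notin> u" if "u \<subseteq> F u" for u
    proof -
      have "- F (- (- u)) \<subseteq> - u" using that by simp
      then have "lfp (\<lambda>Z. - F (- Z)) \<subseteq> - u" by (rule lfp_lowerbound)
      then show ?thesis using x by blast
    qed
    then show "x \<in> - gfp F" unfolding gfp_def by blast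
  qed
  have "- gfp (\<lambda>Z. - F (- Z)) = lfp F" using *[of "\<lambda>Z. - F (- Z)"] by simp
  then have "- (- gfp (\<lambda>Z. - F (- Z))) = - lfp F" by (rule arg_cong)
  then have "- lfp F = gfp (\<lambda>Z. - F (- Z))" unfolding double_complement by (rule sym)
  with *[of F] show ?thesis unfolding fixp_def by (cases b) simp_all
qed

text \<open>\<open>win d C pr ev j X\<close> is the parity formula with the \<open>d - j\<close> outermost fixpoint variables replaced
  by \<open>X 0, \<dots>, X (d - j - 1)\<close>; \<open>C\<close> is the one-step controllable predecessor operator.\<close>

primrec win :: "nat \<Rightarrow> ('v \<Rightarrow> 'v set \<Rightarrow> bool) \<Rightarrow> ('v \<Rightarrow> nat) \<Rightarrow> (nat \<Rightarrow> bool) \<Rightarrow> nat \<Rightarrow> (nat \<Rightarrow> 'v set) \<Rightarrow> 'v set" where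
  "win d C pr ev 0 X = {v. C v (X (pr v))}"
| "win d C pr ev (Suc j) X = fixp (ev (d - Suc j)) (\<lambda>Z. win d C pr ev j (X(d - Suc j := Z)))"

lemma win_mono:
  assumes C: "\<And>v A B. A \<subseteq> B \<Longrightarrow> C v A \<Longrightarrow> C v B"
  shows "(\<And>i. X i \<subseteq> Y i) \<Longrightarrow> win d C pr ev j X \<subseteq> win d C pr ev j Y"
proof (induction j arbitrary: X Y)
  case 0
  show ?case by (auto intro: C[OF 0])
next
  case (Suc j)
  show ?case unfolding win.simps by (intro fixp_mono Suc.IH) (simp add: Suc.prems)
qed

text \<open>Determinacy by De Morgan: negating the formula exchanges least and greatest fixpoints,
  hence \<open>ev\<close> and its negation, and replaces the one-step operator by its dual.\<close>

lemma compl_win: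
  assumes dual: "\<And>v A. \<not> C v A \<longleftrightarrow> C' v (- A)"
  shows "- win d C pr ev j X = win d C' pr (\<lambda>i. \<not> ev i) j (\<lambda>i. - X i)"
proof (induction j arbitrary: X)
  case 0
  then show ?case using dual by auto
next
  case (Suc j)
  have "(\<lambda>i. - (X(k := - Z)) i) = (\<lambda>i. - X i)(k := Z)" for k Z by (rule ext) simp
  then show ?case unfolding win.simps compl_fixp Suc.IH by simp
qed

text \<open>Strategies are extracted along the nesting, from the innermost variable outwards. A
  position of priority \<open>i < d - j\<close> must lead into the still open parameter
  \<open>X i\<close>; plays that never see such a priority must be won outright.\<close>

lemma win_strategy:
  fixes E :: "'v \<Rightarrow> 'a \<Rightarrow> 'v set"
  assumes d: "\<And>v. pr v < d"
  defines "C \<equiv> (\<lambda>v A. \<exists>a. E v a \<subseteq> A)"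
  shows "j \<le> d \<Longrightarrow> \<exists>D a. win d C pr ev j X \<subseteq> D \<and> winning_part E pr ev (d - j) X D a"
proof (induction j arbitrary: X)
  case 0
  have "\<forall>v\<in>win d C pr ev 0 X. \<exists>a. E v a \<subseteq> X (pr v)" unfolding C_def by simp
  from bchoice[OF this] obtain a where a: "\<And>v. v \<in> win d C pr ev 0 X \<Longrightarrow> E v (a v) \<subseteq> X (pr v)" by blast
  have "winning_part E pr ev d X (win d C pr ev 0 X) a"
  proof (rule winning_partI)
    fix f assume "\<And>i::nat. d \<le> pr (f i)"
    then show "parity ev (\<lambda>i. pr (f i))" using d[of "f 0"] by (meson not_le)
  qed (use a d in auto)
  then show ?case by auto
next
  case (Suc j)
  define k where "k = d - Suc j"
  have k: "d - j = Suc k" using Suc.prems by (simp add: k_def)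
  have CM: "\<And>v A B. A \<subseteq> B \<Longrightarrow> C v A \<Longrightarrow> C v B" unfolding C_def by blast
  define F where "F Z = win d C pr ev j (X(k := Z))" for Z
  have mono: "mono F"
  proof (rule monoI)
    fix Y Z :: "'v set" assume "Y \<subseteq> Z"
    then have le: "(X(k := Y)) i \<subseteq> (X(k := Z)) i" for i by simp
    show "F Y \<subseteq> F Z" unfolding F_def
    proof (rule win_mono)
      show "C v B" if "A \<subseteq> B" "C v A" for v A B using that by (rule CM)
    qed (rule le)
  qed
  have IH: "\<exists>D a. F Z \<subseteq> D \<and> winning_part E pr ev (Suc k) (X(k := Z)) D a" for Z
    using Suc.IH[OF Suc_leD[OF Suc.prems], of "X(k := Z)"] unfolding k F_def .
  have win: "win d C pr ev (Suc j) X = fixp (ev k) F" unfolding F_def k_def by simp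
  show ?case
  proof (cases "ev k")
    case True
    \<comment> \<open>The strategy for the body at the fixpoint \<open>Z\<close> already works:
      leaving priority \<open>k\<close> leads back into \<open>Z\<close>, hence into
      \<open>D\<close>. Seeing the least possible priority \<open>k\<close> infinitely often wins,
      and otherwise some tail avoids \<open>k\<close>.\<close>
    define Z where "Z = fixp (ev k) F"
    have Z: "F Z = Z" unfolding Z_def using fixp_unfold[OF mono] by metis
    obtain D a where D: "Z \<subseteq> D" and wp: "winning_part E pr ev (Suc k) (X(k := Z)) D a"
      using IH[of Z] Z by auto
    have step: "if pr v < k then w \<in> X (pr v) else w \<in> D" if "v \<in> D" "w \<in> E v (a v)" for v w
      using winning_part_step[OF wp that] D by (auto split: if_splits)
    have "winning_part E pr ev k X D a"
    proof (rule winning_partI)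
      show "if pr v < k then w \<in> X (pr v) else w \<in> D" if "v \<in> D" "w \<in> E v (a v)" for v w
        using that by (rule step)
    next
      fix f assume f: "\<And>i. f i \<in> D" "\<And>i. k \<le> pr (f i)" "\<And>i. f (Suc i) \<in> E (f i) (a (f i))"
      show "parity ev (\<lambda>i. pr (f i))"
      proof (cases "\<forall>N. \<exists>t\<ge>N. pr (f t) = k")
        case True
        then show ?thesis using \<open>ev k\<close> f(2) unfolding parity_def by blast
      next
        case False
        then obtain N where "\<And>t. t \<ge> N \<Longrightarrow> pr (f t) \<noteq> k" by auto
        then have "pr (f (t + N)) \<noteq> k" for t by simp
        then have N: "Suc k \<le> pr (f (t + N))" for t using f(2)[of "t + N"] by (metis Suc_leI le_neq_implies_less)
        have "parity ev (\<lambda>i. pr (f (i + N)))"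
          by (rule winning_part_parity[OF wp]) (use f N in auto)
        then show ?thesis by (rule parity_shift)
      qed
    qed
    then show ?thesis using D unfolding win Z_def[symmetric] by (auto simp: k_def)
  next
    case False
    \<comment> \<open>The largest winning part replaces ordinal approximants of the least fixpoint:
      whatever the body gains over \<open>G\<close> is again part of a winning part, so
      \<open>F G\<close> is included in \<open>G\<close> and \<open>G\<close> is above the least
      fixpoint.\<close>
    define G where "G = \<Union>{D. \<exists>a. winning_part E pr ev k X D a}"
    obtain aG where G: "winning_part E pr ev k X G aG" unfolding G_def using winning_part_Union by blast
    obtain H b where H: "F G \<subseteq> H" and wp: "winning_part E pr ev (Suc k) (X(k := G)) H b"
      using IH by blast
    define a where "a v = (if v \<in> G then aG v else b v)" for v
    have "winning_part E pr ev k X (H \<union> G) a"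
    proof (rule winning_partI)
      fix v w assume v: "v \<in> H \<union> G" and w: "w \<in> E v (a v)"
      show "if pr v < k then w \<in> X (pr v) else w \<in> H \<union> G"
      proof (cases "v \<in> G")
        case True
        with winning_part_step[OF G True] w show ?thesis by (auto simp: a_def split: if_splits)
      next
        case False
        with winning_part_step[OF wp, of v w] v w show ?thesis by (auto simp: a_def split: if_splits)
      qed
    next
      fix f assume f: "\<And>i. f i \<in> H \<union> G" "\<And>i. k \<le> pr (f i)" "\<And>i. f (Suc i) \<in> E (f i) (a (f i))"
      have stepG: "f (Suc i) \<in> G" if "f i \<in> G" for i
        using winning_part_step[OF G that, of "f (Suc i)"] f(2)[of i] f(3)[of i] that by (simp add: a_def)
      show "parity ev (\<lambda>i. pr (f i))"
      proof (cases "\<exists>c. f c \<in> G")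
        case True
        then obtain c where "f c \<in> G" by auto
        then have c: "f (i + c) \<in> G" for i by (induction i) (use stepG in auto)
        have "parity ev (\<lambda>i. pr (f (i + c)))"
        proof (rule winning_part_parity[OF G c f(2)])
          show "f (Suc i + c) \<in> E (f (i + c)) (aG (f (i + c)))" for i
            using f(3)[of "i + c"] c[of i] by (simp add: a_def)
        qed
        then show ?thesis by (rule parity_shift)
      next
        case False
        then have inH: "f i \<in> H" for i using f(1) by auto
        have b: "f (Suc i) \<in> E (f i) (b (f i))" for i using f(3)[of i] False by (simp add: a_def)
        have "pr (f i) \<noteq> k" for i
          using winning_part_step[OF wp inH b, of i] False by (auto split: if_splits)
        then have "Suc k \<le> pr (f i)" for i using f(2)[of i] by (metis Suc_leI le_neq_implies_less)
        then show ?thesis using winning_part_parity[OF wp, of f] inH b by blast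
      qed
    qed
    then have "H \<union> G \<subseteq> G" unfolding G_def by blast
    then have "lfp F \<subseteq> G" using H by (intro lfp_lowerbound) auto
    then show ?thesis using G False unfolding win fixp_def by (auto simp: k_def)
  qed
qed

text \<open>The assumption \<open>dual\<close> is determinacy of a single round. The two regions are
  complementary by \<open>compl_win\<close>, and each carries a positional strategy by
  \<open>win_strategy\<close>.\<close>

theorem parity_determined:
  fixes E1 :: "'v \<Rightarrow> 'a \<Rightarrow> 'v set" and E2 :: "'v \<Rightarrow> 'b \<Rightarrow> 'v set"
  assumes d: "\<And>v. pr v < d"
    and dual: "\<And>v A. (\<forall>a. \<not> E1 v a \<subseteq> A) \<longleftrightarrow> (\<exists>b. E2 v b \<subseteq> - A)"
  shows "(\<exists>a. \<forall>f. f 0 = v \<longrightarrow> (\<forall>i. f (Suc i) \<in> E1 (f i) (a (f i))) \<longrightarrow> parity ev (\<lambda>i. pr (f i))) \<or>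
    (\<exists>b. \<forall>f. f 0 = v \<longrightarrow> (\<forall>i. f (Suc i) \<in> E2 (f i) (b (f i))) \<longrightarrow> parity (\<lambda>i. \<not> ev i) (\<lambda>i. pr (f i)))"
proof -
  have *: "\<exists>a. \<forall>f. f 0 = v \<longrightarrow> (\<forall>i. f (Suc i) \<in> E (f i) (a (f i))) \<longrightarrow> parity ev (\<lambda>i. pr (f i))"
    if v: "v \<in> win d (\<lambda>v A. \<exists>a. E v a \<subseteq> A) pr ev d X" for E :: "'v \<Rightarrow> 'c \<Rightarrow> 'v set" and ev X
  proof -
    obtain D a where D: "v \<in> D" and wp: "winning_part E pr ev 0 X D a"
      using win_strategy[where pr = pr and d = d and E = E and ev = ev and j = d and X = X] d v by auto
    have "parity ev (\<lambda>i. pr (f i))" if "f 0 = v" "\<forall>i. f (Suc i) \<in> E (f i) (a (f i))" for f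
    proof (rule winning_part_parity[OF wp])
      show "f i \<in> D" for i
      proof (induction i)
        case (Suc i)
        then show ?case using winning_part_step[OF wp Suc, of "f (Suc i)"] that by simp
      qed (simp add: that D)
    qed (use that in auto)
    then show ?thesis by blast
  qed
  have "- win d (\<lambda>v A. \<exists>a. E1 v a \<subseteq> A) pr ev d (\<lambda>_. {}) = win d (\<lambda>v A. \<exists>a. E2 v a \<subseteq> A) pr (\<lambda>i. \<not> ev i) d (\<lambda>_. - {})"
    by (rule compl_win) (use dual in blast)
  then have "v \<in> win d (\<lambda>v A. \<exists>a. E1 v a \<subseteq> A) pr ev d (\<lambda>_. {}) \<or>
    v \<in> win d (\<lambda>v A. \<exists>a. E2 v a \<subseteq> A) pr (\<lambda>i. \<not> ev i) d (\<lambda>_. - {})"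
    by blast
  then show ?thesis using *[of E1] *[of E2] by blast
qed

section \<open>Determinization\<close>

text \<open>The parameter \<open>P\<close> is hidden inside \<open>c\<close>, so equal letters give
  equal types only at the same position \<open>j\<close> (\<open>c_letter\<close>). This is why the
  resulting automaton has time-dependent transitions.\<close>

locale word_types =
  fixes c :: "(nat \<Rightarrow> 'l) \<Rightarrow> nat \<Rightarrow> nat \<Rightarrow> nat" and T :: nat and L :: "(nat \<Rightarrow> 'l) \<Rightarrow> bool"
  assumes c_less: "c w i j < T"
    and c_empty: "c w i i = c w' i' i'"
    and c_append: "c w i j = c w' i' j' \<Longrightarrow> c w j k = c w' j' k' \<Longrightarrow> i \<le> j \<Longrightarrow> j \<le> k \<Longrightarrow> i' \<le> j' \<Longrightarrow> j' \<le> k'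
      \<Longrightarrow> c w i k = c w' i' k'"
    and c_letter: "w j = w' j \<Longrightarrow> c w j (Suc j) = c w' j (Suc j)"
    and L_cuts: "strict_mono d \<Longrightarrow> strict_mono d' \<Longrightarrow> c w 0 (d 0) = c w' 0 (d' 0) \<Longrightarrow>
      (\<And>i. c w (d i) (d (Suc i)) = c w' (d' i) (d' (Suc i))) \<Longrightarrow> L w \<longleftrightarrow> L w'"
begin

lemma c_step: "c w i j = c w' i' j \<Longrightarrow> w j = w' j \<Longrightarrow> i \<le> j \<Longrightarrow> i' \<le> j \<Longrightarrow> c w i (Suc j) = c w' i' (Suc j)"
  by (rule c_append[OF _ c_letter]) auto

text \<open>A position is alive at time \<open>j\<close> as long as it has not merged with an earlier one.
  Merged positions stay merged. At the least rank at which positions die infinitely often, infinitely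
  many merge into one immortal position, and they cut the word into blocks of one type.\<close>

definition alive :: "(nat \<Rightarrow> 'l) \<Rightarrow> nat \<Rightarrow> nat set" where
  "alive w j = {i. i \<le> j \<and> (\<forall>i'<i. c w i' j \<noteq> c w i j)}"

text \<open>Positions are unbounded, but their types are not: an alive position is named by its type
  up to the present, and a triple records two such names and the type of the segment between
  them.\<close>

definition state :: "(nat \<Rightarrow> 'l) \<Rightarrow> nat \<Rightarrow> (nat \<times> nat \<times> nat) set" where
  "state w j = {(c w a j, c w b j, c w a b) |a b. a \<in> alive w j \<and> b \<in> alive w j \<and> a \<le> b}"

text \<open>The newborn position \<open>Suc j\<close> is included: it may merge at birth.\<close>

definition dying :: "(nat \<Rightarrow> 'l) \<Rightarrow> nat \<Rightarrow> nat set" where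
  "dying w j = insert (Suc j) (alive w j) - alive w (Suc j)"

text \<open>Membership in \<open>L\<close> of words factorized as one block of type \<open>s\<close>
  followed by blocks of type \<open>e\<close>. By \<open>L_cuts\<close> one such word decides for
  all of them (\<open>accepts_iff\<close>).\<close>

definition accepts :: "nat \<Rightarrow> nat \<Rightarrow> bool" where
  "accepts s e \<longleftrightarrow> (\<exists>w d. strict_mono d \<and> c w 0 (d 0) = s \<and> (\<forall>i. c w (d i) (d (Suc i)) = e) \<and> L w)"

definition partner :: "(nat \<Rightarrow> 'l) \<Rightarrow> nat \<Rightarrow> nat \<Rightarrow> nat" where
  "partner w j i = (LEAST p. c w p j = c w i j)"

text \<open>The half of a priority is the rank of the first dying position among the survivors; the
  parity guesses membership as if the segment between its partner and it were repeated forever.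
  Ranks are at most \<open>T\<close>, so the default \<open>2 * T + 2\<close> is above all real
  priorities.\<close>

primrec prio :: "(nat \<Rightarrow> 'l) \<Rightarrow> nat \<Rightarrow> nat" where
  "prio w 0 = 2 * T + 2"
| "prio w (Suc j) = (if dying w j = {} then 2 * T + 2 else
     let i = Min (dying w j); p = partner w (Suc j) i in
     2 * card (alive w (Suc j) \<inter> {..<i}) + (if accepts (c w 0 p) (c w p i) then 0 else 1))"

lemma zero_alive: "0 \<in> alive w j" by (simp add: alive_def)

lemma alive_inj: "inj_on (\<lambda>a. c w a j) (alive w j)"
  by (rule inj_onI) (metis (mono_tags, lifting) alive_def linorder_neqE_nat mem_Collect_eq)

lemma finite_alive: "finite (alive w j)"
  by (rule finite_subset[of _ "{..j}"]) (auto simp: alive_def)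

lemma card_alive: "card (alive w j) \<le> T"
proof -
  have "card (alive w j) \<le> card {..<T}"
    by (rule card_inj_on_le[OF alive_inj]) (auto simp: c_less)
  then show ?thesis by simp
qed

lemma partner_alive:
  assumes "i \<le> j"
  shows "partner w j i \<in> alive w j" "c w (partner w j i) j = c w i j" "partner w j i \<le> i"
proof -
  show 1: "c w (partner w j i) j = c w i j" unfolding partner_def by (rule LeastI) simp
  show 2: "partner w j i \<le> i" unfolding partner_def by (rule Least_le) simp
  have "c w i' j \<noteq> c w i j" if "i' < partner w j i" for i'
    using not_less_Least[OF that[unfolded partner_def]] .
  then show "partner w j i \<in> alive w j" using 1 2 assms by (simp add: alive_def)
qed

lemma alive_Suc_subset: "alive w (Suc j) \<subseteq> insert (Suc j) (alive w j)"
proof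
  fix a assume a: "a \<in> alive w (Suc j)"
  have "c w i' j \<noteq> c w a j" if "i' < a" "a \<le> j" for i'
    using a that c_step[of w i' j w a] by (auto simp: alive_def)
  with a show "a \<in> insert (Suc j) (alive w j)" by (auto simp: alive_def le_Suc_eq)
qed

text \<open>If a position merges with any earlier one, it merges with the earliest of its class,
  which is alive. Comparing with candidates alone therefore suffices, and the next step can be
  computed from the state.\<close>

lemma alive_Suc: "alive w (Suc j) =
    {a \<in> insert (Suc j) (alive w j). \<forall>b\<in>insert (Suc j) (alive w j). b < a \<longrightarrow> c w b (Suc j) \<noteq> c w a (Suc j)}"
  (is "_ = ?r")
proof (intro set_eqI iffI)
  fix a assume "a \<in> alive w (Suc j)"
  then show "a \<in> ?r" using alive_Suc_subset[of w j] by (auto simp: alive_def)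
next
  fix a assume a: "a \<in> ?r"
  then have "a \<le> Suc j" by (auto simp: alive_def)
  show "a \<in> alive w (Suc j)"
  proof (rule ccontr)
    assume "a \<notin> alive w (Suc j)"
    then have ne: "partner w (Suc j) a \<noteq> a" using partner_alive(1)[OF \<open>a \<le> Suc j\<close>, of w] by metis
    have "partner w (Suc j) a \<in> insert (Suc j) (alive w j)"
      using partner_alive(1)[OF \<open>a \<le> Suc j\<close>, of w] alive_Suc_subset[of w j] by blast
    then show False using a partner_alive(2,3)[OF \<open>a \<le> Suc j\<close>, of w] ne by auto
  qed
qed

text \<open>Distinct alive positions have distinct types up to \<open>j\<close>, so matching names
  defines a bijection, and the triples make it preserve the order and the intermediate
  types.\<close>

lemma state_iso:
  assumes "state w j = state w' j"
  obtains g where "bij_betw g (alive w j) (alive w' j)"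
    "\<And>a b. a \<in> alive w j \<Longrightarrow> b \<in> alive w j \<Longrightarrow> a \<le> b \<Longrightarrow> g a \<le> g b \<and> c w a b = c w' (g a) (g b)"
    "\<And>a. a \<in> alive w j \<Longrightarrow> c w a j = c w' (g a) j"
proof -
  have ex: "\<exists>a'\<in>alive w' j. \<exists>b'\<in>alive w' j. a' \<le> b' \<and> c w' a' j = c w a j \<and> c w' b' j = c w b j \<and> c w' a' b' = c w a b"
    if "state w j = state w' j" "a \<in> alive w j" "b \<in> alive w j" "a \<le> b" for w w' a b
  proof -
    have "(c w a j, c w b j, c w a b) \<in> state w' j" using that unfolding state_def by blast
    then show ?thesis unfolding state_def by force
  qed
  have "\<forall>a\<in>alive w j. \<exists>a'. a' \<in> alive w' j \<and> c w' a' j = c w a j"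
    using ex[OF assms] by blast
  from bchoice[OF this] obtain g where g: "\<And>a. a \<in> alive w j \<Longrightarrow> g a \<in> alive w' j"
    "\<And>a. a \<in> alive w j \<Longrightarrow> c w' (g a) j = c w a j" by blast
  have uniq: "a' = g a" if "a \<in> alive w j" "a' \<in> alive w' j" "c w' a' j = c w a j" for a a'
    using inj_onD[OF alive_inj[of w' j], of a' "g a"] g that by simp
  show ?thesis
  proof
    show "bij_betw g (alive w j) (alive w' j)"
    proof (rule bij_betw_imageI)
      show "inj_on g (alive w j)"
        by (rule inj_onI) (metis g(2) inj_onD[OF alive_inj])
      show "g ` alive w j = alive w' j"
      proof (intro subset_antisym subsetI)
        fix a' assume a': "a' \<in> alive w' j"
        then obtain a where "a \<in> alive w j" "c w a j = c w' a' j" using ex[OF assms[symmetric] a' a'] by blast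
        then show "a' \<in> g ` alive w j" using uniq[of a a'] a' by auto
      qed (use g in auto)
    qed
  next
    fix a b assume ab: "a \<in> alive w j" "b \<in> alive w j" "a \<le> b"
    then obtain a' b' where "a' \<in> alive w' j" "b' \<in> alive w' j" "a' \<le> b'" "c w' a' j = c w a j"
      "c w' b' j = c w b j" "c w' a' b' = c w a b" using ex[OF assms] by metis
    then show "g a \<le> g b \<and> c w a b = c w' (g a) (g b)" using uniq ab by metis
  next
    show "c w a j = c w' (g a) j" if "a \<in> alive w j" for a using g(2)[OF that] by simp
  qed
qed

text \<open>The isomorphism of \<open>state_iso\<close> is extended by sending the newborn position
  to itself. Merging, dying, ranks and partners are expressed by order and types only, so all of
  them are transported.\<close>

lemma step:
  assumes st: "state w j = state w' j" and letter: "w j = w' j"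
  shows "state w (Suc j) = state w' (Suc j)" "prio w (Suc j) = prio w' (Suc j)"
proof -
  obtain g0 where g0: "bij_betw g0 (alive w j) (alive w' j)"
    "\<And>a b. a \<in> alive w j \<Longrightarrow> b \<in> alive w j \<Longrightarrow> a \<le> b \<Longrightarrow> g0 a \<le> g0 b \<and> c w a b = c w' (g0 a) (g0 b)"
    "\<And>a. a \<in> alive w j \<Longrightarrow> c w a j = c w' (g0 a) j" using state_iso[OF st] by metis
  define C where "C = insert (Suc j) (alive w j)"
  define C' where "C' = insert (Suc j) (alive w' j)"
  define g where "g = g0(Suc j := Suc j)"
  have le: "a \<le> j" if "a \<in> alive w j" for a w using that by (simp add: alive_def)
  have nS: "Suc j \<notin> alive w j" for w by (simp add: alive_def)
  have g0_in: "g0 a \<in> alive w' j" if "a \<in> alive w j" for a using g0(1) that by (auto simp: bij_betw_def)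
  have gS: "g (Suc j) = Suc j" by (simp add: g_def)
  have g_old: "g a = g0 a" if "a \<in> alive w j" for a
    using that nS[of w] by (auto simp: g_def)
  have "bij_betw g (alive w j) (alive w' j)"
    using g0(1) g_old by (subst bij_betw_cong) auto
  then have bij: "bij_betw g C C'" unfolding C_def C'_def using nS gS
    using notIn_Un_bij_betw[of "Suc j" "alive w j" g "alive w' j"] by simp
  have cS: "c w a (Suc j) = c w' (g a) (Suc j)" if "a \<in> C" for a
  proof (cases "a = Suc j")
    case True
    then show ?thesis using gS c_empty by metis
  next
    case False
    then have a: "a \<in> alive w j" using that by (simp add: C_def)
    show ?thesis unfolding g_old[OF a] by (rule c_step) (use a g0(3) g0_in le letter in auto)
  qed
  have cab: "g a \<le> g b \<and> c w a b = c w' (g a) (g b)" if "a \<in> C" "b \<in> C" "a \<le> b" for a b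
  proof (cases "b = Suc j")
    case True
    have "g a \<le> Suc j" using that(1) g0_in le gS g_old unfolding C_def by (metis insertE le_SucI order_refl)
    then show ?thesis using True gS cS[OF that(1)] by simp
  next
    case False
    then have "b \<in> alive w j" using that by (simp add: C_def)
    moreover have "a \<in> alive w j" using that le[OF \<open>b \<in> alive w j\<close>] by (auto simp: C_def)
    ultimately show ?thesis using g0(2) g_old that by simp
  qed
  have inj: "g a = g b \<longleftrightarrow> a = b" if "a \<in> C" "b \<in> C" for a b
    using that bij by (auto simp: bij_betw_def inj_on_def)
  have less: "g a < g b \<longleftrightarrow> a < b" if "a \<in> C" "b \<in> C" for a b
    using cab[OF that] cab[OF that(2,1)] inj[OF that] by (metis le_less_linear le_neq_implies_less leD less_imp_le)
  have C': "C' = g ` C" using bij by (simp add: bij_betw_def)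
  have A: "alive w (Suc j) = {a\<in>C. \<forall>b\<in>C. b < a \<longrightarrow> c w b (Suc j) \<noteq> c w a (Suc j)}"
    unfolding C_def by (rule alive_Suc)
  have A': "alive w' (Suc j) = {a\<in>C'. \<forall>b\<in>C'. b < a \<longrightarrow> c w' b (Suc j) \<noteq> c w' a (Suc j)}"
    unfolding C'_def by (rule alive_Suc)
  have alive_iff: "g a \<in> alive w' (Suc j) \<longleftrightarrow> a \<in> alive w (Suc j)" if "a \<in> C" for a
    unfolding A A' C' using that by (simp add: less cS inj_image_mem_iff)
  have sub: "alive w (Suc j) \<subseteq> C" unfolding A by auto
  have img: "alive w' (Suc j) = g ` alive w (Suc j)"
  proof (intro set_eqI iffI)
    fix x assume x: "x \<in> alive w' (Suc j)"
    then obtain a where "a \<in> C" "x = g a" unfolding A' C' by auto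
    with x show "x \<in> g ` alive w (Suc j)" using alive_iff by auto
  qed (use alive_iff sub in auto)
  show "state w (Suc j) = state w' (Suc j)"
  proof (intro set_eqI iffI)
    fix x assume "x \<in> state w (Suc j)"
    then obtain a b where ab: "x = (c w a (Suc j), c w b (Suc j), c w a b)" "a \<in> alive w (Suc j)" "b \<in> alive w (Suc j)" "a \<le> b"
      unfolding state_def by auto
    then have "x = (c w' (g a) (Suc j), c w' (g b) (Suc j), c w' (g a) (g b))" "g a \<le> g b"
      using cS cab sub by auto
    then show "x \<in> state w' (Suc j)" unfolding state_def img using ab by blast
  next
    fix x assume "x \<in> state w' (Suc j)"
    then obtain a b where ab: "x = (c w' (g a) (Suc j), c w' (g b) (Suc j), c w' (g a) (g b))"
      "a \<in> alive w (Suc j)" "b \<in> alive w (Suc j)" "g a \<le> g b"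
      unfolding state_def img by auto
    then have "a \<le> b" using less sub by (meson leD leI subsetD)
    moreover have "a \<in> C" "b \<in> C" using ab sub by auto
    ultimately have "x = (c w a (Suc j), c w b (Suc j), c w a b)"
      using ab(1) cS[of a] cS[of b] cab[of a b] by simp
    then show "x \<in> state w (Suc j)" unfolding state_def using ab \<open>a \<le> b\<close> by blast
  qed
  have dimg: "dying w' j = g ` dying w j"
    unfolding dying_def C_def[symmetric] C'_def[symmetric] C' using alive_iff by auto
  have dsub: "dying w j \<subseteq> C" unfolding dying_def C_def by auto
  show "prio w (Suc j) = prio w' (Suc j)"
  proof (cases "dying w j = {}")
    case True
    then show ?thesis using dimg by simp
  next
    case False
    define i where "i = Min (dying w j)"
    have fin: "finite (dying w j)" for w unfolding dying_def using finite_alive by simp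
    have i: "i \<in> dying w j" unfolding i_def using False fin by simp
    have iC: "i \<in> C" using i dsub by auto
    have i': "Min (dying w' j) = g i"
    proof (rule Min_eqI[OF fin])
      show "g i \<in> dying w' j" using i dimg by auto
      fix y assume "y \<in> dying w' j"
      then obtain z where z: "z \<in> dying w j" "y = g z" using dimg by auto
      then have "i \<le> z" unfolding i_def using fin by simp
      then show "g i \<le> y" using cab iC z dsub by auto
    qed
    have leS: "a \<le> Suc j" if "a \<in> C" for a
      using that le[of a w] unfolding C_def by (metis insertE le_SucI order_refl)
    have leS': "g a \<le> Suc j" if "a \<in> C" for a
    proof -
      have "g a \<in> C'" using that C' by simp
      then show ?thesis using le[of "g a" w'] unfolding C'_def by (metis insertE le_SucI order_refl)
    qed
    define p where "p = partner w (Suc j) i"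
    have p: "p \<in> alive w (Suc j)" "c w p (Suc j) = c w i (Suc j)" "p \<le> i"
      unfolding p_def by (rule partner_alive[OF leS[OF iC]])+
    have pC: "p \<in> C" using p sub by auto
    have p': "partner w' (Suc j) (g i) = g p"
    proof (rule inj_onD[OF alive_inj])
      show "c w' (partner w' (Suc j) (g i)) (Suc j) = c w' (g p) (Suc j)"
        using partner_alive(2)[OF leS'[OF iC]] p(2) cS[OF pC] cS[OF iC] by simp
      show "partner w' (Suc j) (g i) \<in> alive w' (Suc j)" by (rule partner_alive(1)[OF leS'[OF iC]])
      show "g p \<in> alive w' (Suc j)" using p(1) img by auto
    qed
    \<comment> \<open>Position 0 is always alive and is the least one, so \<open>g\<close> fixes it.
      Hence the type of the initial block \<open>c w 0 p\<close> is also read off the state.\<close>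
    have 0: "0 \<in> C" "0 \<in> C'" unfolding C_def C'_def using zero_alive by auto
    then obtain z where "z \<in> C" "g z = 0" unfolding C' by auto
    then have g_0: "g 0 = 0" using cab[of 0 z] 0 by simp
    have card: "card (alive w' (Suc j) \<inter> {..<g i}) = card (alive w (Suc j) \<inter> {..<i})"
    proof -
      have "alive w' (Suc j) \<inter> {..<g i} = g ` (alive w (Suc j) \<inter> {..<i})"
        unfolding img using less iC sub by auto
      moreover have "inj_on g (alive w (Suc j) \<inter> {..<i})" using inj sub by (auto intro!: inj_onI)
      ultimately show ?thesis by (simp add: card_image)
    qed
    have "c w 0 p = c w' 0 (g p)" "c w p i = c w' (g p) (g i)"
      using cab[of 0 p] cab[of p i] 0 pC iC p(3) g_0 by auto
    moreover have "dying w' j \<noteq> {}" using False dimg by simp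
    ultimately show ?thesis using False unfolding prio.simps i' i_def[symmetric] Let_def p' p_def[symmetric] card by simp
  qed
qed

lemma local:
  assumes "\<And>i. i < j \<Longrightarrow> w i = w' i"
  shows "state w j = state w' j" "prio w j = prio w' j"
proof -
  have "state w j = state w' j \<and> prio w j = prio w' j" using assms
  proof (induction j)
    case 0
    have "alive w 0 = {0}" for w by (auto simp: alive_def)
    then show ?case using c_empty[of w 0 w' 0] by (simp add: state_def)
  next
    case (Suc j)
    then show ?case using step[of w j w'] by simp
  qed
  then show "state w j = state w' j" "prio w j = prio w' j" by auto
qed

lemma prio_le: "prio w j \<le> 2 * T + 2"
proof (cases j)
  case (Suc j')
  have "card (alive w (Suc j') \<inter> {..<i}) \<le> T" for i
    using card_mono[OF finite_alive, of "alive w (Suc j') \<inter> {..<i}" w "Suc j'"] card_alive[of w "Suc j'"] by auto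
  then show ?thesis unfolding Suc prio.simps Let_def
    by (smt (verit) add_mono_thms_linordered_semiring(1) le_numeral_extra(3) mult_le_mono2 one_le_numeral zero_le order_refl)
qed simp

lemma accepts_iff:
  assumes "strict_mono d" "c w 0 (d 0) = s" "\<And>i. c w (d i) (d (Suc i)) = e"
  shows "accepts s e \<longleftrightarrow> L w"
proof
  assume "accepts s e"
  then obtain w' d' where "strict_mono d'" "c w' 0 (d' 0) = s" "\<forall>i. c w' (d' i) (d' (Suc i)) = e" "L w'"
    unfolding accepts_def by blast
  with L_cuts[of d d' w w'] assms show "L w" by simp
qed (use assms in \<open>auto simp: accepts_def\<close>)

section \<open>Correctness of the priorities\<close>

definition immortal :: "(nat \<Rightarrow> 'l) \<Rightarrow> nat set" where
  "immortal w = {i. \<forall>j\<ge>i. i \<in> alive w j}"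

lemma alive_antimono: "i \<in> alive w j' \<Longrightarrow> i \<le> j \<Longrightarrow> j \<le> j' \<Longrightarrow> i \<in> alive w j"
proof (induction j' rule: nat_less_induct)
  case (1 j')
  show ?case
  proof (cases "j = j'")
    case False
    then obtain l where l: "j' = Suc l" "j \<le> l" using 1(4) by (cases j') auto
    then have "i \<in> alive w l" using 1(2,3) alive_Suc_subset[of w l] by auto
    then show ?thesis using 1 l by auto
  qed (use 1 in simp)
qed

lemma finite_immortal: "finite (immortal w)" and card_immortal: "card (immortal w) \<le> T"
proof -
  have "card F \<le> T" if F: "F \<subseteq> immortal w" "finite F" for F
  proof (cases "F = {}")
    case False
    have "F \<subseteq> alive w (Max F)" using F by (auto simp: immortal_def)
    then show ?thesis using card_mono[OF finite_alive, of F w "Max F"] card_alive[of w "Max F"] by simp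
  qed simp
  then have "finite (immortal w) \<and> card (immortal w) \<le> T"
    using finite_if_finite_subsets_card_bdd[of "immortal w" T] by blast
  then show "finite (immortal w)" "card (immortal w) \<le> T" by auto
qed

text \<open>There are finitely many immortal positions, hence finitely many mortal ones below the
  last of them; \<open>N\<close> is chosen beyond a time at which each of these is dead.\<close>

lemma eventually_immortal:
  obtains N where "\<And>i. i \<in> immortal w \<Longrightarrow> i \<le> N"
    "\<And>i i' j. i \<in> immortal w \<Longrightarrow> i' \<le> i \<Longrightarrow> N \<le> j \<Longrightarrow> i' \<in> alive w j \<Longrightarrow> i' \<in> immortal w"
proof -
  define M where "M = Max (insert 0 (immortal w))"
  have M: "i \<le> M" if "i \<in> immortal w" for i unfolding M_def using finite_immortal that by simp
  have "\<forall>i. \<exists>n\<ge>i. i \<notin> immortal w \<longrightarrow> i \<notin> alive w n" unfolding immortal_def by blast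
  from choice[OF this] obtain n where n: "\<And>i. i \<le> n i" "\<And>i. i \<notin> immortal w \<Longrightarrow> i \<notin> alive w (n i)" by blast
  define N where "N = Max (insert M (n ` {..M}))"
  have N: "M \<le> N" "\<And>i. i \<le> M \<Longrightarrow> n i \<le> N" unfolding N_def by (auto intro!: Max_ge simp del: Max_insert)
  show ?thesis
  proof
    show "i \<le> N" if "i \<in> immortal w" for i using M[OF that] N by simp
    fix i i' j assume a: "i \<in> immortal w" "i' \<le> i" "N \<le> j" "i' \<in> alive w j"
    then have "n i' \<le> N" using M N by (meson order_trans)
    then have "i' \<in> alive w (n i')" using alive_antimono[OF a(4) n(1)[of i']] a(3) by simp
    then show "i' \<in> immortal w" using n(2) by blast
  qed
qed

lemma dying_cases: "i \<in> dying w j \<Longrightarrow> i \<le> Suc j \<and> (i = Suc j \<or> i \<in> alive w j) \<and> i \<notin> alive w (Suc j)"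
  unfolding dying_def by (auto simp: alive_def)

lemma dying_inj: "i \<in> dying w j \<Longrightarrow> i \<in> dying w j' \<Longrightarrow> j = j'"
proof (induction j j' rule: linorder_wlog)
  case (le j j')
  show ?case
  proof (rule ccontr)
    assume "j \<noteq> j'"
    then have lt: "Suc j \<le> j'" using le by simp
    have i: "i \<le> Suc j" "i \<notin> alive w (Suc j)" using dying_cases[OF le(2)] by auto
    then have "i \<in> alive w j'" using dying_cases[OF le(3)] lt by auto
    from alive_antimono[OF this i(1) lt] i(2) show False by simp
  qed
qed simp

text \<open>With \<open>r\<close> immortal positions, from some time on every dying position lies
  above all of them, so priorities stay at least \<open>2 * r\<close>. Infinitely often the first
  dying position has exactly the immortal ones below it, so \<open>2 * r\<close> or
  \<open>2 * r + 1\<close> recurs, and recurrence of either one determines membership in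
  \<open>L\<close>.\<close>

theorem parity_prio: "parity even (prio w) \<longleftrightarrow> L w"
proof -
  define r where "r = card (immortal w)"
  obtain N where N: "\<And>i. i \<in> immortal w \<Longrightarrow> i \<le> N"
    "\<And>i i' j. i \<in> immortal w \<Longrightarrow> i' \<le> i \<Longrightarrow> N \<le> j \<Longrightarrow> i' \<in> alive w j \<Longrightarrow> i' \<in> immortal w"
    using eventually_immortal by blast
  define below where "below j = alive w (Suc j) \<inter> {..<Min (dying w j)}" for j
  have fin: "finite (dying w j)" for j unfolding dying_def using finite_alive by simp
  have fin_below: "finite (below j)" for j unfolding below_def using finite_alive by simp
  have mortal: "i \<notin> immortal w" if "i \<in> dying w j" for i j
    using dying_cases[OF that] unfolding immortal_def by auto
  have above: "i < i'" if "i \<in> immortal w" "i' \<in> dying w j" "N \<le> j" for i i' j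
  proof (rule ccontr)
    assume "\<not> i < i'"
    then have le: "i' \<le> i" by simp
    have "i' \<in> alive w j" using dying_cases[OF that(2)] le N(1)[OF that(1)] that(3) by auto
    from N(2)[OF that(1) le that(3) this] mortal[OF that(2)] show False by simp
  qed
  have sub: "immortal w \<subseteq> below j" if "N \<le> j" "dying w j \<noteq> {}" for j
  proof
    fix i assume i: "i \<in> immortal w"
    have "i < Min (dying w j)" using above[OF i _ that(1)] Min_in[OF fin that(2)] by blast
    moreover have "i \<in> alive w (Suc j)" using i N(1)[OF i] that(1) unfolding immortal_def by auto
    ultimately show "i \<in> below j" unfolding below_def by simp
  qed
  have ge: "2 * r \<le> prio w j" if "Suc N \<le> j" for j
  proof (cases j)
    case (Suc l)
    show ?thesis
    proof (cases "dying w l = {}")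
      case True
      then show ?thesis using Suc card_immortal[of w] by (simp add: r_def)
    next
      case False
      then have "r \<le> card (below l)" unfolding r_def using sub[of l] that Suc fin_below by (auto intro!: card_mono)
      then show ?thesis using Suc False by (simp add: Let_def below_def)
    qed
  qed (use that in simp)
  define ev where "ev = {j. N \<le> j \<and> dying w j \<noteq> {} \<and> card (below j) = r}"
  have ev_below: "below j = immortal w" if "j \<in> ev" for j
    using card_subset_eq[OF fin_below[of j] sub[of j]] that unfolding ev_def r_def by auto
  have ev_ex: "\<exists>j\<ge>K. j \<in> ev" if "N \<le> K" for K
  proof -
    \<comment> \<open>\<open>x\<close> is the lowest mortal candidate at time \<open>K\<close>. When
      it dies, it is the first to die and everything alive below it is immortal, so its rank is
      exactly \<open>r\<close>.\<close>
    define x where "x = (LEAST x. x \<in> insert (Suc K) (alive w K) \<and> x \<notin> immortal w)"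
    have SK: "Suc K \<in> insert (Suc K) (alive w K) \<and> Suc K \<notin> immortal w" using N(1)[of "Suc K"] that by auto
    have x: "x \<in> insert (Suc K) (alive w K)" "x \<notin> immortal w"
      unfolding x_def using LeastI[of "\<lambda>x. x \<in> insert (Suc K) (alive w K) \<and> x \<notin> immortal w", OF SK] by auto
    have x_least: "x \<le> y" if "y \<in> insert (Suc K) (alive w K)" "y \<notin> immortal w" for y
      unfolding x_def using that by (intro Least_le) simp
    have xK: "x \<le> Suc K" using x_least SK by simp
    obtain l where l: "x \<le> l" "x \<notin> alive w l" using x(2) unfolding immortal_def by auto
    have "\<exists>j\<ge>K. x \<notin> alive w (Suc j)"
    proof (intro exI[of _ "max K l"] conjI)
      show "x \<notin> alive w (Suc (max K l))" using alive_antimono[OF _ l(1)] l(2) by fastforce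
    qed simp
    define j where "j = (LEAST j. K \<le> j \<and> x \<notin> alive w (Suc j))"
    have j: "K \<le> j" "x \<notin> alive w (Suc j)"
      using LeastI_ex[OF \<open>\<exists>j\<ge>K. x \<notin> alive w (Suc j)\<close>] unfolding j_def by auto
    have "x \<in> insert (Suc j) (alive w j)"
    proof (cases "j = K")
      case False
      then obtain j' where j': "j = Suc j'" "K \<le> j'" using j(1) by (cases j) auto
      then have "x \<in> alive w (Suc j')" using not_less_Least[of j' "\<lambda>j. K \<le> j \<and> x \<notin> alive w (Suc j)"] unfolding j_def[symmetric] by auto
      then show ?thesis using j' by simp
    qed (use x in simp)
    then have xd: "x \<in> dying w j" unfolding dying_def using j by simp
    have Min: "Min (dying w j) = x"
    proof (rule Min_eqI[OF fin _ xd])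
      fix y assume y: "y \<in> dying w j"
      show "x \<le> y"
      proof (cases "y \<le> K")
        case True
        then have "y \<in> alive w j" using dying_cases[OF y] j(1) by auto
        then have "y \<in> alive w K" using alive_antimono True j(1) by blast
        then show ?thesis using x_least mortal[OF y] by simp
      qed (use xK in simp)
    qed
    have "below j \<subseteq> immortal w"
    proof
      fix z assume z: "z \<in> below j"
      then have "z < x" "z \<in> alive w (Suc j)" unfolding below_def Min by auto
      then have "z \<in> alive w K" using alive_antimono[of z w "Suc j" K] xK j(1) by simp
      then show "z \<in> immortal w" using x_least[of z] \<open>z < x\<close> by auto
    qed
    then have "below j = immortal w" using sub[of j] that j(1) xd by auto
    then show ?thesis unfolding ev_def r_def using that j(1) xd by auto
  qed
  \<comment> \<open>A recurring priority yields a factorization of \<open>w\<close> into one block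
    of type \<open>c w 0 P\<close> and blocks of type \<open>e\<close>, for the very pair on which
    \<open>accepts\<close> was evaluated. So only one of the two priorities can recur.\<close>
  have bit: "b = (if L w then 0 else 1)" if inf: "\<forall>K. \<exists>t\<ge>K. prio w t = 2 * r + b" and b: "b < 2" for b
  proof -
    define J where "J = {j \<in> ev. prio w (Suc j) = 2 * r + b}"
    define i where "i j = Min (dying w j)" for j
    define p where "p j = partner w (Suc j) (i j)" for j
    have "infinite J"
      unfolding infinite_nat_iff_unbounded_le
    proof
      fix K
      obtain t where t: "t \<ge> Suc (max K N)" "prio w t = 2 * r + b" using inf by blast
      then obtain j where j: "t = Suc j" "j \<ge> K" "j \<ge> N" by (cases t) auto
      have "dying w j \<noteq> {}"
        using t(2) j(1) b card_immortal[of w] unfolding r_def by (auto split: if_splits)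
      then have "2 * card (below j) + (if accepts (c w 0 (p j)) (c w (p j) (i j)) then 0 else 1) = 2 * r + b"
        using t(2) unfolding j(1) by (simp add: Let_def below_def p_def i_def split: if_splits)
      then have "card (below j) = r" using b by (auto split: if_splits)
      then have "j \<in> J" using t j \<open>dying w j \<noteq> {}\<close> unfolding J_def ev_def by simp
      then show "\<exists>n\<ge>K. n \<in> J" using j by auto
    qed
    have dy: "i j \<in> dying w j" if "j \<in> J" for j
      unfolding i_def using Min_in[OF fin] that unfolding J_def ev_def by simp
    have i_le: "i j \<le> Suc j" if "j \<in> J" for j using dying_cases[OF dy[OF that]] by simp
    have p: "p j \<in> alive w (Suc j)" "c w (p j) (Suc j) = c w (i j) (Suc j)" "p j < i j" if "j \<in> J" for j
    proof -
      show 1: "p j \<in> alive w (Suc j)" and "c w (p j) (Suc j) = c w (i j) (Suc j)"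
        unfolding p_def by (rule partner_alive[OF i_le[OF that]])+
      have "p j \<le> i j" unfolding p_def by (rule partner_alive[OF i_le[OF that]])
      moreover have "p j \<noteq> i j" using 1 dying_cases[OF dy[OF that]] by auto
      ultimately show "p j < i j" by simp
    qed
    have pN: "p j \<le> N" if "j \<in> J" for j
    proof -
      have "p j \<in> below j" using p[OF that] unfolding below_def i_def by simp
      then show ?thesis using ev_below[of j] that N(1) unfolding J_def by simp
    qed
    have "finite ((\<lambda>j. (p j, c w (p j) (i j))) ` J)"
      by (rule finite_subset[of _ "{..N} \<times> {..<T}"]) (auto simp: pN c_less)
    from pigeonhole_infinite[OF \<open>infinite J\<close> this] obtain j0 where
      "infinite {j \<in> J. (p j, c w (p j) (i j)) = (p j0, c w (p j0) (i j0))}" by blast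
    then obtain P e where infJ: "infinite {j \<in> J. p j = P \<and> c w (p j) (i j) = e}" by auto
    define J' where "J' = {j \<in> J. p j = P \<and> c w (p j) (i j) = e}"
    have J': "j \<in> J" "p j = P" "c w P (i j) = e" if "j \<in> J'" for j using that unfolding J'_def by auto
    have "infinite (i ` J')"
    proof
      assume "finite (i ` J')"
      moreover have "inj_on i J'"
        by (rule inj_onI) (metis J'(1) dy dying_inj)
      ultimately show False using infJ finite_imageD unfolding J'_def by blast
    qed
    then have far: "\<exists>j\<in>J'. B < i j" for B
      unfolding infinite_nat_iff_unbounded by blast
    define f where "f = rec_nat (SOME j. j \<in> J') (\<lambda>_ l. SOME j. j \<in> J' \<and> Suc l < i j)"
    have f0: "f 0 \<in> J'" using far[of 0] unfolding f_def by (auto intro: someI)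
    have fS: "f (Suc n) \<in> J' \<and> Suc (f n) < i (f (Suc n))" for n
    proof -
      have "\<exists>j. j \<in> J' \<and> Suc (f n) < i j" using far[of "Suc (f n)"] by blast
      from someI_ex[OF this] show ?thesis unfolding f_def by simp
    qed
    have fJ: "f n \<in> J'" for n by (cases n) (use f0 fS in auto)
    define d where "d n = (case n of 0 \<Rightarrow> P | Suc l \<Rightarrow> i (f l))" for n
    have dec: "d n < d (Suc n)" "c w (d n) (d (Suc n)) = e" for n
    proof (atomize (full), cases n)
      case 0
      then show "d n < d (Suc n) \<and> c w (d n) (d (Suc n)) = e"
        using p(3)[OF J'(1)[OF f0]] J'(2,3)[OF f0] by (simp add: d_def)
    next
      case (Suc l)
      note j = J'[OF fJ[of l]]
      \<comment> \<open>The position \<open>i (f l)\<close> has merged with \<open>P\<close> by time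
        \<open>Suc (f l)\<close>, before the next chosen position. From then on both starting points
        give the same type, namely \<open>e\<close>.\<close>
      have "c w (i (f l)) (i (f (Suc l))) = c w P (i (f (Suc l)))"
      proof (rule c_append)
        show "c w (i (f l)) (Suc (f l)) = c w P (Suc (f l))" using p(2)[OF j(1)] j(2) by simp
      qed (use i_le[OF j(1)] fS[of l] p(3)[OF j(1)] j(2) in auto)
      then show "d n < d (Suc n) \<and> c w (d n) (d (Suc n)) = e"
        using Suc J'(3)[OF fJ[of "Suc l"]] i_le[OF j(1)] fS[of l] by (simp add: d_def)
    qed
    have "accepts (c w 0 P) e \<longleftrightarrow> L w"
      by (rule accepts_iff[of d]) (use dec in \<open>auto simp: strict_mono_Suc_iff d_def\<close>)
    moreover have "2 * card (below (f 0)) + (if accepts (c w 0 P) e then 0 else 1) = 2 * r + b"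
      using J'[OF f0] unfolding J_def ev_def
      by (auto simp: Let_def below_def p_def i_def split: if_splits)
    moreover have "card (below (f 0)) = r" using J'(1)[OF f0] unfolding J_def ev_def by simp
    ultimately show ?thesis by simp
  qed
  have two: "prio w (Suc j) = 2 * r \<or> prio w (Suc j) = 2 * r + 1" if "j \<in> ev" for j
    using that unfolding ev_def below_def by (auto simp: Let_def)
  have io: "(\<forall>K. \<exists>t\<ge>K. prio w t = 2 * r + 0) \<or> (\<forall>K. \<exists>t\<ge>K. prio w t = 2 * r + 1)"
  proof (rule ccontr)
    assume "\<not> ?thesis"
    then obtain K K' where K: "\<forall>t\<ge>K. prio w t \<noteq> 2 * r" "\<forall>t\<ge>K'. prio w t \<noteq> 2 * r + 1" by auto
    obtain j where "j \<ge> max N (max K K')" "j \<in> ev" using ev_ex[of "max N (max K K')"] by auto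
    moreover from this have "prio w (Suc j) \<noteq> 2 * r" "prio w (Suc j) \<noteq> 2 * r + 1"
      using K by (auto simp del: prio.simps)
    ultimately show False using two[of j] by blast
  qed
  show ?thesis
  proof (cases "L w")
    case True
    then have "\<forall>K. \<exists>t\<ge>K. prio w t = 2 * r" using io bit[of 1] by auto
    then show ?thesis using True ge unfolding parity_def by (intro iffI exI[of _ "2 * r"]) auto
  next
    case False
    then have 1: "\<forall>K. \<exists>t\<ge>K. prio w t = 2 * r + 1" and "\<not> (\<forall>K. \<exists>t\<ge>K. prio w t = 2 * r + 0)"
      using io bit[of 0] by auto
    then obtain K where K: "\<And>t. t \<ge> K \<Longrightarrow> prio w t \<noteq> 2 * r" by auto
    have "2 * r + 1 \<le> prio w t" if "t \<ge> max K (Suc N)" for t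
      using K[of t] ge[of t] that by simp
    then have "\<exists>N. \<forall>t\<ge>N. 2 * r + 1 \<le> prio w t" by blast
    then have "parity (\<lambda>i. \<not> even i) (prio w)" unfolding parity_def using 1 by (intro exI[of _ "2 * r + 1"]) auto
    then show ?thesis using parity_unique[of even "prio w"] False by auto
  qed
qed

definition triple :: "nat \<times> nat \<times> nat \<Rightarrow> nat" where
  "triple = (\<lambda>(u, v, m). prod_encode (u, prod_encode (v, m)))"

text \<open>The priority belongs to the last transition and is not determined by the state reached,
  so it is stored along with it.\<close>

definition code :: "(nat \<Rightarrow> 'l) \<Rightarrow> nat \<Rightarrow> nat" where
  "code w j = prod_encode (set_encode (triple ` state w j), prio w j)"

lemma triple_state: "triple ` state w j \<subseteq> {..<prod_encode (T, prod_encode (T, T))}"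
  unfolding state_def triple_def
  by (auto simp: c_less intro!: prod_encode_less prod_encode_mono less_imp_le[OF c_less])

lemma code_eqD:
  assumes "code w j = code w' j" shows "state w j = state w' j" "prio w j = prio w' j"
proof -
  have fin: "finite (triple ` state w j)" for w by (rule finite_subset[OF triple_state]) simp
  have "inj triple" by (auto simp: triple_def intro!: injI)
  moreover have "triple ` state w j = triple ` state w' j"
    using assms fin by (simp add: code_def set_encode_eq)
  ultimately show "state w j = state w' j" by (simp add: inj_image_eq_iff)
  show "prio w j = prio w' j" using assms by (simp add: code_def)
qed

lemma code_less: "code w j < prod_encode (2 ^ prod_encode (T, prod_encode (T, T)), 2 * T + 3)"
  unfolding code_def using set_encode_less[OF triple_state, of w j] prio_le[of w j]
  by (intro prod_encode_less) auto

theorem deterministic_automaton: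
  "\<exists>q0 \<delta> pr. q0 < prod_encode (2 ^ prod_encode (T, prod_encode (T, T)), 2 * T + 3) \<and>
    (\<forall>t q l. \<delta> t q l < prod_encode (2 ^ prod_encode (T, prod_encode (T, T)), 2 * T + 3)) \<and>
    (\<forall>q. pr q < 2 * T + 3) \<and>
    (\<forall>w run. run 0 = q0 \<longrightarrow> (\<forall>t. run (Suc t) = \<delta> t (run t) (w t)) \<longrightarrow> (parity even (\<lambda>t. pr (run t)) \<longleftrightarrow> L w))"
proof -
  \<comment> \<open>Any word reaching the code may be continued: by \<open>step\<close> the
    successor does not depend on the choice. Capping \<open>pr\<close> makes its bound hold for
    unreachable \<open>q\<close> as well.\<close>
  define rep where "rep t q = (SOME w. code w t = q)" for t q
  define \<delta> where "\<delta> t q l = code ((rep t q)(t := l)) (Suc t)" for t q l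
  define pr where "pr q = min (snd (prod_decode q)) (2 * T + 2)" for q
  have \<delta>: "\<delta> t (code w t) (w t) = code w (Suc t)" for t w
  proof -
    have "code (rep t (code w t)) t = code w t" unfolding rep_def by (rule someI[of _ w]) simp
    from code_eqD(1)[OF this] have "state ((rep t (code w t))(t := w t)) t = state w t"
      using local(1)[of t "(rep t (code w t))(t := w t)" "rep t (code w t)"] by simp
    from step[OF this] show ?thesis unfolding \<delta>_def code_def by simp
  qed
  have "parity even (\<lambda>t. pr (run t)) \<longleftrightarrow> L w"
    if run: "run 0 = code undefined 0" "\<And>t. run (Suc t) = \<delta> t (run t) (w t)" for w run
  proof -
    have "run t = code w t" for t
    proof (induction t)
      case 0
      show ?case using local[of 0 undefined w] run(1) by (simp add: code_def)
    qed (simp add: run(2) \<delta>)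
    moreover have "pr (code w t) = prio w t" for t using prio_le[of w t] by (simp add: pr_def code_def)
    ultimately have "(\<lambda>t. pr (run t)) = prio w" by (simp add: fun_eq_iff)
    then show ?thesis using parity_prio[of w] by simp
  qed
  moreover have "pr q < 2 * T + 3" for q unfolding pr_def by simp
  moreover have "\<delta> t q l < prod_encode (2 ^ prod_encode (T, prod_encode (T, T)), 2 * T + 3)" for t q l
    unfolding \<delta>_def by (rule code_less)
  ultimately show ?thesis using code_less[of undefined 0]
    by (intro exI[of _ "code undefined 0"] exI[of _ \<delta>] exI[of _ pr]) blast
qed

end

section \<open>Finite-memory strategies\<close>

primrec mealy_state :: "(nat \<Rightarrow> nat \<Rightarrow> bool \<Rightarrow> nat \<times> bool) \<Rightarrow> nat \<Rightarrow> nat set \<Rightarrow> nat \<Rightarrow> nat" where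
  "mealy_state \<mu> q X 0 = q"
| "mealy_state \<mu> q X (Suc t) = fst (\<mu> t (mealy_state \<mu> q X t) (t \<in> X))"

definition mealy :: "(nat \<Rightarrow> nat \<Rightarrow> bool \<Rightarrow> nat \<times> bool) \<Rightarrow> nat \<Rightarrow> nat set \<Rightarrow> nat set" where
  "mealy \<mu> q X = {t. snd (\<mu> t (mealy_state \<mu> q X t) (t \<in> X))}"

lemma mealy_state_cong: "(\<And>u. u < t \<Longrightarrow> u \<in> X \<longleftrightarrow> u \<in> X') \<Longrightarrow> mealy_state \<mu> q X t = mealy_state \<mu> q X' t"
  by (induction t) auto

text \<open>The argument is the code of the formula, which serves as a bound on its quantifier rank.\<close>

definition state_bound :: "nat \<Rightarrow> nat" where
  "state_bound c = (let T = tp_bound (3 + c) c in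
     prod_encode (2 ^ prod_encode (T, prod_encode (T, T)), T + T + 3))"

text \<open>The three given components are the sets of both players and the predicate, hence
  \<open>m = 3\<close> throughout this section; \<open>mlo_code \<psi>\<close> further slots are for
  quantified sets.\<close>

definition game_struct :: "nat set \<Rightarrow> (nat \<Rightarrow> bool \<times> bool) \<Rightarrow> nat \<Rightarrow> nat set" where
  "game_struct P w i = (if i = 0 then {t. fst (w t)} else if i = 1 then {t. snd (w t)} else P)"

lemma holds_cuts:
  assumes \<psi>: "formula_XY \<psi>" and d: "strict_mono d" "strict_mono d'"
    and eq: "tp 3 (3 + mlo_code \<psi>) (mlo_code \<psi>) 0 (d 0) A = tp 3 (3 + mlo_code \<psi>) (mlo_code \<psi>) 0 (d' 0) A'"
      "\<And>i. tp 3 (3 + mlo_code \<psi>) (mlo_code \<psi>) (d i) (d (Suc i)) A = tp 3 (3 + mlo_code \<psi>) (mlo_code \<psi>) (d' i) (d' (Suc i)) A'"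
    and h: "holds (A 2) (A 0) (A 1) \<psi>"
  shows "holds (A' 2) (A' 0) (A' 1) \<psi>"
proof -
  \<comment> \<open>A factorization in the sense of \<open>cuts\<close> starts at 0, so the initial
    segment up to \<open>d 0\<close> becomes a block of its own, possibly empty.\<close>
  define D where "D d i = (case i of 0 \<Rightarrow> 0 | Suc i' \<Rightarrow> d i')" for d :: "nat \<Rightarrow> nat" and i
  have D: "cuts (D d)" if "strict_mono d" for d
  proof -
    have "mono (D d)" using that
      by (intro mono_iff_le_Suc[THEN iffD2]) (auto simp: D_def strict_mono_Suc_iff less_imp_le split: nat.split)
    moreover have "a < D d (Suc (Suc a))" for a
      using strict_mono_imp_increasing[OF that, of "Suc a"] by (simp add: D_def)
    moreover have "D d 0 = 0" by (simp add: D_def)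
    ultimately show ?thesis unfolding cuts_def by blast
  qed
  have eqD: "\<forall>i. tp 3 (3 + mlo_code \<psi>) (mlo_code \<psi>) (D d i) (D d (Suc i)) A
    = tp 3 (3 + mlo_code \<psi>) (mlo_code \<psi>) (D d' i) (D d' (Suc i)) A'"
    using eq by (auto simp: D_def split: nat.split)
  have tr: "tracks 3 (3 + mlo_code \<psi>) (mlo_code \<psi>) (A 2) (\<lambda>_. 0) ((\<lambda>_. {})(0 := A 0, 1 := A 1)) A \<psi> 2 id id" for A
    using \<psi> unfolding tracks_def formula_XY_def by auto
  show ?thesis
    using sat_cuts[OF D[OF d(1)] D[OF d(2)] qrank_le_code order_refl eqD tr tr] h
    unfolding holds_def by blast
qed

lemma word_types_formula:
  assumes \<psi>: "formula_XY \<psi>"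
  shows "word_types (\<lambda>w i j. tp 3 (3 + mlo_code \<psi>) (mlo_code \<psi>) i j (game_struct P w))
    (tp_bound (3 + mlo_code \<psi>) (mlo_code \<psi>)) (\<lambda>w. holds P {t. fst (w t)} {t. snd (w t)} \<psi>)"
proof
  fix w w' :: "nat \<Rightarrow> bool \<times> bool" and j
  assume "w j = w' j"
  then show "tp 3 (3 + mlo_code \<psi>) (mlo_code \<psi>) j (Suc j) (game_struct P w) = tp 3 (3 + mlo_code \<psi>) (mlo_code \<psi>) j (Suc j) (game_struct P w')"
    by (intro tp_cong) (auto simp: game_struct_def less_Suc_eq_le dest: antisym)
next
  fix d d' w w'
  assume d: "strict_mono d" "strict_mono d'"
    and eq: "tp 3 (3 + mlo_code \<psi>) (mlo_code \<psi>) 0 (d 0) (game_struct P w) = tp 3 (3 + mlo_code \<psi>) (mlo_code \<psi>) 0 (d' 0) (game_struct P w')"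
    "\<And>i. tp 3 (3 + mlo_code \<psi>) (mlo_code \<psi>) (d i) (d (Suc i)) (game_struct P w) = tp 3 (3 + mlo_code \<psi>) (mlo_code \<psi>) (d' i) (d' (Suc i)) (game_struct P w')"
  show "holds P {t. fst (w t)} {t. snd (w t)} \<psi> = holds P {t. fst (w' t)} {t. snd (w' t)} \<psi>"
    using holds_cuts[OF \<psi> d eq] holds_cuts[OF \<psi> d(2,1) eq[symmetric]] by (auto simp: game_struct_def)
qed (rule tp_less tp_empty tp_append; assumption)+

text \<open>The order of moves explains the two kinds of causality. In \<open>E1\<close> the player
  of \<open>Y\<close> chooses an answer to each possible bit of \<open>X\<close>, so the output may
  depend on the current input; in \<open>E2\<close> the player of \<open>X\<close> commits to a bit
  first. Positions include the time, which the machine need not remember, so only the automaton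
  state is memory.\<close>

theorem finite_memory_determinacy:
  assumes \<psi>: "formula_XY \<psi>"
  obtains \<mu> q where "q < state_bound (mlo_code \<psi>)" "\<And>t q x. fst (\<mu> t q x) < state_bound (mlo_code \<psi>)"
    "\<And>X. holds P X (mealy \<mu> q X) \<psi>"
  | \<mu> q where "q < state_bound (mlo_code \<psi>)" "\<And>t q x. fst (\<mu> t q x) < state_bound (mlo_code \<psi>)"
    "\<And>t q x x'. snd (\<mu> t q x) = snd (\<mu> t q x')" "\<And>Y. \<not> holds P (mealy \<mu> q Y) Y \<psi>"
proof -
  interpret word_types "\<lambda>w i j. tp 3 (3 + mlo_code \<psi>) (mlo_code \<psi>) i j (game_struct P w)"
    "tp_bound (3 + mlo_code \<psi>) (mlo_code \<psi>)" "\<lambda>w. holds P {t. fst (w t)} {t. snd (w t)} \<psi>"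
    by (rule word_types_formula[OF \<psi>])
  have sb: "state_bound (mlo_code \<psi>) = prod_encode (2 ^ prod_encode (tp_bound (3 + mlo_code \<psi>) (mlo_code \<psi>),
    prod_encode (tp_bound (3 + mlo_code \<psi>) (mlo_code \<psi>), tp_bound (3 + mlo_code \<psi>) (mlo_code \<psi>))),
    2 * tp_bound (3 + mlo_code \<psi>) (mlo_code \<psi>) + 3)"
    unfolding state_bound_def Let_def mult_2 ..
  obtain q0 \<delta> pr where aut: "q0 < state_bound (mlo_code \<psi>)" "\<And>t q l. \<delta> t q l < state_bound (mlo_code \<psi>)"
    and pr: "\<And>q. pr q < 2 * tp_bound (3 + mlo_code \<psi>) (mlo_code \<psi>) + 3"
    and run: "\<And>w run. run 0 = q0 \<Longrightarrow> (\<And>t. run (Suc t) = \<delta> t (run t) (w t)) \<Longrightarrow>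
       parity even (\<lambda>t. pr (run t)) \<longleftrightarrow> holds P {t. fst (w t)} {t. snd (w t)} \<psi>"
    using deterministic_automaton[folded sb] by blast
  define E1 where "E1 v a = (\<lambda>x. (Suc (fst v), \<delta> (fst v) (snd v) (x, a x))) ` UNIV" for v :: "nat \<times> nat" and a :: "bool \<Rightarrow> bool"
  define E2 where "E2 v x = (\<lambda>y. (Suc (fst v), \<delta> (fst v) (snd v) (x, y))) ` UNIV" for v :: "nat \<times> nat" and x :: bool
  have dual: "(\<forall>a. \<not> E1 v a \<subseteq> A) \<longleftrightarrow> (\<exists>b. E2 v b \<subseteq> - A)" for v A
  proof
    assume *: "\<forall>a. \<not> E1 v a \<subseteq> A"
    show "\<exists>b. E2 v b \<subseteq> - A"
    proof (rule ccontr)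
      assume "\<not> ?thesis"
      then have "\<forall>x. \<exists>y. (Suc (fst v), \<delta> (fst v) (snd v) (x, y)) \<in> A" unfolding E2_def by blast
      from choice[OF this] obtain a where "\<forall>x. (Suc (fst v), \<delta> (fst v) (snd v) (x, a x)) \<in> A" by blast
      then show False using * unfolding E1_def by blast
    qed
  qed (auto simp: E1_def E2_def)
  have prv: "(pr \<circ> snd) v < 2 * tp_bound (3 + mlo_code \<psi>) (mlo_code \<psi>) + 3" for v :: "nat \<times> nat" using pr by simp
  from parity_determined[where pr = "pr \<circ> snd" and ?E1.0 = E1 and ?E2.0 = E2 and ev = even and v = "(0, q0)", OF prv dual]
  show ?thesis
  proof (elim disjE exE)
    fix a assume I: "\<forall>f. f 0 = (0, q0) \<longrightarrow> (\<forall>i. f (Suc i) \<in> E1 (f i) (a (f i))) \<longrightarrow> parity even (\<lambda>i. (pr \<circ> snd) (f i))"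
    define \<mu> where "\<mu> t q x = (\<delta> t q (x, a (t, q) x), a (t, q) x)" for t q x
    have "holds P X (mealy \<mu> q0 X) \<psi>" for X
    proof -
      define r where "r = mealy_state \<mu> q0 X"
      have "parity even (\<lambda>i. (pr \<circ> snd) (i, r i))"
        by (rule I[rule_format, of "\<lambda>i. (i, r i)"]) (auto simp: r_def E1_def \<mu>_def)
      then have "parity even (\<lambda>i. pr (r i))" by simp
      moreover have "parity even (\<lambda>i. pr (r i)) \<longleftrightarrow> holds P {t. fst ((\<lambda>t. (t \<in> X, t \<in> mealy \<mu> q0 X)) t)} {t. snd ((\<lambda>t. (t \<in> X, t \<in> mealy \<mu> q0 X)) t)} \<psi>"
        by (rule run) (auto simp: r_def mealy_def \<mu>_def)
      ultimately show ?thesis by simp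
    qed
    then show ?thesis using that(1)[of q0 \<mu>] aut unfolding \<mu>_def by simp
  next
    fix b assume II: "\<forall>f. f 0 = (0, q0) \<longrightarrow> (\<forall>i. f (Suc i) \<in> E2 (f i) (b (f i))) \<longrightarrow> parity (\<lambda>i. \<not> even i) (\<lambda>i. (pr \<circ> snd) (f i))"
    define \<mu> where "\<mu> t q y = (\<delta> t q (b (t, q), y), b (t, q))" for t q y
    have "\<not> holds P (mealy \<mu> q0 Y) Y \<psi>" for Y
    proof -
      define r where "r = mealy_state \<mu> q0 Y"
      have "parity (\<lambda>i. \<not> even i) (\<lambda>i. (pr \<circ> snd) (i, r i))"
        by (rule II[rule_format, of "\<lambda>i. (i, r i)"]) (auto simp: r_def E2_def \<mu>_def)
      then have "\<not> parity even (\<lambda>i. pr (r i))" using parity_unique by auto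
      moreover have "parity even (\<lambda>i. pr (r i)) \<longleftrightarrow> holds P {t. fst ((\<lambda>t. (t \<in> mealy \<mu> q0 Y, t \<in> Y)) t)} {t. snd ((\<lambda>t. (t \<in> mealy \<mu> q0 Y, t \<in> Y)) t)} \<psi>"
        by (rule run) (auto simp: r_def mealy_def \<mu>_def)
      ultimately show ?thesis by simp
    qed
    then show ?thesis using that(2)[of q0 \<mu>] aut unfolding \<mu>_def by simp
  qed
qed

section \<open>Strategies as tuples of sets\<close>

definition trans_idx :: "nat \<Rightarrow> nat \<Rightarrow> nat \<Rightarrow> nat" where
  "trans_idx x n n' = prod_encode (x, prod_encode (n, n'))"

definition out_idx :: "nat \<Rightarrow> nat" where
  "out_idx n = prod_encode (2, prod_encode (n, 0))"

text \<open>The last entry 1 separates it from every \<open>out_idx n\<close>. Carrying a copy of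
  the predicate in the tuple lets the block types of the tuple see \<open>P\<close>.\<close>

definition param_idx :: nat where
  "param_idx = prod_encode (2, prod_encode (0, 1))"

text \<open>A tuple \<open>A\<close> of sets codes a time-dependent transition table on \<open>N\<close> states: at time \<open>t\<close>
  the input bit \<open>x\<close> allows to pass from \<open>n\<close> to \<open>n'\<close> iff \<open>t \<in> A (trans_idx x n n')\<close>, and the output bit
  at time \<open>t\<close> is read off the state reached. In the run, \<open>R n\<close> is the set of times when the state is \<open>n\<close>.\<close>

definition machine :: "nat \<Rightarrow> (nat \<Rightarrow> nat set) \<Rightarrow> nat set \<Rightarrow> nat set \<Rightarrow> bool" where
  "machine N A X Y \<longleftrightarrow> (\<exists>R. 0 \<in> R 0 \<and> (\<forall>t. \<exists>n<N. t \<in> R n) \<and>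
     (\<forall>t. \<forall>n<N. \<forall>n'<N. t \<in> R n \<and> Suc t \<in> R n' \<longrightarrow>
        (if t \<in> X then t \<in> A (trans_idx 1 n n') else t \<in> A (trans_idx 0 n n')) \<and> (t \<in> Y \<longleftrightarrow> t \<in> A (out_idx n'))))"

text \<open>A Mealy output belongs to a transition, whereas \<open>machine\<close> reads outputs off
  the state reached. The new state therefore stores the pair of the old machine's state and the
  output bit, which needs \<open>prod_encode (B, 2)\<close> numbers.\<close>

lemma machine_mealy:
  assumes q: "q < B" and \<mu>: "\<And>t q x. fst (\<mu> t q x) < B"
  shows "\<exists>A. A param_idx = P \<and> (\<forall>X Y. machine (prod_encode (B, 2)) A X Y \<longleftrightarrow> Y = mealy \<mu> q X)"
proof -
  \<comment> \<open>At time 0 the number 0 stands for \<open>q\<close>, because a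
    \<open>machine\<close> always starts in state 0.\<close>
  define nxt where "nxt t n x = (let m = \<mu> t (if t = 0 then q else fst (prod_decode n)) x in
    prod_encode (fst m, if snd m then 1 else 0))" for t n x
  define A where "A i = (let (x, k) = prod_decode i; (n, n') = prod_decode k in
    if x < 2 then {t. nxt t n (x = 1) = n'} else if n' = 0 then {t. snd (prod_decode n) = 1} else P)" for i
  have A: "A (trans_idx 1 n n') = {t. nxt t n True = n'}" "A (trans_idx 0 n n') = {t. nxt t n False = n'}"
    "A (out_idx n) = {t. snd (prod_decode n) = 1}" "A param_idx = P" for n n'
    unfolding A_def trans_idx_def out_idx_def param_idx_def by simp_all
  define rs where "rs X = rec_nat 0 (\<lambda>t n. nxt t n (t \<in> X))" for X
  have rs: "rs X 0 = 0" "rs X (Suc t) = nxt t (rs X t) (t \<in> X)" for X t unfolding rs_def by simp_all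
  have nxt_less: "nxt t n x < prod_encode (B, 2)" for t n x
    unfolding nxt_def Let_def using \<mu>[of t] by (intro prod_encode_less) (auto intro: less_imp_le)
  have rs_less: "rs X t < prod_encode (B, 2)" for X t
  proof (cases t)
    case 0
    have "0 < prod_encode (B, 2)" using prod_encode_less[of 0 B 0 2] q by simp
    then show ?thesis using 0 rs(1) by simp
  qed (simp add: rs nxt_less)
  have st: "(if t = 0 then q else fst (prod_decode (rs X t))) = mealy_state \<mu> q X t" for X t
    by (induction t) (simp_all add: rs nxt_def Let_def)
  have out: "snd (prod_decode (rs X (Suc t))) = 1 \<longleftrightarrow> t \<in> mealy \<mu> q X" for X t
    unfolding rs nxt_def Let_def st mealy_def by simp
  have tr: "(if t \<in> X then t \<in> A (trans_idx 1 n n') else t \<in> A (trans_idx 0 n n')) \<longleftrightarrow> nxt t n (t \<in> X) = n'"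
    for t X n n' by (simp only: A mem_Collect_eq split: if_split) simp
  have ou: "t \<in> A (out_idx n') \<longleftrightarrow> snd (prod_decode n') = 1" for t n' by (simp add: A)
  have "machine (prod_encode (B, 2)) A X Y \<longleftrightarrow> Y = mealy \<mu> q X" for X Y
  proof
    assume "machine (prod_encode (B, 2)) A X Y"
    then obtain R where R: "0 \<in> R 0" "\<And>t. \<exists>n<prod_encode (B, 2). t \<in> R n"
      "\<And>t n n'. n < prod_encode (B, 2) \<Longrightarrow> n' < prod_encode (B, 2) \<Longrightarrow> t \<in> R n \<Longrightarrow> Suc t \<in> R n' \<Longrightarrow>
        nxt t n (t \<in> X) = n' \<and> (t \<in> Y \<longleftrightarrow> snd (prod_decode n') = 1)"
      unfolding machine_def tr ou by blast
    have in_R: "t \<in> R (rs X t)" for t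
    proof (induction t)
      case (Suc t)
      obtain n' where n': "n' < prod_encode (B, 2)" "Suc t \<in> R n'" using R(2) by blast
      with R(3)[OF rs_less n'(1) Suc n'(2)] show ?case by (simp add: rs)
    qed (simp add: R rs)
    have "t \<in> Y \<longleftrightarrow> t \<in> mealy \<mu> q X" for t
      using R(3)[OF rs_less rs_less in_R in_R, of t] out by simp
    then show "Y = mealy \<mu> q X" by auto
  next
    assume Y: "Y = mealy \<mu> q X"
    show "machine (prod_encode (B, 2)) A X Y"
      unfolding machine_def tr ou Y
      by (rule exI[of _ "\<lambda>n. {t. rs X t = n}"]) (use rs rs_less out in \<open>auto simp: rs(1)\<close>)
  qed
  then show ?thesis using A(4) by blast
qed

text \<open>The last clause, for \<open>X = X'\<close>, makes the relation computed by \<open>A\<close> a function even if the table is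
  not deterministic.\<close>

definition winning_machine :: "nat set \<Rightarrow> mlo \<Rightarrow> bool \<Rightarrow> nat \<Rightarrow> (nat \<Rightarrow> nat set) \<Rightarrow> bool" where
  "winning_machine P \<psi> strong N A \<longleftrightarrow> A param_idx = P \<and> (\<forall>X. \<exists>Y. machine N A X Y \<and> holds P X Y \<psi>) \<and>
     (\<forall>X Y X' Y' t. machine N A X Y \<and> machine N A X' Y' \<and>
        (\<forall>u. (if strong then u < t else u \<le> t) \<longrightarrow> (u \<in> X \<longleftrightarrow> u \<in> X')) \<longrightarrow> (t \<in> Y \<longleftrightarrow> t \<in> Y'))"

lemma winning_machine_ex:
  assumes q: "q < B" and \<mu>: "\<And>t q x. fst (\<mu> t q x) < B"
    and moore: "strong \<Longrightarrow> (\<And>t q x x'. snd (\<mu> t q x) = snd (\<mu> t q x'))"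
    and win: "\<And>X. holds P X (mealy \<mu> q X) \<psi>"
  shows "\<exists>A. winning_machine P \<psi> strong (prod_encode (B, 2)) A"
proof -
  obtain A where A: "A param_idx = P" "\<And>X Y. machine (prod_encode (B, 2)) A X Y \<longleftrightarrow> Y = mealy \<mu> q X"
    using machine_mealy[OF q, of \<mu> P] \<mu> by blast
  have "t \<in> mealy \<mu> q X \<longleftrightarrow> t \<in> mealy \<mu> q X'"
    if *: "\<forall>u. (if strong then u < t else u \<le> t) \<longrightarrow> (u \<in> X \<longleftrightarrow> u \<in> X')" for X X' t
  proof -
    have "mealy_state \<mu> q X t = mealy_state \<mu> q X' t"
      by (rule mealy_state_cong) (use * in \<open>auto split: if_splits\<close>)
    moreover have "snd (\<mu> t s (t \<in> X)) = snd (\<mu> t s (t \<in> X'))" for s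
    proof (cases strong)
      case True
      then show ?thesis by (rule moore)
    next
      case False
      then have "t \<in> X \<longleftrightarrow> t \<in> X'" using * by auto
      then show ?thesis by simp
    qed
    ultimately show ?thesis unfolding mealy_def by simp
  qed
  then have "winning_machine P \<psi> strong (prod_encode (B, 2)) A" using A win unfolding winning_machine_def by blast
  then show ?thesis by blast
qed

lemma winning_machine_operator:
  assumes "winning_machine P \<psi> strong N A"
  shows "\<exists>F. (\<forall>X Y. machine N A X Y \<longleftrightarrow> Y = F X) \<and> (\<forall>X. holds P X (F X) \<psi>) \<and>
    (if strong then strongly_causal F else causal F)"
proof -
  have tot: "\<forall>X. \<exists>Y. machine N A X Y \<and> holds P X Y \<psi>" and
    caus: "\<And>X Y X' Y' t. machine N A X Y \<Longrightarrow> machine N A X' Y' \<Longrightarrow>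
        (\<And>u. (if strong then u < t else u \<le> t) \<Longrightarrow> u \<in> X \<longleftrightarrow> u \<in> X') \<Longrightarrow> t \<in> Y \<longleftrightarrow> t \<in> Y'"
    using assms unfolding winning_machine_def by blast+
  from choice[OF tot] obtain F where F: "\<And>X. machine N A X (F X)" "\<And>X. holds P X (F X) \<psi>" by blast
  have "machine N A X Y \<Longrightarrow> Y = F X" for X Y
    using caus[of X Y X "F X"] F(1) by blast
  then have 1: "machine N A X Y \<longleftrightarrow> Y = F X" for X Y using F(1) by blast
  have "if strong then strongly_causal F else causal F"
  proof (cases strong)
    case True
    have "F X \<inter> {..t} = F X' \<inter> {..t}" if "X \<inter> {..<t} = X' \<inter> {..<t}" for t X X'
    proof -
      have "v \<in> X \<longleftrightarrow> v \<in> X'" if "v < t" for v using \<open>X \<inter> {..<t} = X' \<inter> {..<t}\<close> that by blast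
      then have "u \<in> F X \<longleftrightarrow> u \<in> F X'" if "u \<le> t" for u
        by (intro caus[OF F(1) F(1)]) (use True that in auto)
      then show ?thesis by auto
    qed
    then have "strongly_causal F" unfolding strongly_causal_def by blast
    then show ?thesis using True by simp
  next
    case False
    have "F X \<inter> {..t} = F X' \<inter> {..t}" if "X \<inter> {..t} = X' \<inter> {..t}" for t X X'
    proof -
      have "v \<in> X \<longleftrightarrow> v \<in> X'" if "v \<le> t" for v using \<open>X \<inter> {..t} = X' \<inter> {..t}\<close> that by blast
      then have "u \<in> F X \<longleftrightarrow> u \<in> F X'" if "u \<le> t" for u
        by (intro caus[OF F(1) F(1)]) (use False that in auto)
      then show ?thesis by auto
    qed
    then have "causal F" unfolding causal_def by blast
    then show ?thesis using False by simp
  qed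
  with 1 F(2) show ?thesis by blast
qed

section \<open>Uniformization\<close>

definition consecutive :: "nat set \<Rightarrow> nat \<Rightarrow> nat \<Rightarrow> bool" where
  "consecutive D s t \<longleftrightarrow> s \<in> D \<and> t \<in> D \<and> s < t \<and> (\<forall>u. s < u \<and> u < t \<longrightarrow> u \<notin> D)"

text \<open>Only blocks between consecutive elements are compared, which is less than Ramsey's
  theorem provides. Each instance concerns a finite prefix of \<open>A\<close> and \<open>D\<close>,
  so the condition survives limits.\<close>

definition homogeneous :: "nat \<Rightarrow> nat \<Rightarrow> nat \<Rightarrow> (nat \<Rightarrow> nat set) \<Rightarrow> nat set \<Rightarrow> bool" where
  "homogeneous m n k A D \<longleftrightarrow> (\<forall>s t s' t'. consecutive D s t \<and> consecutive D s' t' \<longrightarrow> tp m n k s t A = tp m n k s' t' A)"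

definition unbounded :: "nat set \<Rightarrow> bool" where
  "unbounded D \<longleftrightarrow> (\<forall>t. \<exists>d. t < d \<and> d \<in> D)"

primrec letter_less :: "nat \<Rightarrow> (nat \<Rightarrow> nat set) \<Rightarrow> (nat \<Rightarrow> nat set) \<Rightarrow> nat \<Rightarrow> bool" where
  "letter_less 0 A' A t \<longleftrightarrow> False"
| "letter_less (Suc i) A' A t \<longleftrightarrow> t \<notin> A' i \<and> t \<in> A i \<or> (t \<in> A' i \<longleftrightarrow> t \<in> A i) \<and> letter_less i A' A t"

text \<open>Preferring an early next element of \<open>D\<close> over a small letter keeps \<open>D\<close> unbounded in the limit of
  the greedy choices.\<close>

definition precedes :: "nat \<Rightarrow> (nat \<Rightarrow> nat set) \<Rightarrow> nat set \<Rightarrow> (nat \<Rightarrow> nat set) \<Rightarrow> nat set \<Rightarrow> bool" where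
  "precedes m A' D' A D \<longleftrightarrow> (\<exists>t. (\<forall>u<t. (u \<in> D' \<longleftrightarrow> u \<in> D) \<and> (\<forall>i<m. u \<in> A' i \<longleftrightarrow> u \<in> A i)) \<and>
     (\<exists>d'. d' \<in> D' \<and> t \<le> d' \<and> (\<forall>d. d \<in> D \<and> t \<le> d \<longrightarrow> d' \<le> d) \<and>
        ((\<forall>d. d \<in> D \<and> t \<le> d \<longrightarrow> d' < d) \<or> letter_less m A' A t)))"

primrec letter :: "nat \<Rightarrow> (nat \<Rightarrow> nat set) \<Rightarrow> nat \<Rightarrow> nat" where
  "letter 0 A t = 0"
| "letter (Suc i) A t = (if t \<in> A i then 2 ^ i else 0) + letter i A t"

lemma letter_bound: "letter i A t < 2 ^ i"
  by (induction i) auto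

lemma letter_less_iff: "letter_less i A' A t \<longleftrightarrow> letter i A' t < letter i A t"
proof (induction i)
  case (Suc i)
  then show ?case using letter_bound[of i A t] letter_bound[of i A' t] by auto
qed simp

lemma letter_eq_iff: "letter m A' t = letter m A t \<longleftrightarrow> (\<forall>i<m. t \<in> A' i \<longleftrightarrow> t \<in> A i)"
proof (induction m)
  case (Suc m)
  show ?case using Suc letter_bound[of m A t] letter_bound[of m A' t] by (auto simp: less_Suc_eq)
qed simp

definition next_in :: "nat set \<Rightarrow> nat \<Rightarrow> nat" where
  "next_in D t = (LEAST d. d \<in> D \<and> t \<le> d)"

lemma next_in:
  assumes "unbounded D"
  shows "next_in D t \<in> D" "t \<le> next_in D t" "d \<in> D \<Longrightarrow> t \<le> d \<Longrightarrow> next_in D t \<le> d"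
proof -
  obtain d0 where "t < d0" "d0 \<in> D" using assms unfolding unbounded_def by blast
  then have "d0 \<in> D \<and> t \<le> d0" by simp
  from LeastI[of "\<lambda>d. d \<in> D \<and> t \<le> d", OF this] show "next_in D t \<in> D" "t \<le> next_in D t"
    unfolding next_in_def by auto
  show "d \<in> D \<Longrightarrow> t \<le> d \<Longrightarrow> next_in D t \<le> d" unfolding next_in_def by (intro Least_le) simp
qed

lemma next_in_eqI: "d \<in> D \<Longrightarrow> t \<le> d \<Longrightarrow> (\<And>u. t \<le> u \<Longrightarrow> u < d \<Longrightarrow> u \<notin> D) \<Longrightarrow> next_in D t = d"
  unfolding next_in_def by (rule Least_equality) (use not_le in blast)+

definition key :: "nat \<Rightarrow> (nat \<Rightarrow> nat set) \<times> nat set \<Rightarrow> nat \<Rightarrow> nat \<times> nat" where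
  "key m x t = (next_in (snd x) t, letter m (fst x) t)"

definition agree :: "nat \<Rightarrow> (nat \<Rightarrow> nat set) \<times> nat set \<Rightarrow> (nat \<Rightarrow> nat set) \<times> nat set \<Rightarrow> nat \<Rightarrow> bool" where
  "agree m x y t \<longleftrightarrow> (\<forall>u<t. (u \<in> snd x \<longleftrightarrow> u \<in> snd y) \<and> letter m (fst x) u = letter m (fst y) u)"

abbreviation lexless :: "nat \<times> nat \<Rightarrow> nat \<times> nat \<Rightarrow> bool" where
  "lexless a b \<equiv> fst a < fst b \<or> fst a = fst b \<and> snd a < snd b"

lemma precedes_iff:
  assumes D: "unbounded D" "unbounded D'"
  shows "precedes m A' D' A D \<longleftrightarrow> (\<exists>t. agree m (A', D') (A, D) t \<and> lexless (key m (A', D') t) (key m (A, D) t))"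
proof -
  have "(\<exists>d'. d' \<in> D' \<and> t \<le> d' \<and> (\<forall>d. d \<in> D \<and> t \<le> d \<longrightarrow> d' \<le> d) \<and>
        ((\<forall>d. d \<in> D \<and> t \<le> d \<longrightarrow> d' < d) \<or> letter_less m A' A t)) \<longleftrightarrow>
     lexless (key m (A', D') t) (key m (A, D) t)" (is "?l \<longleftrightarrow> ?r") for t
  proof
    assume ?l
    then obtain d' where d': "d' \<in> D'" "t \<le> d'" "\<And>d. d \<in> D \<Longrightarrow> t \<le> d \<Longrightarrow> d' \<le> d"
      "(\<forall>d. d \<in> D \<and> t \<le> d \<longrightarrow> d' < d) \<or> letter_less m A' A t" by blast
    have "next_in D' t \<le> d'" using next_in(3)[OF D(2) d'(1,2)] .
    moreover have "d' \<le> next_in D t" using d'(3) next_in[OF D(1)] by blast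
    moreover have "d' < next_in D t \<or> letter_less m A' A t" using d'(4) next_in[OF D(1)] by blast
    ultimately show ?r unfolding key_def letter_less_iff by auto
  next
    assume r: ?r
    show ?l
    proof (intro exI conjI)
      show "next_in D' t \<in> D'" "t \<le> next_in D' t" using next_in[OF D(2)] by auto
      have le: "next_in D' t \<le> next_in D t" using r by (auto simp: key_def)
      show "\<forall>d. d \<in> D \<and> t \<le> d \<longrightarrow> next_in D' t \<le> d" using next_in(3)[OF D(1)] le le_trans by blast
      show "(\<forall>d. d \<in> D \<and> t \<le> d \<longrightarrow> next_in D' t < d) \<or> letter_less m A' A t"
        using r next_in(3)[OF D(1)] less_le_trans unfolding key_def letter_less_iff by fastforce
    qed
  qed
  then show ?thesis unfolding precedes_def agree_def letter_eq_iff by simp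
qed

text \<open>If 0 is in \<open>D\<close>, the first block is empty; for this reason
  \<open>cuts\<close> asks for monotone and not for strictly monotone sequences.\<close>

definition enum_cuts :: "nat set \<Rightarrow> nat \<Rightarrow> nat" where
  "enum_cuts D i = (case i of 0 \<Rightarrow> 0 | Suc j \<Rightarrow> enumerate D j)"

lemma unbounded_infinite: "unbounded D \<longleftrightarrow> infinite D"
  unfolding unbounded_def infinite_nat_iff_unbounded by blast

lemma cuts_enum:
  assumes "unbounded D" shows "cuts (enum_cuts D)"
proof -
  have inf: "infinite D" using assms unbounded_infinite by simp
  have "enumerate D i \<le> enumerate D (Suc i)" for i using enumerate_step[OF inf] by (simp add: less_imp_le)
  then have "mono (enum_cuts D)" by (intro mono_iff_le_Suc[THEN iffD2]) (auto simp: enum_cuts_def split: nat.split)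
  moreover have "a < enum_cuts D (Suc (Suc a))" for a
    using le_enumerate[OF inf, of "Suc a"] by (simp add: enum_cuts_def)
  moreover have "enum_cuts D 0 = 0" by (simp add: enum_cuts_def)
  ultimately show ?thesis unfolding cuts_def by blast
qed

lemma consecutive_enum:
  assumes "unbounded D" shows "consecutive D (enumerate D i) (enumerate D (Suc i))"
proof -
  have inf: "infinite D" using assms unbounded_infinite by simp
  have "u \<notin> D" if "enumerate D i < u" "u < enumerate D (Suc i)" for u
    using not_less_Least[of u "\<lambda>s. s \<in> D \<and> enumerate D i < s"] that enumerate_Suc''[OF inf, of i] by auto
  then show ?thesis unfolding consecutive_def using enumerate_in_set[OF inf] enumerate_step[OF inf] by auto
qed

text \<open>\<open>Good_cuts\<close> is the property of MLO-definable conditions that is needed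
  here: they depend only on the component \<open>p\<close> and on the types of the blocks of some
  factorization.\<close>

locale uniformization =
  fixes m n k p :: nat and P :: "nat set" and Good :: "(nat \<Rightarrow> nat set) \<Rightarrow> bool"
  assumes n: "n = m + k" and p: "p < m"
    and Good_p: "Good A \<Longrightarrow> A p = P"
    and Good_cuts: "Good A \<Longrightarrow> A' p = P \<Longrightarrow> cuts d \<Longrightarrow> cuts d' \<Longrightarrow>
      \<forall>i. tp m n k (d i) (d (Suc i)) A = tp m n k (d' i) (d' (Suc i)) A' \<Longrightarrow> Good A'"
    and Good_ex: "\<exists>A. Good A"
begin

definition candidate :: "(nat \<Rightarrow> nat set) \<Rightarrow> nat set \<Rightarrow> bool" where
  "candidate A D \<longleftrightarrow> Good A \<and> unbounded D \<and> homogeneous m n k A D"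

lemma candidate_ex: "\<exists>A D. candidate A D"
proof -
  obtain A where A: "Good A" using Good_ex by blast
  define f where "f X = tp m n k (Min X) (Max X) A" for X
  have "\<forall>x\<in>UNIV. \<forall>y\<in>UNIV. x \<noteq> y \<longrightarrow> f {x, y} < tp_bound n k" unfolding f_def by (simp add: tp_less)
  from Ramsey2[OF infinite_UNIV_nat this] obtain D c where
    D: "infinite D" "\<forall>x\<in>D. \<forall>y\<in>D. x \<noteq> y \<longrightarrow> f {x, y} = c" by blast
  have "tp m n k s t A = c" if "consecutive D s t" for s t
    using D(2)[rule_format, of s t] that unfolding consecutive_def f_def by (auto simp: max_def min_def)
  then have "homogeneous m n k A D" unfolding homogeneous_def by simp
  then show ?thesis using A D(1) unfolding candidate_def unbounded_infinite by blast
qed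

lemma tp_agree:
  assumes "agree m (A, D) (A', D') t" shows "u \<le> t \<Longrightarrow> tp m n k s u A = tp m n k s u A'"
  using assms unfolding agree_def letter_eq_iff n by (intro tp_cong) auto

lemma consecutive_agree:
  "agree m x y t \<Longrightarrow> u < t \<Longrightarrow> consecutive (snd x) s u \<longleftrightarrow> consecutive (snd y) s u"
  unfolding agree_def consecutive_def by (meson less_trans)

text \<open>The candidates left after minimizing the keys at the first \<open>t\<close> times. Each
  stage is nonempty, but the stages shrink and a common member is not immediate; therefore a limit
  of picks is examined instead.\<close>

primrec best :: "nat \<Rightarrow> ((nat \<Rightarrow> nat set) \<times> nat set) set" where
  "best 0 = {x. candidate (fst x) (snd x)}"
| "best (Suc t) = {x \<in> best t. \<forall>y\<in>best t. \<not> lexless (key m y t) (key m x t)}"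

lemma best_ne: "best t \<noteq> {}"
proof (induction t)
  case 0
  then show ?case using candidate_ex by auto
next
  case (Suc t)
  define a where "a = (LEAST a. \<exists>x\<in>best t. fst (key m x t) = a)"
  have a: "\<exists>x\<in>best t. fst (key m x t) = a" unfolding a_def by (rule LeastI_ex) (use Suc in blast)
  have a_le: "a \<le> fst (key m x t)" if "x \<in> best t" for x unfolding a_def by (rule Least_le) (use that in blast)
  define b where "b = (LEAST b. \<exists>x\<in>best t. fst (key m x t) = a \<and> snd (key m x t) = b)"
  have b: "\<exists>x\<in>best t. fst (key m x t) = a \<and> snd (key m x t) = b" unfolding b_def by (rule LeastI_ex) (use a in blast)
  have b_le: "b \<le> snd (key m x t)" if "x \<in> best t" "fst (key m x t) = a" for x
    unfolding b_def by (rule Least_le) (use that in blast)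
  obtain x where x: "x \<in> best t" "fst (key m x t) = a" "snd (key m x t) = b" using b by blast
  have "\<not> lexless (key m y t) (key m x t)" if "y \<in> best t" for y
    using a_le[OF that] b_le[OF that] x by auto
  then have "x \<in> best (Suc t)" using x(1) by simp
  then show ?case by blast
qed

lemma best_antimono: "t \<le> t' \<Longrightarrow> best t' \<subseteq> best t"
  by (induction t' rule: dec_induct) auto

lemma best_candidate: "x \<in> best t \<Longrightarrow> candidate (fst x) (snd x)"
  using best_antimono[of 0 t] by auto

lemma best_key: "x \<in> best (Suc t) \<Longrightarrow> y \<in> best (Suc t) \<Longrightarrow> key m x t = key m y t"
  by (auto intro!: prod_eqI) (metis linorder_neqE_nat)+

text \<open>Equal keys at \<open>u\<close> mean equal letters and equal next elements of
  \<open>D\<close>, and \<open>u\<close> is in \<open>D\<close> iff the next element from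
  \<open>u\<close> on is \<open>u\<close> itself.\<close>

lemma best_agree: "x \<in> best t \<Longrightarrow> y \<in> best t \<Longrightarrow> agree m x y t"
  unfolding agree_def
proof (intro allI impI)
  fix u assume x: "x \<in> best t" and y: "y \<in> best t" and u: "u < t"
  have "key m x u = key m y u"
    by (rule best_key) (use x y u best_antimono[of "Suc u" t] in auto)
  then have eq: "next_in (snd x) u = next_in (snd y) u" "letter m (fst x) u = letter m (fst y) u"
    by (auto simp: key_def)
  have "u \<in> snd z \<longleftrightarrow> next_in (snd z) u = u" if "z \<in> best t" for z
  proof -
    have "unbounded (snd z)" using best_candidate[OF that] by (simp add: candidate_def)
    from next_in[OF this] show ?thesis by (metis le_antisym order_refl)
  qed
  then show "(u \<in> snd x \<longleftrightarrow> u \<in> snd y) \<and> letter m (fst x) u = letter m (fst y) u" using x y eq by simp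
qed

definition pick :: "nat \<Rightarrow> (nat \<Rightarrow> nat set) \<times> nat set" where
  "pick t = (SOME x. x \<in> best t)"

lemma pick: "pick t \<in> best t"
  unfolding pick_def using best_ne[of t] by (simp add: some_in_eq)

definition lim :: "(nat \<Rightarrow> nat set) \<times> nat set" where
  "lim = (\<lambda>i. {t. t \<in> fst (pick (Suc t)) i}, {t. t \<in> snd (pick (Suc t))})"

lemma agree_lim: "x \<in> best t \<Longrightarrow> agree m x lim t"
  unfolding agree_def
proof (intro allI impI)
  fix u assume x: "x \<in> best t" and u: "u < t"
  then have "x \<in> best (Suc u)" using best_antimono[of "Suc u" t] by auto
  from best_agree[OF this pick] have "(u \<in> snd x \<longleftrightarrow> u \<in> snd (pick (Suc u)))"
    "letter m (fst x) u = letter m (fst (pick (Suc u))) u" unfolding agree_def by auto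
  then show "(u \<in> snd x \<longleftrightarrow> u \<in> snd lim) \<and> letter m (fst x) u = letter m (fst lim) u"
    unfolding letter_eq_iff by (simp add: lim_def)
qed

text \<open>A key looks ahead to the next element \<open>d\<close> of \<open>D\<close>, so agreement
  up to \<open>t\<close> is not enough. A survivor \<open>y\<close> of stage \<open>Suc d\<close>
  has the same next element and agrees with the limit up to and including \<open>d\<close>. The
  limit thus inherits \<open>d\<close>, and in particular stays unbounded.\<close>

lemma key_lim: "x \<in> best (Suc t) \<Longrightarrow> key m x t = key m lim t" and unbounded_lim: "unbounded (snd lim)"
proof -
  have *: "next_in (snd x) t \<in> snd lim \<and> next_in (snd x) t = next_in (snd lim) t" if x: "x \<in> best (Suc t)" for x t
  proof -
    define d where "d = next_in (snd x) t"
    have "unbounded (snd x)" using best_candidate[OF x] by (simp add: candidate_def)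
    then have d: "t \<le> d" unfolding d_def using next_in by simp
    define y where "y = pick (Suc d)"
    have y: "y \<in> best (Suc d)" unfolding y_def by (rule pick)
    then have y': "y \<in> best (Suc t)" using best_antimono[of "Suc t" "Suc d"] d by auto
    have yd: "next_in (snd y) t = d" using best_key[OF x y'] unfolding d_def by (simp add: key_def)
    have "unbounded (snd y)" using best_candidate[OF y] by (simp add: candidate_def)
    note nx = next_in[OF this, where t = t, unfolded yd]
    have ag: "u \<in> snd y \<longleftrightarrow> u \<in> snd lim" if "u \<le> d" for u
      using agree_lim[OF y] that unfolding agree_def by simp
    have "d \<in> snd lim" using nx(1) ag by simp
    moreover have "next_in (snd lim) t = d"
    proof (rule next_in_eqI[OF \<open>d \<in> snd lim\<close> d])
      fix u assume "t \<le> u" "u < d"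
      then show "u \<notin> snd lim" using nx(3)[of u] ag[of u] by auto
    qed
    ultimately show ?thesis unfolding d_def by simp
  qed
  have letter: "letter m (fst x) t = letter m (fst lim) t" if "x \<in> best (Suc t)" for x t
    using agree_lim[OF that] unfolding agree_def by simp
  show "x \<in> best (Suc t) \<Longrightarrow> key m x t = key m lim t" using * letter by (simp add: key_def del: best.simps)
  show "unbounded (snd lim)"
    unfolding unbounded_def
  proof
    fix t
    have "unbounded (snd (pick (Suc (Suc t))))" using best_candidate[OF pick] by (simp add: candidate_def)
    from next_in(2)[OF this, of "Suc t"] *[OF pick, of "Suc t"] show "\<exists>d. t < d \<and> d \<in> snd lim"
      by (metis Suc_le_lessD)
  qed
qed

text \<open>Let \<open>d0 < d1\<close> be the first two cuts of the limit. The single approximation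
  \<open>pick (Suc d1)\<close> agrees with the limit through \<open>d1\<close>, so both have the
  same initial block and the same type on the block from \<open>d0\<close> to \<open>d1\<close>.
  Homogeneity spreads this type to all later blocks of both, wherever these blocks lie, and
  \<open>Good_cuts\<close> applies.\<close>

lemma candidate_lim: "candidate (fst lim) (snd lim)"
proof -
  have ag: "agree m (fst (pick t), snd (pick t)) (fst lim, snd lim) t" for t using agree_lim[OF pick] by simp
  have hom: "homogeneous m n k (fst lim) (snd lim)"
    unfolding homogeneous_def
  proof (intro allI impI, elim conjE)
    fix s t s' t' assume st: "consecutive (snd lim) s t" "consecutive (snd lim) s' t'"
    define u where "u = Suc (max t t')"
    have "consecutive (snd (pick u)) s t" "consecutive (snd (pick u)) s' t'"
      using consecutive_agree[OF ag[of u], of t s] consecutive_agree[OF ag[of u], of t' s'] st by (auto simp: u_def)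
    then have "tp m n k s t (fst (pick u)) = tp m n k s' t' (fst (pick u))"
      using best_candidate[OF pick, of u] unfolding candidate_def homogeneous_def by blast
    then show "tp m n k s t (fst lim) = tp m n k s' t' (fst lim)"
      using tp_agree[OF ag[of u], of t s] tp_agree[OF ag[of u], of t' s'] by (simp add: u_def)
  qed
  define d0 where "d0 = enumerate (snd lim) 0"
  define d1 where "d1 = enumerate (snd lim) 1"
  have c01: "consecutive (snd lim) d0 d1" using consecutive_enum[OF unbounded_lim, of 0] by (simp add: d0_def d1_def)
  then have lt: "d0 < d1" by (simp add: consecutive_def)
  define A where "A = fst (pick (Suc d1))"
  define D where "D = snd (pick (Suc d1))"
  have AD: "candidate A D" unfolding A_def D_def by (rule best_candidate[OF pick])
  then have uD: "unbounded D" and Good: "Good A" and homD: "homogeneous m n k A D" by (auto simp: candidate_def)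
  have agD: "agree m (A, D) (fst lim, snd lim) (Suc d1)" unfolding A_def D_def by (rule ag)
  have cD: "consecutive D d0 d1" using consecutive_agree[OF agD, of d1 d0] c01 by simp
  have d0D: "enumerate D 0 = d0"
  proof -
    have "(LEAST x. x \<in> D) = d0"
    proof (rule Least_equality)
      show "d0 \<in> D" using cD by (simp add: consecutive_def)
      fix y assume y: "y \<in> D"
      show "d0 \<le> y"
      proof (rule ccontr)
        assume "\<not> d0 \<le> y"
        then have "y \<in> snd lim" using agD y lt unfolding agree_def by simp
        then have "d0 \<le> y" unfolding d0_def enumerate_0 by (rule Least_le)
        then show False using \<open>\<not> d0 \<le> y\<close> by simp
      qed
    qed
    then show ?thesis by (simp add: enumerate_0)
  qed
  have segD: "tp m n k (enumerate D i) (enumerate D (Suc i)) A = tp m n k d0 d1 A" for i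
    using homD consecutive_enum[OF uD, of i] cD unfolding homogeneous_def by blast
  have seg_lim: "tp m n k (enumerate (snd lim) i) (enumerate (snd lim) (Suc i)) (fst lim) = tp m n k d0 d1 (fst lim)" for i
    using hom consecutive_enum[OF unbounded_lim, of i] c01 unfolding homogeneous_def by blast
  have eq: "tp m n k d0 d1 A = tp m n k d0 d1 (fst lim)" "tp m n k 0 d0 A = tp m n k 0 d0 (fst lim)"
    using tp_agree[OF agD] lt by auto
  have segs: "\<forall>i. tp m n k (enum_cuts D i) (enum_cuts D (Suc i)) A
    = tp m n k (enum_cuts (snd lim) i) (enum_cuts (snd lim) (Suc i)) (fst lim)"
  proof
    fix i
    show "tp m n k (enum_cuts D i) (enum_cuts D (Suc i)) A
      = tp m n k (enum_cuts (snd lim) i) (enum_cuts (snd lim) (Suc i)) (fst lim)"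
      by (cases i) (simp_all only: enum_cuts_def nat.case segD seg_lim eq d0D d0_def[symmetric])
  qed
  have lim_p: "fst lim p = P"
  proof (intro set_eqI)
    fix t
    have "fst (pick (Suc t)) p = P" using best_candidate[OF pick, of "Suc t"] Good_p by (simp add: candidate_def)
    then show "t \<in> fst lim p \<longleftrightarrow> t \<in> P" by (simp add: lim_def)
  qed
  have "Good (fst lim)"
    by (rule Good_cuts[OF Good lim_p cuts_enum[OF uD] cuts_enum[OF unbounded_lim] segs])
  then show ?thesis using hom unbounded_lim by (simp add: candidate_def)
qed

definition least_candidate :: "(nat \<Rightarrow> nat set) \<Rightarrow> nat set \<Rightarrow> bool" where
  "least_candidate A D \<longleftrightarrow> candidate A D \<and> \<not> (\<exists>A' D'. candidate A' D' \<and> precedes m A' D' A D)"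

text \<open>A candidate \<open>x\<close> preceding the limit at time \<open>t\<close> would have
  survived all stages up to \<open>t\<close> and then beaten a survivor of stage
  \<open>Suc t\<close>, whose key at \<open>t\<close> is that of the limit.\<close>

lemma least_candidate_lim: "least_candidate (fst lim) (snd lim)"
proof -
  have False if x: "candidate (fst x) (snd x)" and prec: "precedes m (fst x) (snd x) (fst lim) (snd lim)" for x
  proof -
    have ux: "unbounded (snd x)" using x by (simp add: candidate_def)
    obtain t where t: "agree m x lim t" "lexless (key m x t) (key m lim t)"
      using prec unfolding precedes_iff[OF unbounded_lim ux] by auto
    have "u \<le> t \<Longrightarrow> x \<in> best u" for u
    proof (induction u)
      case 0
      then show ?case using x by simp
    next
      case (Suc u)
      then have xu: "x \<in> best u" and ut: "u < t" by auto
      show ?case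
      proof (rule ccontr)
        \<comment> \<open>Agreement before \<open>t\<close> does not make the keys at
          \<open>u < t\<close> equal, since the next element may lie beyond. If \<open>x\<close>
          lost at \<open>u\<close>, the limit has the earlier next element, both next elements are
          at least \<open>t\<close>, and so the limit also has the smaller key at
          \<open>t\<close>.\<close>
        assume "x \<notin> best (Suc u)"
        then obtain y where y: "y \<in> best u" "lexless (key m y u) (key m x u)" using xu by auto
        define z where "z = pick (Suc u)"
        have z: "z \<in> best (Suc u)" unfolding z_def by (rule pick)
        then have "\<not> lexless (key m y u) (key m z u)" using y(1) by simp
        then have "lexless (key m lim u) (key m x u)" using y(2) key_lim[OF z] by auto
        moreover have "letter m (fst x) u = letter m (fst lim) u" using t(1) ut unfolding agree_def by simp
        ultimately have lt: "next_in (snd lim) u < next_in (snd x) u" by (simp add: key_def)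
        have ag: "v \<in> snd x \<longleftrightarrow> v \<in> snd lim" if "v < t" for v using t(1) that unfolding agree_def by simp
        note nl = next_in[OF unbounded_lim, where t = u] and nxx = next_in[OF ux, where t = u]
        have Nt: "t \<le> next_in (snd lim) u"
        proof (rule ccontr)
          assume "\<not> t \<le> next_in (snd lim) u"
          then have "next_in (snd lim) u \<in> snd x" using ag nl(1) by simp
          then have "next_in (snd x) u \<le> next_in (snd lim) u" using nxx(3) nl(2) by simp
          then show False using lt by simp
        qed
        have "next_in (snd lim) t = next_in (snd lim) u"
          by (rule next_in_eqI[OF nl(1) Nt]) (use nl(3) ut in fastforce)
        moreover have "next_in (snd x) t = next_in (snd x) u"
          by (rule next_in_eqI[OF nxx(1)]) (use nxx(3) ut Nt lt in fastforce)+
        ultimately have "fst (key m lim t) < fst (key m x t)" using lt by (simp add: key_def)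
        then show False using t(2) by auto
      qed
    qed
    then have "x \<in> best t" by simp
    moreover have "pick (Suc t) \<in> best (Suc t)" by (rule pick)
    ultimately have "\<not> lexless (key m x t) (key m (pick (Suc t)) t)" by simp
    then show False using t(2) key_lim[OF pick, of t] by simp
  qed
  then show ?thesis unfolding least_candidate_def using candidate_lim by fastforce
qed

lemma least_candidate_unique:
  assumes "least_candidate A D" "least_candidate A' D'"
  shows "D = D'" "i < m \<Longrightarrow> A i = A' i"
proof -
  have c: "candidate A D" "candidate A' D'" and u: "unbounded D" "unbounded D'"
    and np: "\<not> precedes m A D A' D'" "\<not> precedes m A' D' A D"
    using assms unfolding least_candidate_def candidate_def by auto
  have "agree m (A, D) (A', D') t" for t
  proof (induction t)
    case 0
    then show ?case by (simp add: agree_def)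
  next
    case (Suc t)
    then have "agree m (A', D') (A, D) t" by (simp add: agree_def)
    then have "\<not> lexless (key m (A, D) t) (key m (A', D') t)" "\<not> lexless (key m (A', D') t) (key m (A, D) t)"
      using np Suc unfolding precedes_iff[OF u] precedes_iff[OF u(2,1)] by auto
    then have eq: "next_in D t = next_in D' t" "letter m A t = letter m A' t" by (auto simp: key_def)
    have "t \<in> D \<longleftrightarrow> next_in D t = t" if "unbounded D" for D using next_in[OF that] by (metis le_antisym order_refl)
    then have "t \<in> D \<longleftrightarrow> t \<in> D'" using eq(1) u by simp
    then show ?case using Suc eq(2) unfolding agree_def by (auto simp: less_Suc_eq)
  qed
  then have "(u \<in> D \<longleftrightarrow> u \<in> D') \<and> (\<forall>i<m. u \<in> A i \<longleftrightarrow> u \<in> A' i)" for u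
    unfolding agree_def letter_eq_iff by fastforce
  then show "D = D'" "i < m \<Longrightarrow> A i = A' i" by auto
qed

end

section \<open>The defining formulas\<close>

abbreviation Or where "Or \<phi> \<chi> \<equiv> Neg (Conj (Neg \<phi>) (Neg \<chi>))"
abbreviation Imp where "Imp \<phi> \<chi> \<equiv> Neg (Conj \<phi> (Neg \<chi>))"
abbreviation Iff where "Iff \<phi> \<chi> \<equiv> Conj (Imp \<phi> \<chi>) (Imp \<chi> \<phi>)"
abbreviation AllElem where "AllElem t \<phi> \<equiv> Neg (ExElem t (Neg \<phi>))"
abbreviation AllSet where "AllSet X \<phi> \<equiv> Neg (ExSet X (Neg \<phi>))"

text \<open>Set variables come in groups \<open>g\<close>: 0 for single sets (0 and 1 are \<open>X\<close> and \<open>Y\<close>, 4 and 5 are sets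
  of cuts), 1 for the tuple \<open>A\<close>, 2 for the second tuple in a comparison of types, 3 for runs, and
  4 for the tuple that group 1 is compared with.\<close>

definition V :: "nat \<Rightarrow> nat \<Rightarrow> nat" where
  "V g i = prod_encode (g, i)"

lemma V_eq [simp]: "V g i = V h j \<longleftrightarrow> g = h \<and> i = j"
  by (simp add: V_def)

lemma V_0: "V 0 0 = 0" "V 0 1 = 1"
  by (simp_all add: V_def prod_encode_def)

definition Tru :: mlo where
  "Tru = ExElem 0 (Equal 0 0)"

primrec BigConj :: "(nat \<Rightarrow> mlo) \<Rightarrow> nat \<Rightarrow> mlo" where
  "BigConj \<phi> 0 = Tru"
| "BigConj \<phi> (Suc n) = Conj (BigConj \<phi> n) (\<phi> n)"

primrec ExBlock :: "nat \<Rightarrow> nat \<Rightarrow> mlo \<Rightarrow> mlo" where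
  "ExBlock g 0 \<phi> = \<phi>"
| "ExBlock g (Suc n) \<phi> = ExSet (V g n) (ExBlock g n \<phi>)"

lemma sat_Tru [simp]: "sat P e s Tru" and free_Tru [simp]: "free_elem Tru = {}" "free_set Tru = {}"
  by (simp_all add: Tru_def)

lemma sat_BigConj [simp]: "sat P e s (BigConj \<phi> n) \<longleftrightarrow> (\<forall>i<n. sat P e s (\<phi> i))"
  by (induction n) (auto simp: less_Suc_eq)

lemma free_BigConj [simp]: "free_elem (BigConj \<phi> n) = (\<Union>i<n. free_elem (\<phi> i))"
    "free_set (BigConj \<phi> n) = (\<Union>i<n. free_set (\<phi> i))"
  by (induction n) (auto simp: lessThan_Suc)

definition upd :: "(nat \<Rightarrow> nat set) \<Rightarrow> nat \<Rightarrow> nat \<Rightarrow> (nat \<Rightarrow> nat set) \<Rightarrow> nat \<Rightarrow> nat set" where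
  "upd s g n B = (\<lambda>v. if fst (prod_decode v) = g \<and> snd (prod_decode v) < n then B (snd (prod_decode v)) else s v)"

lemma upd_V [simp]: "upd s g n B (V h i) = (if h = g \<and> i < n then B i else s (V h i))"
  by (simp add: upd_def V_def)

lemma sat_ExBlock [simp]: "sat P e s (ExBlock g n \<phi>) \<longleftrightarrow> (\<exists>B. sat P e (upd s g n B) \<phi>)"
proof (induction n arbitrary: s)
  case 0
  have "upd s g 0 B = s" for B by (auto simp: upd_def)
  then show ?case by simp
next
  case (Suc n)
  have eq: "upd (s(V g n := C)) g n B = upd s g (Suc n) (B(n := C))" for B C
  proof
    fix v
    obtain h i where "v = V h i" by (metis V_def prod_decode_inverse surj_pair)
    then show "upd (s(V g n := C)) g n B v = upd s g (Suc n) (B(n := C)) v" by auto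
  qed
  have "(\<exists>C B. sat P e (upd s g (Suc n) (B(n := C))) \<phi>) \<longleftrightarrow> (\<exists>B. sat P e (upd s g (Suc n) B) \<phi>)"
    by (metis fun_upd_triv)
  then show ?case by (simp add: Suc eq del: fun_upd_apply)
qed

lemma free_ExBlock [simp]: "free_elem (ExBlock g n \<phi>) = free_elem \<phi>"
    "free_set (ExBlock g n \<phi>) = free_set \<phi> - V g ` {..<n}"
  by (induction n) (auto simp: lessThan_Suc)

text \<open>Tags are at most 2 and states are below \<open>N\<close>, which explains the tuple
  length \<open>m = prod_encode (3, prod_encode (N, N))\<close> used from here on.\<close>

lemma trans_idx_less: "n < N \<Longrightarrow> n' < N \<Longrightarrow> x < 2 \<Longrightarrow> trans_idx x n n' < prod_encode (3, prod_encode (N, N))"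
  and out_idx_less: "n < N \<Longrightarrow> out_idx n < prod_encode (3, prod_encode (N, N))"
  and param_idx_less: "0 < N \<Longrightarrow> param_idx < prod_encode (3, prod_encode (N, N))"
  unfolding trans_idx_def out_idx_def param_idx_def by (auto intro!: prod_encode_less prod_encode_mono)

definition zeroF :: "nat \<Rightarrow> mlo" where
  "zeroF t = Neg (ExElem 2 (Less 2 t))"

definition succF :: "nat \<Rightarrow> nat \<Rightarrow> mlo" where
  "succF t u = Conj (Less t u) (Neg (ExElem 2 (Conj (Less t 2) (Less 2 u))))"

definition transF :: "nat \<Rightarrow> nat \<Rightarrow> nat \<Rightarrow> nat \<Rightarrow> mlo" where
  "transF x y n n' = Imp (Conj (Elem 0 (V 3 n)) (Elem 1 (V 3 n')))
     (Conj (Conj (Imp (Elem 0 (V 0 x)) (Elem 0 (V 1 (trans_idx 1 n n'))))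
                 (Imp (Neg (Elem 0 (V 0 x))) (Elem 0 (V 1 (trans_idx 0 n n')))))
           (Iff (Elem 0 (V 0 y)) (Elem 0 (V 1 (out_idx n')))))"

definition machineF :: "nat \<Rightarrow> nat \<Rightarrow> nat \<Rightarrow> mlo" where
  "machineF N x y = ExBlock 3 N (Conj (Conj
     (AllElem 0 (Imp (zeroF 0) (Elem 0 (V 3 0))))
     (AllElem 0 (Neg (BigConj (\<lambda>n. Neg (Elem 0 (V 3 n))) N))))
     (AllElem 0 (AllElem 1 (Imp (succF 0 1) (BigConj (\<lambda>n. BigConj (\<lambda>n'. transF x y n n') N) N)))))"

lemma sat_zeroF: "t \<noteq> 2 \<Longrightarrow> sat P e s (zeroF t) \<longleftrightarrow> e t = 0"
  unfolding zeroF_def by auto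

lemma sat_succF: "t \<noteq> 2 \<Longrightarrow> u \<noteq> 2 \<Longrightarrow> sat P e s (succF t u) \<longleftrightarrow> e u = Suc (e t)"
proof -
  have "a < b \<and> \<not> (\<exists>u. a < u \<and> u < b) \<longleftrightarrow> b = Suc a" for a b :: nat
    by (metis Suc_lessI lessI less_antisym not_less_eq)
  then show "t \<noteq> 2 \<Longrightarrow> u \<noteq> 2 \<Longrightarrow> ?thesis" unfolding succF_def by simp
qed

lemma sat_transF: "sat P e s (transF x y n n') \<longleftrightarrow> (e 0 \<in> s (V 3 n) \<and> e 1 \<in> s (V 3 n') \<longrightarrow>
    ((e 0 \<in> s (V 0 x) \<longrightarrow> e 0 \<in> s (V 1 (trans_idx 1 n n'))) \<and> (e 0 \<notin> s (V 0 x) \<longrightarrow> e 0 \<in> s (V 1 (trans_idx 0 n n')))) \<and>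
    (e 0 \<in> s (V 0 y) \<longleftrightarrow> e 0 \<in> s (V 1 (out_idx n'))))"
  unfolding transF_def by auto

lemma sat_machineF [simp]: "sat P e s (machineF N x y) \<longleftrightarrow> machine N (\<lambda>i. s (V 1 i)) (s (V 0 x)) (s (V 0 y))"
  unfolding machineF_def machine_def if_bool_eq_conj
  by (cases "N = 0") (simp, simp add: sat_zeroF sat_succF sat_transF, rule ex_cong1, blast)

lemma free_elem_machineF [simp]: "free_elem (machineF N x y) = {}"
  unfolding machineF_def zeroF_def succF_def transF_def by auto

lemma free_set_machineF: "0 < N \<Longrightarrow> free_set (machineF N x y) \<subseteq> {V 0 x, V 0 y} \<union> V 1 ` {..<prod_encode (3, prod_encode (N, N))}"
  unfolding machineF_def zeroF_def succF_def transF_def by (auto simp: trans_idx_less out_idx_less)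

definition paramF :: mlo where
  "paramF = AllElem 0 (Iff (Elem 0 (V 1 param_idx)) (Param 0))"

definition winsF :: "nat \<Rightarrow> mlo \<Rightarrow> mlo" where
  "winsF N \<psi> = AllSet (V 0 0) (ExSet (V 0 1) (Conj (machineF N 0 1) \<psi>))"

definition pastF :: "bool \<Rightarrow> mlo" where
  "pastF strong = AllElem 1 (Imp (if strong then Less 1 0 else Neg (Less 0 1)) (Iff (Elem 1 (V 0 0)) (Elem 1 (V 0 2))))"

definition causalF :: "bool \<Rightarrow> nat \<Rightarrow> mlo" where
  "causalF strong N = AllSet (V 0 0) (AllSet (V 0 1) (AllSet (V 0 2) (AllSet (V 0 3) (AllElem 0
     (Imp (Conj (machineF N 0 1) (Conj (machineF N 2 3) (pastF strong))) (Iff (Elem 0 (V 0 1)) (Elem 0 (V 0 3))))))))"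

definition winF :: "bool \<Rightarrow> nat \<Rightarrow> mlo \<Rightarrow> mlo" where
  "winF strong N \<psi> = Conj paramF (Conj (winsF N \<psi>) (causalF strong N))"

lemma sat_eq_holds_V: "formula_XY \<psi> \<Longrightarrow> sat P e s \<psi> \<longleftrightarrow> holds P (s (V 0 0)) (s (V 0 1)) \<psi>"
  unfolding V_0 by (rule sat_eq_holds)

lemma sat_paramF: "sat P e s paramF \<longleftrightarrow> s (V 1 param_idx) = P"
  unfolding paramF_def by auto

lemma sat_winsF: "formula_XY \<psi> \<Longrightarrow> sat P e s (winsF N \<psi>) \<longleftrightarrow> (\<forall>X. \<exists>Y. machine N (\<lambda>i. s (V 1 i)) X Y \<and> holds P X Y \<psi>)"
  unfolding winsF_def by (simp add: sat_eq_holds_V)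

lemma sat_pastF: "sat P e s (pastF strong) \<longleftrightarrow> (\<forall>u. (if strong then u < e 0 else u \<le> e 0) \<longrightarrow> (u \<in> s (V 0 0) \<longleftrightarrow> u \<in> s (V 0 2)))"
  unfolding pastF_def by auto

lemma sat_causalF: "sat P e s (causalF strong N) \<longleftrightarrow>
    (\<forall>X Y X' Y' t. machine N (\<lambda>i. s (V 1 i)) X Y \<and> machine N (\<lambda>i. s (V 1 i)) X' Y' \<and>
        (\<forall>u. (if strong then u < t else u \<le> t) \<longrightarrow> (u \<in> X \<longleftrightarrow> u \<in> X')) \<longrightarrow> (t \<in> Y \<longleftrightarrow> t \<in> Y'))"
proof -
  have "sat P e s (causalF strong N) \<longleftrightarrow> (\<forall>X Y X' Y' t.
     sat P (e(0 := t)) (s(V 0 0 := X, V 0 1 := Y, V 0 2 := X', V 0 3 := Y'))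
       (Imp (Conj (machineF N 0 1) (Conj (machineF N 2 3) (pastF strong))) (Iff (Elem 0 (V 0 1)) (Elem 0 (V 0 3)))))"
    unfolding causalF_def by (simp only: sat.simps not_ex not_not)
  moreover have "sat P (e(0 := t)) (s(V 0 0 := X, V 0 1 := Y, V 0 2 := X', V 0 3 := Y'))
       (Imp (Conj (machineF N 0 1) (Conj (machineF N 2 3) (pastF strong))) (Iff (Elem 0 (V 0 1)) (Elem 0 (V 0 3)))) \<longleftrightarrow>
     (machine N (\<lambda>i. s (V 1 i)) X Y \<and> machine N (\<lambda>i. s (V 1 i)) X' Y' \<and>
        (\<forall>u. (if strong then u < t else u \<le> t) \<longrightarrow> (u \<in> X \<longleftrightarrow> u \<in> X')) \<longrightarrow> (t \<in> Y \<longleftrightarrow> t \<in> Y'))" for X Y X' Y' t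
    by (cases strong) (auto simp: sat_pastF)
  ultimately show ?thesis by simp
qed

lemma sat_winF: "formula_XY \<psi> \<Longrightarrow> sat P e s (winF strong N \<psi>) \<longleftrightarrow> winning_machine P \<psi> strong N (\<lambda>i. s (V 1 i))"
  unfolding winF_def winning_machine_def by (simp only: sat.simps sat_paramF sat_winsF sat_causalF)

lemma free_elem_winF: "free_elem \<psi> = {} \<Longrightarrow> free_elem (winF strong N \<psi>) = {}"
  unfolding winF_def paramF_def winsF_def causalF_def pastF_def by auto

lemma free_set_winF: "0 < N \<Longrightarrow> free_set \<psi> \<subseteq> {V 0 0, V 0 1} \<Longrightarrow> free_set (winF strong N \<psi>) \<subseteq> V 1 ` {..<prod_encode (3, prod_encode (N, N))}"
  using free_set_machineF[of N 0 1] free_set_machineF[of N 2 3] param_idx_less[of N]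
  unfolding winF_def paramF_def winsF_def causalF_def pastF_def by auto

section \<open>Equality of types as a formula\<close>

definition meetF :: "nat \<Rightarrow> nat \<Rightarrow> nat \<Rightarrow> nat \<Rightarrow> nat \<Rightarrow> mlo" where
  "meetF g t u i j = ExElem 4 (Conj (Conj (Neg (Less 4 t)) (Less 4 u)) (Conj (Elem 4 (V g i)) (Elem 4 (V g j))))"

definition beforeF :: "nat \<Rightarrow> nat \<Rightarrow> nat \<Rightarrow> nat \<Rightarrow> nat \<Rightarrow> mlo" where
  "beforeF g t u i j = ExElem 4 (ExElem 5 (Conj (Conj (Neg (Less 4 t)) (Conj (Less 4 5) (Less 5 u)))
     (Conj (Elem 4 (V g i)) (Elem 5 (V g j)))))"

text \<open>Element variables 0, 1 delimit the segment of the tuple in group 1, and 2, 3 that of group 2.\<close>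

primrec typeF :: "nat \<Rightarrow> nat \<Rightarrow> nat \<Rightarrow> mlo" where
  "typeF m n 0 = BigConj (\<lambda>i. BigConj (\<lambda>j. Conj (Iff (meetF 1 0 1 i j) (meetF 2 2 3 i j))
     (Iff (beforeF 1 0 1 i j) (beforeF 2 2 3 i j))) n) n"
| "typeF m n (Suc k) = Conj (AllSet (V 1 (m + k)) (ExSet (V 2 (m + k)) (typeF m n k)))
     (AllSet (V 2 (m + k)) (ExSet (V 1 (m + k)) (typeF m n k)))"

lemma sat_meetF: "t < 4 \<Longrightarrow> u < 4 \<Longrightarrow> sat P e s (meetF g t u i j) \<longleftrightarrow> meet (e t) (e u) (\<lambda>i. s (V g i)) i j"
  unfolding meetF_def meet_def by (auto simp: not_less)

lemma sat_beforeF: "t < 4 \<Longrightarrow> u < 4 \<Longrightarrow> sat P e s (beforeF g t u i j) \<longleftrightarrow> before (e t) (e u) (\<lambda>i. s (V g i)) i j"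
  unfolding beforeF_def before_def by (auto simp: not_less)

lemma sat_typeF: "sat P e s (typeF m n k) \<longleftrightarrow> tp m n k (e 0) (e 1) (\<lambda>i. s (V 1 i)) = tp m n k (e 2) (e 3) (\<lambda>i. s (V 2 i))"
proof (induction k arbitrary: s)
  case 0
  then show ?case by (simp add: tp_0_iff sat_meetF sat_beforeF) blast
next
  case (Suc k)
  have *: "(\<lambda>i. (s(V 1 j := B, V 2 j := B')) (V 1 i)) = (\<lambda>i. s (V 1 i))(j := B)"
    "(\<lambda>i. (s(V 1 j := B, V 2 j := B')) (V 2 i)) = (\<lambda>i. s (V 2 i))(j := B')"
    "(\<lambda>i. (s(V 2 j := B', V 1 j := B)) (V 1 i)) = (\<lambda>i. s (V 1 i))(j := B)"
    "(\<lambda>i. (s(V 2 j := B', V 1 j := B)) (V 2 i)) = (\<lambda>i. s (V 2 i))(j := B')" for j B B'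
    by (rule ext, simp)+
  show ?case unfolding typeF.simps tp_Suc_iff sat.simps Suc * by simp
qed

lemma free_elem_typeF: "free_elem (typeF m n k) \<subseteq> {0, 1, 2, 3}"
  by (induction k) (auto simp: meetF_def beforeF_def)

lemma free_set_typeF: "v \<in> free_set (typeF m n k) \<Longrightarrow> \<exists>i<n. (i < m \<or> m + k \<le> i) \<and> (v = V 1 i \<or> v = V 2 i)"
proof (induction k)
  case 0
  then show ?case by (auto simp: meetF_def beforeF_def)
next
  case (Suc k)
  then have "v \<in> free_set (typeF m n k)" "v \<noteq> V 1 (m + k)" "v \<noteq> V 2 (m + k)" by auto
  moreover from this Suc.IH obtain i where "i < n" "i < m \<or> m + k \<le> i" "v = V 1 i \<or> v = V 2 i" by blast
  ultimately show ?case by (intro exI[of _ i]) (auto simp: le_eq_less_or_eq)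
qed

definition consecutiveF :: "nat \<Rightarrow> nat \<Rightarrow> mlo" where
  "consecutiveF t u = Conj (Conj (Elem t (V 0 4)) (Elem u (V 0 4)))
     (Conj (Less t u) (Neg (ExElem 4 (Conj (Conj (Less t 4) (Less 4 u)) (Elem 4 (V 0 4))))))"

text \<open>\<open>typeF\<close> compares segments of two different tuples. To compare two segments
  of one tuple, group 2 is quantified and forced to be a copy of group 1.\<close>

definition homogeneousF :: "nat \<Rightarrow> nat \<Rightarrow> nat \<Rightarrow> mlo" where
  "homogeneousF m n k = ExBlock 2 m (Conj (AllElem 0 (BigConj (\<lambda>i. Iff (Elem 0 (V 1 i)) (Elem 0 (V 2 i))) m))
     (AllElem 0 (AllElem 1 (AllElem 2 (AllElem 3 (Imp (Conj (consecutiveF 0 1) (consecutiveF 2 3)) (typeF m n k)))))))"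

lemma sat_consecutiveF: "t < 4 \<Longrightarrow> u < 4 \<Longrightarrow> sat P e s (consecutiveF t u) \<longleftrightarrow> consecutive (s (V 0 4)) (e t) (e u)"
  unfolding consecutiveF_def consecutive_def by auto

lemma sat_homogeneousF:
  assumes "n = m + k"
  shows "sat P e s (homogeneousF m n k) \<longleftrightarrow> homogeneous m n k (\<lambda>i. s (V 1 i)) (s (V 0 4))"
proof -
  have "sat P e s (homogeneousF m n k) \<longleftrightarrow> (\<exists>B. (\<forall>t. \<forall>i<m. t \<in> s (V 1 i) \<longleftrightarrow> t \<in> B i) \<and>
    (\<forall>t u t' u'. consecutive (s (V 0 4)) t u \<and> consecutive (s (V 0 4)) t' u' \<longrightarrow>
       tp m n k t u (\<lambda>i. s (V 1 i)) = tp m n k t' u' (\<lambda>i. if i < m then B i else s (V 2 i))))"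
    unfolding homogeneousF_def by (simp add: sat_consecutiveF sat_typeF) (rule ex_cong1, blast)
  also have "\<dots> \<longleftrightarrow> (\<exists>B. (\<forall>t. \<forall>i<m. t \<in> s (V 1 i) \<longleftrightarrow> t \<in> B i) \<and> homogeneous m n k (\<lambda>i. s (V 1 i)) (s (V 0 4)))"
  proof (rule ex_cong1, rule conj_cong[OF refl])
    fix B :: "nat \<Rightarrow> nat set" assume "\<forall>t. \<forall>i<m. t \<in> s (V 1 i) \<longleftrightarrow> t \<in> B i"
    then have "tp m n k t' u' (\<lambda>i. if i < m then B i else s (V 2 i)) = tp m n k t' u' (\<lambda>i. s (V 1 i))" for t' u'
      using assms by (intro tp_cong) auto
    then show "(\<forall>t u t' u'. consecutive (s (V 0 4)) t u \<and> consecutive (s (V 0 4)) t' u' \<longrightarrow>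
       tp m n k t u (\<lambda>i. s (V 1 i)) = tp m n k t' u' (\<lambda>i. if i < m then B i else s (V 2 i))) \<longleftrightarrow>
       homogeneous m n k (\<lambda>i. s (V 1 i)) (s (V 0 4))" unfolding homogeneous_def by simp
  qed
  also have "\<dots> \<longleftrightarrow> homogeneous m n k (\<lambda>i. s (V 1 i)) (s (V 0 4))"
  proof -
    have "\<exists>B. \<forall>t. \<forall>i<m. t \<in> s (V 1 i) \<longleftrightarrow> t \<in> B i" by (rule exI[of _ "\<lambda>i. s (V 1 i)"]) simp
    then show ?thesis by blast
  qed
  finally show ?thesis .
qed

lemma free_homogeneousF:
  assumes "n = m + k" shows "free_elem (homogeneousF m n k) = {}" "free_set (homogeneousF m n k) \<subseteq> V 1 ` {..<m} \<union> {V 0 4}"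
proof -
  show "free_elem (homogeneousF m n k) = {}"
    using free_elem_typeF[of m n k] unfolding homogeneousF_def consecutiveF_def by auto
  have "free_set (typeF m n k) \<subseteq> V 1 ` {..<m} \<union> V 2 ` {..<m}"
    using free_set_typeF[of _ m n k] assms by fastforce
  then show "free_set (homogeneousF m n k) \<subseteq> V 1 ` {..<m} \<union> {V 0 4}"
    unfolding homogeneousF_def consecutiveF_def by auto
qed

section \<open>Defining the least candidate\<close>

definition candidateF :: "bool \<Rightarrow> nat \<Rightarrow> nat \<Rightarrow> nat \<Rightarrow> nat \<Rightarrow> mlo \<Rightarrow> mlo" where
  "candidateF strong N m n k \<psi> = Conj (winF strong N \<psi>)
     (Conj (AllElem 0 (ExElem 1 (Conj (Less 0 1) (Elem 1 (V 0 4))))) (homogeneousF m n k))"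

primrec letter_lessF :: "nat \<Rightarrow> mlo" where
  "letter_lessF 0 = Neg Tru"
| "letter_lessF (Suc i) = Or (Conj (Neg (Elem 0 (V 1 i))) (Elem 0 (V 4 i)))
     (Conj (Iff (Elem 0 (V 1 i)) (Elem 0 (V 4 i))) (letter_lessF i))"

definition precedesF :: "nat \<Rightarrow> mlo" where
  "precedesF m = ExElem 0 (Conj
     (AllElem 1 (Imp (Less 1 0) (Conj (Iff (Elem 1 (V 0 4)) (Elem 1 (V 0 5)))
        (BigConj (\<lambda>i. Iff (Elem 1 (V 1 i)) (Elem 1 (V 4 i))) m))))
     (ExElem 1 (Conj (Conj (Elem 1 (V 0 4)) (Neg (Less 1 0)))
       (Conj (AllElem 2 (Imp (Conj (Elem 2 (V 0 5)) (Neg (Less 2 0))) (Neg (Less 2 1))))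
         (Or (AllElem 2 (Imp (Conj (Elem 2 (V 0 5)) (Neg (Less 2 0))) (Less 1 2))) (letter_lessF m))))))"

lemma sat_letter_lessF: "sat P e s (letter_lessF m) \<longleftrightarrow> letter_less m (\<lambda>i. s (V 1 i)) (\<lambda>i. s (V 4 i)) (e 0)"
  by (induction m) auto

lemma sat_precedesF: "sat P e s (precedesF m) \<longleftrightarrow>
    precedes m (\<lambda>i. s (V 1 i)) (s (V 0 4)) (\<lambda>i. s (V 4 i)) (s (V 0 5))"
proof -
  have iff: "(p \<longrightarrow> q) \<and> (q \<longrightarrow> p) \<longleftrightarrow> (p \<longleftrightarrow> q)" for p q by blast
  show ?thesis unfolding precedesF_def precedes_def
    by (simp add: sat_letter_lessF not_less disj_imp iff) (simp only: not_le imp_conjL)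
qed

text \<open>\<open>candidateF\<close> speaks about group 1 and set 4. To apply it to a rival as
  well, the current pair is first copied to group 4 and set 5, and group 1 and set 4 are then
  quantified anew.\<close>

definition leastF :: "bool \<Rightarrow> nat \<Rightarrow> nat \<Rightarrow> nat \<Rightarrow> nat \<Rightarrow> mlo \<Rightarrow> mlo" where
  "leastF strong N m n k \<psi> = Conj (candidateF strong N m n k \<psi>)
     (Neg (ExBlock 4 m (ExSet (V 0 5) (Conj
        (AllElem 0 (Conj (Iff (Elem 0 (V 0 4)) (Elem 0 (V 0 5))) (BigConj (\<lambda>i. Iff (Elem 0 (V 1 i)) (Elem 0 (V 4 i))) m)))
        (ExBlock 1 m (ExSet (V 0 4) (Conj (candidateF strong N m n k \<psi>) (precedesF m))))))))"

definition solutionF :: "bool \<Rightarrow> nat \<Rightarrow> nat \<Rightarrow> nat \<Rightarrow> nat \<Rightarrow> mlo \<Rightarrow> mlo" where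
  "solutionF strong N m n k \<psi> = ExBlock 1 m (ExSet (V 0 4) (Conj (leastF strong N m n k \<psi>) (machineF N 0 1)))"

text \<open>\<open>ExBlock\<close> binds only the first \<open>m\<close> members of a group. This
  and the following congruences discard the values left over at other indices.\<close>

lemma machine_cong:
  assumes "\<And>i. i < prod_encode (3, prod_encode (N, N)) \<Longrightarrow> A i = A' i"
  shows "machine N A X Y \<longleftrightarrow> machine N A' X Y"
proof -
  have "A (trans_idx x n n') = A' (trans_idx x n n')" if "n < N" "n' < N" "x < 2" for x n n'
    using assms trans_idx_less[OF that] by simp
  moreover have "A (out_idx n) = A' (out_idx n)" if "n < N" for n using assms out_idx_less[OF that] by simp
  ultimately show ?thesis unfolding machine_def by (simp cong: conj_cong imp_cong)
qed

lemma winning_machine_cong: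
  assumes "0 < N" "\<And>i. i < prod_encode (3, prod_encode (N, N)) \<Longrightarrow> A i = A' i"
  shows "winning_machine P \<psi> strong N A \<longleftrightarrow> winning_machine P \<psi> strong N A'"
proof -
  have "machine N A X Y \<longleftrightarrow> machine N A' X Y" for X Y by (rule machine_cong) (rule assms(2))
  then show ?thesis unfolding winning_machine_def assms(2)[OF param_idx_less[OF assms(1)]] by presburger
qed

lemma letter_less_cong: "(\<And>i. i < m \<Longrightarrow> A i = C i) \<Longrightarrow> (\<And>i. i < m \<Longrightarrow> B i = D i) \<Longrightarrow>
    letter_less m A B t \<longleftrightarrow> letter_less m C D t"
  by (induction m) auto

lemma precedes_cong:
  assumes "\<And>i. i < m \<Longrightarrow> A i = C i" "\<And>i. i < m \<Longrightarrow> B i = D i"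
  shows "precedes m A X B Y \<longleftrightarrow> precedes m C X D Y"
proof -
  have "letter_less m A B t \<longleftrightarrow> letter_less m C D t" for t by (rule letter_less_cong) (simp_all add: assms)
  then show ?thesis unfolding precedes_def using assms by simp
qed

definition candidate :: "nat set \<Rightarrow> mlo \<Rightarrow> bool \<Rightarrow> nat \<Rightarrow> nat \<Rightarrow> nat \<Rightarrow> nat \<Rightarrow> (nat \<Rightarrow> nat set) \<Rightarrow> nat set \<Rightarrow> bool" where
  "candidate P \<psi> strong N m n k A D \<longleftrightarrow> winning_machine P \<psi> strong N A \<and> unbounded D \<and> homogeneous m n k A D"

lemma candidate_cong:
  assumes "0 < N" "m = prod_encode (3, prod_encode (N, N))" "n = m + k" "\<And>i. i < m \<Longrightarrow> A i = A' i"
  shows "candidate P \<psi> strong N m n k A D \<longleftrightarrow> candidate P \<psi> strong N m n k A' D"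
proof -
  have "tp m n k t u A = tp m n k t u A'" for t u by (rule tp_cong) (use assms in auto)
  then show ?thesis unfolding candidate_def homogeneous_def using winning_machine_cong[of N A A'] assms by simp
qed

lemma sat_candidateF:
  "formula_XY \<psi> \<Longrightarrow> n = m + k \<Longrightarrow> sat P e s (candidateF strong N m n k \<psi>) \<longleftrightarrow>
     candidate P \<psi> strong N m n k (\<lambda>i. s (V 1 i)) (s (V 0 4))"
  unfolding candidateF_def candidate_def unbounded_def
  by (simp only: sat.simps sat_winF sat_homogeneousF) simp

lemma sat_leastF:
  assumes \<psi>: "formula_XY \<psi>" and N: "0 < N" "m = prod_encode (3, prod_encode (N, N))" and n: "n = m + k"
  shows "sat P e s (leastF strong N m n k \<psi>) \<longleftrightarrow> candidate P \<psi> strong N m n k (\<lambda>i. s (V 1 i)) (s (V 0 4)) \<and>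
    \<not> (\<exists>A' D'. candidate P \<psi> strong N m n k A' D' \<and> precedes m A' D' (\<lambda>i. s (V 1 i)) (s (V 0 4)))"
proof -
  define eqF where "eqF = AllElem 0 (Conj (Iff (Elem 0 (V 0 4)) (Elem 0 (V 0 5))) (BigConj (\<lambda>i. Iff (Elem 0 (V 1 i)) (Elem 0 (V 4 i))) m))"
  have eqF: "sat P e s eqF \<longleftrightarrow> s (V 0 4) = s (V 0 5) \<and> (\<forall>i<m. s (V 1 i) = s (V 4 i))" for e s
    unfolding eqF_def by auto
  define A where "A = (\<lambda>i. s (V 1 i))"
  define D where "D = s (V 0 4)"
  \<comment> \<open>The assignment under all quantifiers of \<open>leastF\<close>: the copy is
    \<open>Q\<close>, \<open>E\<close> and the rival is \<open>A'\<close>,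
    \<open>D'\<close>.\<close>
  define env where "env Q E A' D' = (upd ((upd s 4 m Q)(V 0 5 := E)) 1 m A')(V 0 4 := D')" for Q E A' D'
  have env: "(\<lambda>i. env Q E A' D' (V 1 i)) = (\<lambda>i. if i < m then A' i else A i)" "env Q E A' D' (V 0 4) = D'"
    "(\<lambda>i. env Q E A' D' (V 4 i)) = (\<lambda>i. if i < m then Q i else s (V 4 i))" "env Q E A' D' (V 0 5) = E" for Q E A' D'
    unfolding env_def A_def by (auto simp: fun_eq_iff)
  have cc: "candidate P \<psi> strong N m n k (\<lambda>i. if i < m then A' i else A i) D' \<longleftrightarrow> candidate P \<psi> strong N m n k A' D'" for A' D'
    by (rule candidate_cong[OF N n]) simp
  have pc: "precedes m (\<lambda>i. if i < m then A' i else A i) D' (\<lambda>i. if i < m then Q i else s (V 4 i)) E \<longleftrightarrow> precedes m A' D' Q E"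
    for A' D' Q E by (rule precedes_cong) simp_all
  have "sat P e s (leastF strong N m n k \<psi>) \<longleftrightarrow> candidate P \<psi> strong N m n k A D \<and>
    \<not> (\<exists>Q E. sat P e ((upd s 4 m Q)(V 0 5 := E)) eqF \<and>
       (\<exists>A' D'. candidate P \<psi> strong N m n k A' D' \<and> precedes m A' D' Q E))"
    unfolding leastF_def eqF_def[symmetric]
    by (simp only: sat.simps sat_ExBlock sat_candidateF[OF \<psi> n] sat_precedesF env_def[symmetric] env cc pc A_def[symmetric] D_def[symmetric])
  also have "\<dots> \<longleftrightarrow> candidate P \<psi> strong N m n k A D \<and>
    \<not> (\<exists>Q E. D = E \<and> (\<forall>i<m. A i = Q i) \<and> (\<exists>A' D'. candidate P \<psi> strong N m n k A' D' \<and> precedes m A' D' Q E))"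
    unfolding eqF by (simp add: A_def D_def)
  also have "\<dots> \<longleftrightarrow> candidate P \<psi> strong N m n k A D \<and>
    \<not> (\<exists>A' D'. candidate P \<psi> strong N m n k A' D' \<and> precedes m A' D' A D)"
  proof -
    have "precedes m A' D' Q D \<longleftrightarrow> precedes m A' D' A D" if "\<forall>i<m. A i = Q i" for A' D' Q
      by (rule precedes_cong) (use that in auto)
    then show ?thesis by blast
  qed
  finally show ?thesis unfolding A_def D_def .
qed

lemma sat_solutionF:
  assumes \<psi>: "formula_XY \<psi>" and N: "0 < N" "m = prod_encode (3, prod_encode (N, N))" and n: "n = m + k"
  shows "sat P e s (solutionF strong N m n k \<psi>) \<longleftrightarrow> (\<exists>A D. candidate P \<psi> strong N m n k A D \<and>
    \<not> (\<exists>A' D'. candidate P \<psi> strong N m n k A' D' \<and> precedes m A' D' A D) \<and> machine N A (s (V 0 0)) (s (V 0 1)))"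
proof -
  define B where "B A = (\<lambda>i. if i < m then A i else s (V 1 i))" for A
  have "sat P e s (solutionF strong N m n k \<psi>) \<longleftrightarrow> (\<exists>A D. candidate P \<psi> strong N m n k (B A) D \<and>
    \<not> (\<exists>A' D'. candidate P \<psi> strong N m n k A' D' \<and> precedes m A' D' (B A) D) \<and> machine N (B A) (s (V 0 0)) (s (V 0 1)))"
    unfolding solutionF_def B_def by (simp add: sat_leastF[OF \<psi> N n] del: One_nat_def)
  also have "\<dots> \<longleftrightarrow> (\<exists>A D. candidate P \<psi> strong N m n k A D \<and>
    \<not> (\<exists>A' D'. candidate P \<psi> strong N m n k A' D' \<and> precedes m A' D' A D) \<and> machine N A (s (V 0 0)) (s (V 0 1)))"
  proof -
    have "candidate P \<psi> strong N m n k (B A) D = candidate P \<psi> strong N m n k A D" for A D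
      by (rule candidate_cong[OF N n]) (simp add: B_def)
    moreover have "precedes m A' D' (B A) D = precedes m A' D' A D" for A A' D D'
      by (rule precedes_cong) (simp_all add: B_def)
    moreover have "machine N (B A) X Y = machine N A X Y" for A X Y
      by (rule machine_cong) (simp add: B_def N(2))
    ultimately show ?thesis by simp
  qed
  finally show ?thesis .
qed

lemma formula_solutionF:
  assumes \<psi>: "formula_XY \<psi>" and N: "0 < N" "m = prod_encode (3, prod_encode (N, N))" and n: "n = m + k"
  shows "formula_XY (solutionF strong N m n k \<psi>)"
proof -
  have \<psi>': "free_elem \<psi> = {}" "free_set \<psi> \<subseteq> {V 0 0, V 0 1}" using \<psi> unfolding formula_XY_def V_0 by auto
  have c: "free_elem (candidateF strong N m n k \<psi>) = {}" "free_set (candidateF strong N m n k \<psi>) \<subseteq> V 1 ` {..<m} \<union> {V 0 4}"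
    using free_elem_winF[OF \<psi>'(1)] free_set_winF[OF N(1) \<psi>'(2), of strong] free_homogeneousF[OF n] N
    unfolding candidateF_def by auto
  have l: "free_elem (letter_lessF i) \<subseteq> {0}" "i \<le> m \<Longrightarrow> free_set (letter_lessF i) \<subseteq> V 1 ` {..<m} \<union> V 4 ` {..<m}" for i
    by (induction i) auto
  have p: "free_elem (precedesF m) = {}" "free_set (precedesF m) \<subseteq> V 1 ` {..<m} \<union> V 4 ` {..<m} \<union> {V 0 4, V 0 5}"
    using l[of m] unfolding precedesF_def by auto
  have "free_elem (leastF strong N m n k \<psi>) = {}" "free_set (leastF strong N m n k \<psi>) \<subseteq> V 1 ` {..<m} \<union> {V 0 4}"
    using c p unfolding leastF_def by auto
  then have "free_elem (solutionF strong N m n k \<psi>) = {}" "free_set (solutionF strong N m n k \<psi>) \<subseteq> {V 0 0, V 0 1}"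
    using free_set_machineF[OF N(1), of 0 1] N(2) unfolding solutionF_def by auto
  then show ?thesis unfolding formula_XY_def V_0 by simp
qed

text \<open>Being a winning machine is expressed by the formula \<open>winF\<close>, so
  \<open>sat_cuts\<close> yields \<open>Good_cuts\<close> once \<open>k\<close> bounds its rank. The
  types here are those of strategy tuples and are unrelated to the types from which the automaton
  was built.\<close>

lemma uniformization_winning_machine:
  assumes \<psi>: "formula_XY \<psi>" and N: "0 < N" "m = prod_encode (3, prod_encode (N, N))" and n: "n = m + k"
    and k: "k = mlo_code (winF strong N \<psi>)" and ex: "\<exists>A. winning_machine P \<psi> strong N A"
  shows "uniformization m n k param_idx P (winning_machine P \<psi> strong N)"
proof
  show "n = m + k" "param_idx < m" "\<exists>A. winning_machine P \<psi> strong N A" using n N param_idx_less ex by auto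
  show "A param_idx = P" if "winning_machine P \<psi> strong N A" for A using that unfolding winning_machine_def by simp
  fix A A' d d'
  assume win: "winning_machine P \<psi> strong N A" and A': "A' param_idx = P" and d: "cuts d" "cuts d'"
    and eq: "\<forall>i. tp m n k (d i) (d (Suc i)) A = tp m n k (d' i) (d' (Suc i)) A'"
  have \<psi>': "free_elem \<psi> = {}" "free_set \<psi> \<subseteq> {V 0 0, V 0 1}" using \<psi> unfolding formula_XY_def V_0 by auto
  \<comment> \<open>Every set variable with index \<open>i\<close> gets component \<open>i\<close>,
    whatever its group; only group 1 is free in \<open>winF\<close>.\<close>
  define s where "s A v = A (snd (prod_decode v))" for A :: "nat \<Rightarrow> nat set" and v
  have s: "(\<lambda>i. s A (V 1 i)) = A" for A unfolding s_def V_def by simp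
  have tr: "tracks m n k P (\<lambda>_. 0) (s A) A (winF strong N \<psi>) param_idx id (\<lambda>v. snd (prod_decode v))" if "A param_idx = P" for A
    using that free_elem_winF[OF \<psi>'(1)] free_set_winF[OF N(1) \<psi>'(2), of strong] param_idx_less[OF N(1)] N(2) n
    unfolding tracks_def s_def by (auto simp: V_def)
  have "sat P (\<lambda>_. 0) (s A) (winF strong N \<psi>)" unfolding sat_winF[OF \<psi>] s by (rule win)
  from sat_cuts[OF d _ _ eq tr[of A] tr[of A'] this] have "sat P (\<lambda>_. 0) (s A') (winF strong N \<psi>)"
    using qrank_le_code k n win A' unfolding winning_machine_def by simp
  then show "winning_machine P \<psi> strong N A'" unfolding sat_winF[OF \<psi>] s .
qed

theorem solutionF_defines:
  assumes \<psi>: "formula_XY \<psi>" and N: "0 < N" "m = prod_encode (3, prod_encode (N, N))" and n: "n = m + k"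
    and k: "k = mlo_code (winF strong N \<psi>)" and ex: "\<exists>A. winning_machine P \<psi> strong N A"
  shows "\<exists>F. mlo_defines P (solutionF strong N m n k \<psi>) F \<and> (if strong then strongly_causal F else causal F) \<and>
    (\<forall>X. holds P X (F X) \<psi>)"
proof -
  interpret U: uniformization m n k param_idx P "winning_machine P \<psi> strong N"
    by (rule uniformization_winning_machine[OF assms])
  have cand: "U.candidate = candidate P \<psi> strong N m n k"
    unfolding U.candidate_def candidate_def fun_eq_iff by simp
  define A where "A = fst U.lim"
  define D where "D = snd U.lim"
  have least: "U.least_candidate A D" unfolding A_def D_def by (rule U.least_candidate_lim)
  then have "winning_machine P \<psi> strong N A" unfolding U.least_candidate_def U.candidate_def by simp
  from winning_machine_operator[OF this] obtain F where F: "\<And>X Y. machine N A X Y \<longleftrightarrow> Y = F X"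
    "\<And>X. holds P X (F X) \<psi>" "if strong then strongly_causal F else causal F" by blast
  have "holds P X Y (solutionF strong N m n k \<psi>) \<longleftrightarrow> Y = F X" for X Y
  proof -
    have "holds P X Y (solutionF strong N m n k \<psi>) \<longleftrightarrow> (\<exists>A D. U.least_candidate A D \<and> machine N A X Y)"
      unfolding holds_def sat_solutionF[OF \<psi> N n] U.least_candidate_def cand V_0 by simp
    also have "\<dots> \<longleftrightarrow> machine N A X Y"
      using least U.least_candidate_unique(2)[OF _ least] machine_cong[of N _ A X Y] N(2) by metis
    finally show ?thesis using F(1) by simp
  qed
  then have "mlo_defines P (solutionF strong N m n k \<psi>) F"
    unfolding mlo_defines_def using formula_solutionF[OF \<psi> N n] by simp
  with F(2,3) show ?thesis by blast
qed

text \<open>The code \<open>c\<close> is a separate argument because the opponent's formula is built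
  from the negated and swapped \<psi>, while the number of states is still bounded through \<psi>
  itself.\<close>

definition solution :: "bool \<Rightarrow> nat \<Rightarrow> mlo \<Rightarrow> mlo" where
  "solution strong c \<psi> = (let N = prod_encode (state_bound c, 2); m = prod_encode (3, prod_encode (N, N));
     k = mlo_code (winF strong N \<psi>) in solutionF strong N m (m + k) k \<psi>)"

lemma solution_defines:
  assumes \<psi>: "formula_XY \<psi>" and q: "q < state_bound c" and \<mu>: "\<And>t q x. fst (\<mu> t q x) < state_bound c"
    and moore: "strong \<Longrightarrow> (\<And>t q x x'. snd (\<mu> t q x) = snd (\<mu> t q x'))"
    and win: "\<And>X. holds P X (mealy \<mu> q X) \<psi>"
  shows "\<exists>F. mlo_defines P (solution strong c \<psi>) F \<and> (if strong then strongly_causal F else causal F) \<and>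
    (\<forall>X. holds P X (F X) \<psi>)"
proof -
  have "0 < prod_encode (state_bound c, 2)" using prod_encode_less[of 0 "state_bound c" 0 2] by simp
  from solutionF_defines[OF \<psi> this refl refl refl winning_machine_ex[OF q \<mu> moore win]]
  show ?thesis unfolding solution_def Let_def .
qed

section \<open>Exchanging the players, and incompatibility of their wins\<close>

definition eqF :: "nat \<Rightarrow> nat \<Rightarrow> mlo" where
  "eqF X Y = AllElem 0 (Iff (Elem 0 X) (Elem 0 Y))"

text \<open>The exchange goes through the auxiliary set variables 2 and 3 instead of a substitution.
  \<psi> is kept as a subformula, so the new code is a fixed arithmetical expression in the old
  one.\<close>

definition swapF :: "mlo \<Rightarrow> mlo" where
  "swapF \<psi> = ExSet 2 (ExSet 3 (Conj (Conj (eqF 2 0) (eqF 3 1)) (ExSet 0 (ExSet 1 (Conj (Conj (eqF 0 3) (eqF 1 2)) \<psi>)))))"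

lemma holds_swapF: "formula_XY \<psi> \<Longrightarrow> holds P X Y (swapF \<psi>) \<longleftrightarrow> holds P Y X \<psi>"
proof -
  assume \<psi>: "formula_XY \<psi>"
  have eqF: "sat P e s (eqF X Y) \<longleftrightarrow> s X = s Y" for e s X Y unfolding eqF_def by auto
  show ?thesis unfolding holds_def[of P X Y] swapF_def sat.simps eqF by (simp add: sat_eq_holds[OF \<psi>])
qed

lemma formula_swapF: "formula_XY \<psi> \<Longrightarrow> formula_XY (swapF \<psi>)"
  unfolding formula_XY_def swapF_def eqF_def by auto

lemma formula_Neg: "formula_XY (Neg \<psi>) \<longleftrightarrow> formula_XY \<psi>"
  unfolding formula_XY_def by simp

lemma holds_Neg: "holds P X Y (Neg \<psi>) \<longleftrightarrow> \<not> holds P X Y \<psi>"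
  unfolding holds_def by simp

lemma determined:
  assumes \<psi>: "formula_XY \<psi>"
  shows "(\<exists>F. causal F \<and> mlo_defines P (solution False (mlo_code \<psi>) \<psi>) F \<and> (\<forall>X. holds P X (F X) \<psi>)) \<or>
    (\<exists>G. strongly_causal G \<and> mlo_defines P (solution True (mlo_code \<psi>) (Neg (swapF \<psi>))) G \<and> (\<forall>Y. \<not> holds P (G Y) Y \<psi>))"
  using \<psi>
proof (rule finite_memory_determinacy[where P = P])
  fix \<mu> q assume *: "q < state_bound (mlo_code \<psi>)" "\<And>t q x. fst (\<mu> t q x) < state_bound (mlo_code \<psi>)"
    "\<And>X. holds P X (mealy \<mu> q X) \<psi>"
  from solution_defines[OF \<psi> *(1), of \<mu> False P] *(2,3) show ?thesis by auto
next
  fix \<mu> q assume *: "q < state_bound (mlo_code \<psi>)" "\<And>t q x. fst (\<mu> t q x) < state_bound (mlo_code \<psi>)"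
    "\<And>t q x x'. snd (\<mu> t q x) = snd (\<mu> t q x')" "\<And>Y. \<not> holds P (mealy \<mu> q Y) Y \<psi>"
  have \<psi>': "formula_XY (Neg (swapF \<psi>))" using formula_swapF[OF \<psi>] by (simp add: formula_Neg)
  have h: "holds P X Y (Neg (swapF \<psi>)) \<longleftrightarrow> \<not> holds P Y X \<psi>" for X Y using holds_swapF[OF \<psi>] by (simp add: holds_Neg)
  have "\<exists>F. mlo_defines P (solution True (mlo_code \<psi>) (Neg (swapF \<psi>))) F \<and> (if True then strongly_causal F else causal F) \<and>
    (\<forall>X. holds P X (F X) (Neg (swapF \<psi>)))"
    by (rule solution_defines[OF \<psi>' *(1), where \<mu> = \<mu>]) (use *(2,4) h in \<open>simp_all\<close>, rule *(3))
  then show ?thesis unfolding h by auto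
qed

text \<open>Iterating from the empty set, the \<open>n\<close>-th iterate is final below
  \<open>n\<close>, because strong causality gains one position per application. The diagonal of the
  iterates is the fixpoint.\<close>

lemma strongly_causal_fixpoint:
  assumes "strongly_causal H" shows "\<exists>X. H X = X"
proof -
  define x where "x n = (H ^^ n) {}" for n
  have xS: "x (Suc n) = H (x n)" for n by (simp add: x_def)
  have step: "v \<in> H X \<longleftrightarrow> v \<in> H X'" if *: "\<And>u. u < t \<Longrightarrow> u \<in> X \<longleftrightarrow> u \<in> X'" and "v \<le> t" for X X' t v
  proof -
    have "X \<inter> {..<t} = X' \<inter> {..<t}" using * by blast
    then have "H X \<inter> {..t} = H X' \<inter> {..t}" using assms unfolding strongly_causal_def by blast
    then show ?thesis using \<open>v \<le> t\<close> by blast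
  qed
  have agree: "t < n \<Longrightarrow> t \<in> x n \<longleftrightarrow> t \<in> x (Suc n)" for n t
  proof (induction n arbitrary: t)
    case (Suc n)
    have "t \<in> H (x n) \<longleftrightarrow> t \<in> H (x (Suc n))" by (rule step[OF Suc.IH]) (use Suc.prems in \<open>simp_all add: less_Suc_eq_le\<close>)
    then show ?case by (simp only: xS[symmetric])
  qed simp
  have later: "t < n \<Longrightarrow> t \<in> x n \<longleftrightarrow> t \<in> x (n + l)" for n l t
  proof (induction l)
    case (Suc l)
    then show ?case using agree[of t "n + l"] by simp
  qed simp
  define X where "X = {t. t \<in> x (Suc t)}"
  have X: "t \<in> X \<longleftrightarrow> t \<in> x n" if "t < n" for t n
  proof -
    obtain l where "n = Suc t + l" using \<open>t < n\<close> by (auto simp: less_iff_Suc_add)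
    then show ?thesis using later[of t "Suc t" l] by (simp add: X_def)
  qed
  have "t \<in> H X \<longleftrightarrow> t \<in> X" for t
  proof -
    have "t \<in> H X \<longleftrightarrow> t \<in> H (x t)" using step[of t X "x t" t] X[of _ t] by blast
    then show ?thesis by (simp add: X_def xS)
  qed
  then show ?thesis by blast
qed

text \<open>Playing the operators against each other: the fixpoint \<open>Y\<close> of the
  composition gives one pair \<open>G Y\<close>, \<open>Y\<close> that would both satisfy and
  violate \<psi>.\<close>

lemma not_both_win:
  assumes "causal F" "strongly_causal G" "\<And>X. holds P X (F X) \<psi>" "\<And>Y. \<not> holds P (G Y) Y \<psi>"
  shows False
proof -
  have "strongly_causal (\<lambda>Y. F (G Y))" using assms(1,2) unfolding causal_def strongly_causal_def by meson
  then obtain Y where "F (G Y) = Y" using strongly_causal_fixpoint by blast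
  then show False using assms(3)[of "G Y"] assms(4)[of Y] by simp
qed

section \<open>Computability\<close>

text \<open>The code of \<open>\<psi>\<close> is passed as an additional last argument.\<close>

definition nrec :: "nat \<Rightarrow> (mlo \<Rightarrow> nat list \<Rightarrow> nat) \<Rightarrow> bool" where
  "nrec n F \<longleftrightarrow> (\<exists>r. recursive (Suc n) r \<and> (\<forall>\<psi> xs. length xs = n \<longrightarrow> r (xs @ [mlo_code \<psi>]) = F \<psi> xs))"

lemma nrec_cong: "nrec n F \<Longrightarrow> (\<And>\<psi> xs. length xs = n \<Longrightarrow> F \<psi> xs = G \<psi> xs) \<Longrightarrow> nrec n G"
  unfolding nrec_def by auto

lemma nrec_comp:
  assumes F: "nrec m F" and as: "\<And>a. a \<in> set as \<Longrightarrow> nrec n a" and len: "length as = m"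
  shows "nrec n (\<lambda>\<psi> xs. F \<psi> (map (\<lambda>a. a \<psi> xs) as))"
proof -
  obtain r where r: "recursive (Suc m) r" "\<And>\<psi> xs. length xs = m \<Longrightarrow> r (xs @ [mlo_code \<psi>]) = F \<psi> xs"
    using F unfolding nrec_def by blast
  have "\<forall>a\<in>set as. \<exists>r. recursive (Suc n) r \<and> (\<forall>\<psi> xs. length xs = n \<longrightarrow> r (xs @ [mlo_code \<psi>]) = a \<psi> xs)"
    using as unfolding nrec_def by blast
  from bchoice[OF this] obtain R where R: "\<And>a. a \<in> set as \<Longrightarrow> recursive (Suc n) (R a)"
    "\<And>a \<psi> xs. a \<in> set as \<Longrightarrow> length xs = n \<Longrightarrow> R a (xs @ [mlo_code \<psi>]) = a \<psi> xs" by blast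
  define hs where "hs = map R as @ [\<lambda>xs. xs ! n]"
  have "recursive (Suc n) (\<lambda>xs. r (map (\<lambda>h. h xs) hs))"
    by (rule recursive.comp) (use r(1) len R(1) in \<open>auto simp: hs_def intro: recursive.proj\<close>)
  moreover have "r (map (\<lambda>h. h (xs @ [mlo_code \<psi>])) hs) = F \<psi> (map (\<lambda>a. a \<psi> xs) as)" if "length xs = n" for \<psi> xs
  proof -
    have "map (\<lambda>h. h (xs @ [mlo_code \<psi>])) hs = map (\<lambda>a. a \<psi> xs) as @ [mlo_code \<psi>]"
      using R(2) that by (simp add: hs_def nth_append)
    then show ?thesis using r(2) len by simp
  qed
  ultimately show ?thesis unfolding nrec_def by blast
qed

lemma nrec_nth: "i < n \<Longrightarrow> nrec n (\<lambda>\<psi> xs. xs ! i)"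
  unfolding nrec_def by (rule exI[of _ "\<lambda>xs. xs ! i"]) (auto simp: nth_append intro: recursive.proj)

lemma nrec_code: "nrec n (\<lambda>\<psi> xs. mlo_code \<psi>)"
  unfolding nrec_def by (rule exI[of _ "\<lambda>xs. xs ! n"]) (auto simp: nth_append intro: recursive.proj)

lemma nrec_hd: "nrec (Suc n) (\<lambda>\<psi> xs. hd xs)"
  by (rule nrec_cong[OF nrec_nth[of 0]], simp) (case_tac xs; simp)

lemma nrec_tl: "nrec n a \<Longrightarrow> nrec (Suc n) (\<lambda>\<psi> xs. a \<psi> (tl xs))"
proof -
  assume a: "nrec n a"
  let ?as = "map (\<lambda>i \<psi> xs. xs ! Suc i) [0..<n]"
  have "nrec (Suc n) (\<lambda>\<psi> xs. a \<psi> (map (\<lambda>a. a \<psi> xs) ?as))"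
    by (rule nrec_comp[OF a]) (auto simp: nrec_nth)
  then show ?thesis
  proof (rule nrec_cong)
    fix \<psi> and xs :: "nat list" assume len: "length xs = Suc n"
    then have "map (\<lambda>i. xs ! Suc i) [0..<n] = tl xs" by (intro nth_equalityI) (auto simp: nth_tl)
    then show "a \<psi> (map (\<lambda>a. a \<psi> xs) ?as) = a \<psi> (tl xs)" by (simp add: comp_def)
  qed
qed

lemma nrec_Suc: "nrec n a \<Longrightarrow> nrec n (\<lambda>\<psi> xs. Suc (a \<psi> xs))"
proof -
  assume "nrec n a"
  then obtain r where r: "recursive (Suc n) r" "\<And>\<psi> xs. length xs = n \<Longrightarrow> r (xs @ [mlo_code \<psi>]) = a \<psi> xs"
    unfolding nrec_def by blast
  have "recursive (Suc n) (\<lambda>xs. (\<lambda>ys. Suc (ys ! 0)) (map (\<lambda>h. h xs) [r]))"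
    by (rule recursive.comp) (use r(1) recursive.suc in auto)
  then show ?thesis unfolding nrec_def using r(2) by (intro exI[of _ "\<lambda>xs. Suc (r xs)"]) simp
qed

lemma nrec_const: "nrec n (\<lambda>\<psi> xs. c)"
proof (induction c)
  case 0
  show ?case unfolding nrec_def by (rule exI[of _ "\<lambda>_. 0"]) (auto intro: recursive.zero)
qed (rule nrec_Suc)

text \<open>This serves every numerical bound and every family of formulas defined by recursion on a
  number: such a family becomes a primitive recursion on codes.\<close>

lemma nrec_rec:
  assumes a: "nrec n a" and c: "nrec n c" and h: "nrec (Suc (Suc n)) (\<lambda>\<psi> ys. h (hd ys) (hd (tl ys)) \<psi> (tl (tl ys)))"
  shows "nrec n (\<lambda>\<psi> xs. rec_nat (a \<psi> xs) (\<lambda>k r. h k r \<psi> xs) (c \<psi> xs))"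
proof -
  obtain ra where ra: "recursive (Suc n) ra" "\<And>\<psi> xs. length xs = n \<Longrightarrow> ra (xs @ [mlo_code \<psi>]) = a \<psi> xs"
    using a unfolding nrec_def by blast
  obtain rc where rc: "recursive (Suc n) rc" "\<And>\<psi> xs. length xs = n \<Longrightarrow> rc (xs @ [mlo_code \<psi>]) = c \<psi> xs"
    using c unfolding nrec_def by blast
  obtain rh where rh: "recursive (Suc (Suc (Suc n))) rh" "\<And>\<psi> ys. length ys = Suc (Suc n) \<Longrightarrow>
    rh (ys @ [mlo_code \<psi>]) = h (hd ys) (hd (tl ys)) \<psi> (tl (tl ys))"
    using h unfolding nrec_def by blast
  define g where "g = (\<lambda>zs. rec_nat (ra (tl zs)) (\<lambda>k r. rh (k # r # tl zs)) (hd zs))"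
  have g: "recursive (Suc (Suc n)) g" unfolding g_def by (rule recursive.prim_rec[OF ra(1) rh(1)])
  define hs where "hs = rc # map (\<lambda>i xs. xs ! i) [0..<Suc n]"
  have "recursive (Suc n) (\<lambda>xs. g (map (\<lambda>h. h xs) hs))"
    by (rule recursive.comp) (use g rc(1) in \<open>auto simp: hs_def intro: recursive.proj simp del: upt_Suc\<close>)
  moreover have "g (map (\<lambda>h. h (xs @ [mlo_code \<psi>])) hs) = rec_nat (a \<psi> xs) (\<lambda>k r. h k r \<psi> xs) (c \<psi> xs)"
    if len: "length xs = n" for \<psi> xs
  proof -
    have "map (\<lambda>h. h (xs @ [mlo_code \<psi>])) hs = rc (xs @ [mlo_code \<psi>]) # (xs @ [mlo_code \<psi>])"
      unfolding hs_def using map_nth[of "xs @ [mlo_code \<psi>]"] len by (simp add: comp_def del: upt_Suc)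
    moreover have "rh (k # r # xs @ [mlo_code \<psi>]) = h k r \<psi> xs" for k r
      using rh(2)[of "k # r # xs" \<psi>] len by simp
    ultimately show ?thesis using ra(2) rc(2) len by (simp add: g_def)
  qed
  ultimately show ?thesis unfolding nrec_def by blast
qed

lemma nrec_add: "nrec n a \<Longrightarrow> nrec n b \<Longrightarrow> nrec n (\<lambda>\<psi> xs. a \<psi> xs + b \<psi> xs)"
proof -
  assume "nrec n a" "nrec n b"
  then have "nrec n (\<lambda>\<psi> xs. rec_nat (a \<psi> xs) (\<lambda>k r. Suc r) (b \<psi> xs))"
    by (intro nrec_rec nrec_Suc nrec_tl[OF nrec_hd])
  moreover have "rec_nat x (\<lambda>k r. Suc r) y = x + y" for x y by (induction y) auto
  ultimately show ?thesis by simp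
qed

lemma nrec_prod_encode: "nrec n a \<Longrightarrow> nrec n b \<Longrightarrow> nrec n (\<lambda>\<psi> xs. prod_encode (a \<psi> xs, b \<psi> xs))"
proof -
  assume *: "nrec n a" "nrec n b"
  then have "nrec n (\<lambda>\<psi> xs. rec_nat 0 (\<lambda>k r. r + Suc k) (a \<psi> xs + b \<psi> xs) + a \<psi> xs)"
    by (intro nrec_rec nrec_add nrec_Suc nrec_tl[OF nrec_hd] nrec_hd nrec_const)
  moreover have "rec_nat 0 (\<lambda>k r. r + Suc k) y = triangle y" for y by (induction y) auto
  ultimately show ?thesis by (simp add: prod_encode_def)
qed

lemma nrec_power2: "nrec n a \<Longrightarrow> nrec n (\<lambda>\<psi> xs. 2 ^ a \<psi> xs)"
proof -
  assume "nrec n a"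
  then have "nrec n (\<lambda>\<psi> xs. rec_nat 1 (\<lambda>k r. r + r) (a \<psi> xs))"
    by (intro nrec_rec nrec_add nrec_tl[OF nrec_hd] nrec_const)
  moreover have "rec_nat 1 (\<lambda>k r. r + r) y = (2::nat) ^ y" for y by (induction y) auto
  ultimately show ?thesis by simp
qed

lemmas nrec_arith = nrec_const nrec_code nrec_Suc nrec_add nrec_prod_encode nrec_power2 nrec_hd nrec_tl[OF nrec_hd]

section \<open>Recursiveness of the bounds and of the formula families\<close>

lemma nrec_tp_bound: "nrec n a \<Longrightarrow> nrec n b \<Longrightarrow> nrec n (\<lambda>\<psi> xs. tp_bound (a \<psi> xs) (b \<psi> xs))"
proof -
  assume *: "nrec n a" "nrec n b"
  then have "nrec n (\<lambda>\<psi> xs. rec_nat (2 ^ prod_encode (2, prod_encode (a \<psi> xs, a \<psi> xs))) (\<lambda>k r. 2 ^ r) (b \<psi> xs))"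
    by (intro nrec_rec nrec_arith)
  moreover have "rec_nat (2 ^ prod_encode (2, prod_encode (x, x))) (\<lambda>k r. 2 ^ r) y = tp_bound x y" for x y by (induction y) auto
  ultimately show ?thesis by simp
qed

lemma nrec_state_bound: "nrec n a \<Longrightarrow> nrec n (\<lambda>\<psi> xs. state_bound (a \<psi> xs))"
  unfolding state_bound_def Let_def by (intro nrec_arith nrec_tp_bound)

lemma nrec_V: "nrec n a \<Longrightarrow> nrec n (\<lambda>\<psi> xs. V g (a \<psi> xs))"
  unfolding V_def by (intro nrec_arith)

lemma nrec_BigConj:
  assumes "nrec n c" "nrec (Suc n) (\<lambda>\<psi> ys. mlo_code (\<phi> (hd ys) \<psi> (tl ys)))"
  shows "nrec n (\<lambda>\<psi> xs. mlo_code (BigConj (\<lambda>i. \<phi> i \<psi> xs) (c \<psi> xs)))"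
proof -
  have "nrec (Suc (Suc n)) (\<lambda>\<psi> ys. mlo_code (\<phi> (hd ys) \<psi> (tl (tl ys))))"
  proof -
    let ?as = "(\<lambda>\<psi> xs. hd xs) # map (\<lambda>i \<psi> xs. xs ! Suc (Suc i)) [0..<n]"
    have "nrec (Suc (Suc n)) (\<lambda>\<psi> xs. (\<lambda>\<psi> ys. mlo_code (\<phi> (hd ys) \<psi> (tl ys))) \<psi> (map (\<lambda>a. a \<psi> xs) ?as))"
      by (rule nrec_comp[OF assms(2)]) (auto simp: nrec_nth nrec_hd)
    then show ?thesis
    proof (rule nrec_cong)
      fix \<psi> and xs :: "nat list" assume len: "length xs = Suc (Suc n)"
      then have "map (\<lambda>i. xs ! Suc (Suc i)) [0..<n] = tl (tl xs)" by (intro nth_equalityI) (auto simp: nth_tl)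
      then show "mlo_code (\<phi> (hd (map (\<lambda>a. a \<psi> xs) ?as)) \<psi> (tl (map (\<lambda>a. a \<psi> xs) ?as))) = mlo_code (\<phi> (hd xs) \<psi> (tl (tl xs)))"
        by (simp add: comp_def)
    qed
  qed
  then have "nrec n (\<lambda>\<psi> xs. rec_nat (mlo_code Tru) (\<lambda>i r. prod_encode (5, prod_encode (r, mlo_code (\<phi> i \<psi> xs)))) (c \<psi> xs))"
    by (intro nrec_rec nrec_arith assms(1))
  moreover have "rec_nat (mlo_code Tru) (\<lambda>i r. prod_encode (5, prod_encode (r, mlo_code (f i)))) y = mlo_code (BigConj f y)" for f y
    by (induction y) auto
  ultimately show ?thesis by simp
qed

lemma nrec_ExBlock: "nrec n c \<Longrightarrow> nrec n (\<lambda>\<psi> xs. mlo_code (\<phi> \<psi> xs)) \<Longrightarrow>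
    nrec n (\<lambda>\<psi> xs. mlo_code (ExBlock g (c \<psi> xs) (\<phi> \<psi> xs)))"
proof -
  assume *: "nrec n c" "nrec n (\<lambda>\<psi> xs. mlo_code (\<phi> \<psi> xs))"
  then have "nrec n (\<lambda>\<psi> xs. rec_nat (mlo_code (\<phi> \<psi> xs)) (\<lambda>i r. prod_encode (7, prod_encode (V g i, r))) (c \<psi> xs))"
    by (intro nrec_rec nrec_arith nrec_V)
  moreover have "rec_nat (mlo_code f) (\<lambda>i r. prod_encode (7, prod_encode (V g i, r))) y = mlo_code (ExBlock g y f)" for f y
    by (induction y) auto
  ultimately show ?thesis by simp
qed

lemma nrec_transF: "nrec n a \<Longrightarrow> nrec n b \<Longrightarrow> nrec n (\<lambda>\<psi> xs. mlo_code (transF x y (a \<psi> xs) (b \<psi> xs)))"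
  unfolding transF_def trans_idx_def out_idx_def mlo_code.simps by (intro nrec_arith nrec_V)

lemmas nrec_intros = nrec_arith nrec_V nrec_BigConj nrec_ExBlock

lemma nrec_machineF: "nrec n a \<Longrightarrow> nrec n (\<lambda>\<psi> xs. mlo_code (machineF (a \<psi> xs) x y))"
proof -
  assume a: "nrec n a"
  show ?thesis unfolding machineF_def
    by (intro nrec_ExBlock a, unfold mlo_code.simps) (intro nrec_intros nrec_transF a nrec_tl[OF a], unfold mlo_code.simps, intro nrec_intros)
qed

lemma nrec_winF:
  assumes a: "nrec n a" and \<chi>: "nrec n (\<lambda>\<psi> xs. mlo_code (\<chi> \<psi>))"
  shows "nrec n (\<lambda>\<psi> xs. mlo_code (winF strong (a \<psi> xs) (\<chi> \<psi>)))"
  unfolding winF_def paramF_def winsF_def causalF_def mlo_code.simps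
  by (intro nrec_arith nrec_V nrec_machineF a \<chi>)

lemma nrec_typeF:
  assumes m: "nrec n m" and l: "nrec n l" and k: "nrec n k"
  shows "nrec n (\<lambda>\<psi> xs. mlo_code (typeF (m \<psi> xs) (l \<psi> xs) (k \<psi> xs)))"
proof -
  \<comment> \<open>The code of the successor clause of \<open>typeF\<close>, with the code
    \<open>r\<close> of the previous level occurring twice and all derived connectives
    expanded.\<close>
  define step where "step m k r = prod_encode (5, prod_encode (
      prod_encode (4, prod_encode (7, prod_encode (V 1 (m + k), prod_encode (4, prod_encode (7, prod_encode (V 2 (m + k), r)))))),
      prod_encode (4, prod_encode (7, prod_encode (V 2 (m + k), prod_encode (4, prod_encode (7, prod_encode (V 1 (m + k), r))))))))"
    for m k r
  have rec: "rec_nat (mlo_code (typeF m l 0)) (step m) k = mlo_code (typeF m l k)" for m l k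
    by (induction k) (auto simp: step_def)
  have base: "nrec n (\<lambda>\<psi> xs. mlo_code (typeF (m \<psi> xs) (l \<psi> xs) 0))"
    unfolding typeF.simps
    by (intro nrec_BigConj l nrec_tl[OF l], unfold meetF_def beforeF_def mlo_code.simps) (intro nrec_intros)
  have "nrec n (\<lambda>\<psi> xs. rec_nat (mlo_code (typeF (m \<psi> xs) (l \<psi> xs) 0)) (\<lambda>k r. step (m \<psi> xs) k r) (k \<psi> xs))"
    unfolding step_def by (intro nrec_rec k base) (intro nrec_intros nrec_tl[OF nrec_tl[OF m]])
  then show ?thesis unfolding rec .
qed

lemma nrec_homogeneousF:
  assumes m: "nrec n m" and l: "nrec n l" and k: "nrec n k"
  shows "nrec n (\<lambda>\<psi> xs. mlo_code (homogeneousF (m \<psi> xs) (l \<psi> xs) (k \<psi> xs)))"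
  unfolding homogeneousF_def consecutiveF_def
  by (intro nrec_ExBlock m, unfold mlo_code.simps)
    (intro nrec_intros nrec_typeF assms, unfold mlo_code.simps, intro nrec_intros)

lemma nrec_candidateF:
  assumes N: "nrec n N" and m: "nrec n m" and l: "nrec n l" and k: "nrec n k" and \<chi>: "nrec n (\<lambda>\<psi> xs. mlo_code (\<chi> \<psi>))"
  shows "nrec n (\<lambda>\<psi> xs. mlo_code (candidateF strong (N \<psi> xs) (m \<psi> xs) (l \<psi> xs) (k \<psi> xs) (\<chi> \<psi>)))"
  unfolding candidateF_def mlo_code.simps by (intro nrec_arith nrec_V nrec_winF nrec_homogeneousF assms)

lemma nrec_letter_lessF:
  assumes m: "nrec n m"
  shows "nrec n (\<lambda>\<psi> xs. mlo_code (letter_lessF (m \<psi> xs)))"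
proof -
  define step where "step i r = prod_encode (4, prod_encode (5, prod_encode (
      prod_encode (4, mlo_code (Conj (Neg (Elem 0 (V 1 i))) (Elem 0 (V 4 i)))),
      prod_encode (4, prod_encode (5, prod_encode (mlo_code (Iff (Elem 0 (V 1 i)) (Elem 0 (V 4 i))), r))))))" for i r
  have "rec_nat (mlo_code (Neg Tru)) step i = mlo_code (letter_lessF i)" for i
    by (induction i) (auto simp: step_def)
  moreover have "nrec n (\<lambda>\<psi> xs. rec_nat (mlo_code (Neg Tru)) (\<lambda>i r. step i r) (m \<psi> xs))"
    unfolding step_def mlo_code.simps by (intro nrec_rec m) (intro nrec_intros)+
  ultimately show ?thesis by simp
qed

lemma nrec_precedesF:
  assumes m: "nrec n m"
  shows "nrec n (\<lambda>\<psi> xs. mlo_code (precedesF (m \<psi> xs)))"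
  unfolding precedesF_def mlo_code.simps
  by (intro nrec_intros nrec_letter_lessF m, unfold mlo_code.simps, intro nrec_intros)

lemma nrec_leastF:
  assumes N: "nrec n N" and m: "nrec n m" and l: "nrec n l" and k: "nrec n k" and \<chi>: "nrec n (\<lambda>\<psi> xs. mlo_code (\<chi> \<psi>))"
  shows "nrec n (\<lambda>\<psi> xs. mlo_code (leastF strong (N \<psi> xs) (m \<psi> xs) (l \<psi> xs) (k \<psi> xs) (\<chi> \<psi>)))"
proof -
  have *: "nrec n (\<lambda>\<psi> xs. mlo_code (ExBlock 1 (m \<psi> xs) (ExSet (V 0 4)
      (Conj (candidateF strong (N \<psi> xs) (m \<psi> xs) (l \<psi> xs) (k \<psi> xs) (\<chi> \<psi>)) (precedesF (m \<psi> xs))))))"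
    by (intro nrec_ExBlock m, unfold mlo_code.simps) (intro nrec_arith nrec_V nrec_candidateF nrec_precedesF assms)
  have **: "nrec n (\<lambda>\<psi> xs. mlo_code (AllElem 0 (Conj (Iff (Elem 0 (V 0 4)) (Elem 0 (V 0 5)))
      (BigConj (\<lambda>i. Iff (Elem 0 (V 1 i)) (Elem 0 (V 4 i))) (m \<psi> xs)))))"
    unfolding mlo_code.simps by (intro nrec_intros m, unfold mlo_code.simps, intro nrec_intros)
  have "nrec n (\<lambda>\<psi> xs. mlo_code (ExBlock 4 (m \<psi> xs) (ExSet (V 0 5) (Conj
        (AllElem 0 (Conj (Iff (Elem 0 (V 0 4)) (Elem 0 (V 0 5))) (BigConj (\<lambda>i. Iff (Elem 0 (V 1 i)) (Elem 0 (V 4 i))) (m \<psi> xs))))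
        (ExBlock 1 (m \<psi> xs) (ExSet (V 0 4)
          (Conj (candidateF strong (N \<psi> xs) (m \<psi> xs) (l \<psi> xs) (k \<psi> xs) (\<chi> \<psi>)) (precedesF (m \<psi> xs)))))))))"
    by (intro nrec_ExBlock m, subst mlo_code.simps, subst mlo_code.simps) (intro nrec_prod_encode nrec_const nrec_V * **)
  then show ?thesis unfolding leastF_def mlo_code.simps(5)[of "ExBlock _ _ _"] mlo_code.simps(6)[of "candidateF _ _ _ _ _ _"]
    by (intro nrec_prod_encode nrec_const nrec_candidateF assms)
qed

lemma nrec_solutionF:
  assumes "nrec n N" "nrec n m" "nrec n l" "nrec n k" "nrec n (\<lambda>\<psi> xs. mlo_code (\<chi> \<psi>))"
  shows "nrec n (\<lambda>\<psi> xs. mlo_code (solutionF strong (N \<psi> xs) (m \<psi> xs) (l \<psi> xs) (k \<psi> xs) (\<chi> \<psi>)))"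
  unfolding solutionF_def
  by (intro nrec_ExBlock assms, unfold mlo_code.simps) (intro nrec_arith nrec_V nrec_leastF nrec_machineF assms)

lemma computable_solution:
  assumes \<chi>: "nrec 0 (\<lambda>\<psi> xs. mlo_code (\<chi> \<psi>))"
  shows "computable (\<lambda>\<psi>. solution strong (mlo_code \<psi>) (\<chi> \<psi>))"
proof -
  have "nrec 0 (\<lambda>\<psi> xs. mlo_code (solution strong (mlo_code \<psi>) (\<chi> \<psi>)))"
    unfolding solution_def Let_def
    by (intro nrec_solutionF nrec_winF nrec_state_bound nrec_arith \<chi>)
  then show ?thesis unfolding nrec_def computable_def by simp
qed

lemma nrec_swapF: "nrec n (\<lambda>\<psi> xs. mlo_code (Neg (swapF \<psi>)))"
  unfolding swapF_def eqF_def mlo_code.simps by (intro nrec_arith)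

theorem theorem1p4:
  shows "(\<forall>\<psi> P. formula_XY \<psi> \<longrightarrow>
            (\<exists>F. causal F \<and> mlo_definable P F \<and> (\<forall>X. holds P X (F X) \<psi>)) \<or>
            (\<exists>G. strongly_causal G \<and> mlo_definable P G \<and> (\<forall>Y. \<not> holds P (G Y) Y \<psi>)))
       \<and> (\<exists>f g. computable f \<and> computable g \<and>
            (\<forall>\<psi> P. formula_XY \<psi> \<longrightarrow>
               ((\<exists>F. causal F \<and> mlo_definable P F \<and> (\<forall>X. holds P X (F X) \<psi>)) \<longrightarrow>
                (\<exists>F. causal F \<and> mlo_defines P (f \<psi>) F \<and> (\<forall>X. holds P X (F X) \<psi>))) \<and>
               ((\<exists>G. strongly_causal G \<and> mlo_definable P G \<and> (\<forall>Y. \<not> holds P (G Y) Y \<psi>)) \<longrightarrow>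
                (\<exists>G. strongly_causal G \<and> mlo_defines P (g \<psi>) G \<and> (\<forall>Y. \<not> holds P (G Y) Y \<psi>)))))"
proof (rule conjI)
  show "\<forall>\<psi> P. formula_XY \<psi> \<longrightarrow>
            (\<exists>F. causal F \<and> mlo_definable P F \<and> (\<forall>X. holds P X (F X) \<psi>)) \<or>
            (\<exists>G. strongly_causal G \<and> mlo_definable P G \<and> (\<forall>Y. \<not> holds P (G Y) Y \<psi>))"
    using determined unfolding mlo_definable_def by blast
  define f where "f \<psi> = solution False (mlo_code \<psi>) \<psi>" for \<psi>
  define g where "g \<psi> = solution True (mlo_code \<psi>) (Neg (swapF \<psi>))" for \<psi>
  have det: "(\<exists>F. causal F \<and> mlo_defines P (f \<psi>) F \<and> (\<forall>X. holds P X (F X) \<psi>)) \<or>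
      (\<exists>G. strongly_causal G \<and> mlo_defines P (g \<psi>) G \<and> (\<forall>Y. \<not> holds P (G Y) Y \<psi>))" if "formula_XY \<psi>" for \<psi> P
    using determined[OF that] unfolding f_def g_def .
  show "\<exists>f g. computable f \<and> computable g \<and>
            (\<forall>\<psi> P. formula_XY \<psi> \<longrightarrow>
               ((\<exists>F. causal F \<and> mlo_definable P F \<and> (\<forall>X. holds P X (F X) \<psi>)) \<longrightarrow>
                (\<exists>F. causal F \<and> mlo_defines P (f \<psi>) F \<and> (\<forall>X. holds P X (F X) \<psi>))) \<and>
               ((\<exists>G. strongly_causal G \<and> mlo_definable P G \<and> (\<forall>Y. \<not> holds P (G Y) Y \<psi>)) \<longrightarrow>
                (\<exists>G. strongly_causal G \<and> mlo_defines P (g \<psi>) G \<and> (\<forall>Y. \<not> holds P (G Y) Y \<psi>))))"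
  proof (rule exI[of _ f], rule exI[of _ g], intro conjI allI impI)
    show "computable f" unfolding f_def by (rule computable_solution[OF nrec_code])
    show "computable g" unfolding g_def by (rule computable_solution[OF nrec_swapF])
  next
    fix \<psi> P
    assume \<psi>: "formula_XY \<psi>" and "\<exists>F. causal F \<and> mlo_definable P F \<and> (\<forall>X. holds P X (F X) \<psi>)"
    then obtain F where "causal F" "\<And>X. holds P X (F X) \<psi>" by blast
    \<comment> \<open>Any winning causal operator refutes the opponent's alternative in
      \<open>det\<close>. What remains is that \<open>f \<psi>\<close> defines a winning operator,
      possibly a different one from \<open>F\<close>.\<close>
    then have "\<not> (\<exists>G. strongly_causal G \<and> mlo_defines P (g \<psi>) G \<and> (\<forall>Y. \<not> holds P (G Y) Y \<psi>))"
      using not_both_win[of F _ P \<psi>] by blast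
    then show "\<exists>F. causal F \<and> mlo_defines P (f \<psi>) F \<and> (\<forall>X. holds P X (F X) \<psi>)" using det[OF \<psi>, of P] by argo
  next
    fix \<psi> P
    assume \<psi>: "formula_XY \<psi>" and "\<exists>G. strongly_causal G \<and> mlo_definable P G \<and> (\<forall>Y. \<not> holds P (G Y) Y \<psi>)"
    then obtain G where "strongly_causal G" "\<And>Y. \<not> holds P (G Y) Y \<psi>" by blast
    then have "\<not> (\<exists>F. causal F \<and> mlo_defines P (f \<psi>) F \<and> (\<forall>X. holds P X (F X) \<psi>))"
      using not_both_win[of _ G P \<psi>] by blast
    then show "\<exists>G. strongly_causal G \<and> mlo_defines P (g \<psi>) G \<and> (\<forall>Y. \<not> holds P (G Y) Y \<psi>)" using det[OF \<psi>, of P] by argo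
  qed
qed

end
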